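(* Let $0\to\mathfrak n\xrightarrow{\iota}\hat{\mathfrak g}\xrightarrow{\pi}\mathfrak g\to0$ be an extension of $L_\infty$-algebras, let $h$ be a section of it with curvature $K_h\in C^1(\mathfrak g,\mathfrak n[1])$, and let $(\mathbb V,\rho)$ be a representation up to homotopy of $\mathfrak g$. Let $k\ge1$ and let $f\in\underline{\mathrm{Hom}}^{p}(\wedge^k\mathfrak n[1],\mathbb V)^{\hat{\mathfrak g}}$ be of degree $p$. Then: 1. the element $f_{K_h}:=f\circ K_h^{\wedge k}\in C^{p+k}(\mathfrak g,\mathbb V)$ is a cocycle in the complex $(C(\mathfrak g,\mathbb V),D_\rho)$; 2. the cohomology class $[f_{K_h}]\in H^{p+k}(\mathfrak g,\mathbb V)$ does not depend on the section $h$.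
   Context: Vector spaces are over $\mathbb R$. For graded vector spaces $V,W$, $\underline{\mathrm{Hom}}^p(V,W)$ is the space of linear maps homogeneous of degree $p$; $(f\otimes g)(v\otimes w)=(-1)^{|g||v|}f(v)\otimes g(w)$ for homogeneous maps; $V[1]_n=V_{n+1}$. $S(V)=\bigoplus_{n\ge0}S^n(V)$ is the graded symmetric algebra with product $\vee$ (also written $\mu$) and coproduct $$\Delta(v_1\vee\cdots\vee v_n)=\sum_{k=0}^n\sum_{\sigma\in Sh(k,n-k)}\epsilon(\sigma)(v_{\sigma(1)}\vee\cdots\vee v_{\sigma(k)})\otimes(v_{\sigma(k+1)}\vee\cdots\vee v_{\sigma(n)}),$$ with $Sh(k,n-k)$ the permutations increasing on $\{1,\dots,k\}$ and on $\{k+1,\dots,n\}$, $\epsilon(\sigma)$ the Koszul sign. The exterior power $\wedge^kV$ is the quotient of $V^{\otimes k}$ by the span of all $v_1\otimes\cdots\otimes v_k-\mathrm{sgn}(\sigma)\epsilon(\sigma)v_{\sigma(1)}\otimes\cdots\otimes v_{\sigma(k)}$. An $L_\infty$-algebra is a graded vector space $\mathfrak g=\bigoplus_{n\le 0}\mathfrak g_n$ with degree 1 maps $\lambda_k:S^k(\mathfrak g[1])\to\mathfrak g[1]$, $k\ge1$, such that with $\lambda=\sum_k\lambda_k$ ($\lambda(1)=0$) the coderivation $d_\lambda=\mu\circ(\lambda\otimes\mathrm{Id})\circ\Delta$ satisfies $d_\lambda^2=0$. An $L_\infty$-morphism $F:\mathfrak g\to\mathfrak g'$ is a degree 0 coalgebra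 morphism $F:S(\mathfrak g[1])\to S(\mathfrak g'[1])$, $F(1)=1$, commuting with the coderivations; it is strict if $F=S(F^1_1)$ for a linear map $F_1^1:\mathfrak g[1]\to\mathfrak g'[1]$, where $S(F^1_1)(v_1\vee\cdots\vee v_n)=F^1_1(v_1)\vee\cdots\vee F^1_1(v_n)$. A representation up to homotopy (ruth) of $(\mathfrak g,\lambda)$ on $\mathbb V$ is a degree 1 map $\rho:S(\mathfrak g[1])\otimes\mathbb V\to\mathbb V$ with $\rho\circ(d_\lambda\otimes\mathrm{Id})+\rho\circ(\mathrm{Id}\otimes\rho)\circ(\Delta\otimes\mathrm{Id})=0$. $C^p(\mathfrak g,\mathbb V)=\underline{\mathrm{Hom}}^p(S(\mathfrak g[1]),\mathbb V)$, with differential $D_\rho\alpha=\rho\circ(\mathrm{Id}\otimes\alpha)\circ\Delta-(-1)^p\alpha\circ d_\lambda$ for $\alpha\in C^p$; $H(\mathfrak g,\mathbb V)$ is its cohomology. An extension of $L_\infty$-algebras is a short exact sequence $0\to\mathfrak n\xrightarrow{\iota}\hat{\mathfrak g}\xrightarrow{\pi}\mathfrak g\to0$ with $\iota,\pi$ strict $L_\infty$-morphisms; $\mathfrak n$ is identified with its image. Let $\lambda,\hat\lambda$ be the structure maps of $\mathfrak g,\hat{\mathfrak g}$. A section is a degree 0 linear map $h:\mathfrak g[1]\to\hat{\mathfrak g}[1]$ with $\pi^1_1\circ h=\mathrm{Id}$. Its curvature is the degree 1 map $K_h=\hat\lambda\circ S(h)-h\circ\lambda:S(\mathfrak g[1])\to\mathfrak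 n[1]$ (it takes values in $\mathfrak n[1]$). The adjoint ruth of $\hat{\mathfrak g}$ restricts to the ruth $\mathrm{ad}|_{\mathfrak n}(x\otimes y)=\hat\lambda(x\vee y)$ of $\hat{\mathfrak g}$ on $\mathfrak n[1]$. The induced ruth $\wedge^k\mathrm{ad}|_{\mathfrak n}$ on $\wedge^k\mathfrak n[1]$ is induced by the ruth on $\mathfrak n[1]^{\otimes k}$ given by $x\otimes v_1\otimes\cdots\otimes v_k\mapsto\sum_{i=1}^k(-1)^{(|x|+1)(|v_1|+\cdots+|v_{i-1}|)}v_1\otimes\cdots\otimes\mathrm{ad}|_{\mathfrak n}(x\otimes v_i)\otimes\cdots\otimes v_k$. View $\mathbb V$ as a ruth of $\hat{\mathfrak g}$ via $\pi^*\rho=\rho\circ(\pi\otimes\mathrm{Id})$. $\underline{\mathrm{Hom}}^{p}(\wedge^k\mathfrak n[1],\mathbb V)^{\hat{\mathfrak g}}$ is the space of $f\in\underline{\mathrm{Hom}}^p(\wedge^k\mathfrak n[1],\mathbb V)$ that are ruth maps: $f\circ(\wedge^k\mathrm{ad}|_{\mathfrak n})=(-1)^p\,\pi^*\rho\circ(\mathrm{Id}\otimes f)$. $K_h^{\wedge k}=(K_h\otimes\cdots\otimes K_h)\circ\Delta^{k-1}\in C^k(\mathfrak g,\mathfrak n[1]^{\otimes k})$, where $\Delta^{k-1}:S(\mathfrak g[1])\to S(\mathfrak g[1])^{\otimes k}$ is the iterated coproduct; $f\circ K_h^{\wedge k}$ is formed via the projection $\mathfrak n[1]^{\otimes k}\to\wedge^k\mathfrak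 n[1]$. *)

theory Defs
  imports "HOL-Analysis.Finite_Function_Topology" "HOL-Combinatorics.Permutations"
begin

section \<open>Graded vector spaces\<close>

text \<open>
  A graded real vector space is a type \<open>'a\<close> of this class. The grading
  \<open>V = (\<Oplus>n. V\<^sub>n)\<close> is given by the projections \<open>hproj n\<close> onto the summands;
  the summand of degree \<open>n\<close> itself is \<open>gcomp n\<close> below.
\<close>

class graded_vector = real_vector +
  fixes hproj :: "int \<Rightarrow> 'a \<Rightarrow> 'a"
  assumes hproj_add: "hproj n (x + y) = hproj n x + hproj n y"
    and hproj_scaleR: "hproj n (c *\<^sub>R x) = c *\<^sub>R hproj n x"
    and hproj_hproj: "hproj m (hproj n x) = (if m = n then hproj n x else 0)"
    and finite_hproj: "finite {n. hproj n x \<noteq> 0}"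
    and sum_hproj: "(\<Sum>n | hproj n x \<noteq> 0. hproj n x) = x"

definition gcomp :: "int \<Rightarrow> 'a::graded_vector set" where
  "gcomp n = {x. hproj n x = x}"

definition degs :: "'a::graded_vector \<Rightarrow> int set" where
  "degs x = {n. hproj n x \<noteq> 0}"

definition Hom :: "int \<Rightarrow> ('a::graded_vector \<Rightarrow> 'b::graded_vector) set" where
  "Hom p = {f. linear f \<and> (\<forall>n. f ` gcomp n \<subseteq> gcomp (n + p))}"

abbreviation msgn :: "int \<Rightarrow> real" where
  "msgn n \<equiv> (-1) powi n"

lemma linear_hproj: "linear (hproj n)"
  by (rule linearI) (simp_all add: hproj_add hproj_scaleR)

lemma finite_degs [simp]: "finite (degs x)"
  by (simp add: degs_def finite_hproj)

lemma sum_degs: "(\<Sum>n\<in>degs x. hproj n x) = x"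
  by (simp add: degs_def sum_hproj)

lemma hproj_gcomp: "hproj n x \<in> gcomp n"
  by (simp add: gcomp_def hproj_hproj)

lemma hproj_0 [simp]: "hproj n 0 = 0"
  by (rule linear_0[OF linear_hproj])

lemma hproj_homogeneous: "x \<in> gcomp d \<Longrightarrow> hproj n x = (if n = d then x else 0)"
  unfolding gcomp_def using hproj_hproj[of n d x] by auto

lemma degs_homogeneous: "x \<in> gcomp d \<Longrightarrow> degs x = (if x = 0 then {} else {d})"
  by (auto simp: degs_def hproj_homogeneous)

lemma sum_degs_superset:
  assumes "finite A" "degs x \<subseteq> A" "\<And>d. linear (G d)"
  shows "(\<Sum>d\<in>degs x. G d (hproj d x)) = (\<Sum>d\<in>A. G d (hproj d x))"
  using assms by (intro sum.mono_neutral_left) (auto simp: degs_def linear_0)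

lemma linear_sum_degs:
  assumes G: "\<And>d. linear (G d)"
  shows "linear (\<lambda>x::'a::graded_vector. \<Sum>d\<in>degs x. G d (hproj d x) :: 'b::real_vector)"
proof (rule linearI)
  fix x y :: 'a
  let ?A = "degs x \<union> degs y \<union> degs (x + y)"
  have e: "(\<Sum>d\<in>degs z. G d (hproj d z)) = (\<Sum>d\<in>?A. G d (hproj d z))" if "z \<in> {x, y, x + y}" for z
    using that by (intro sum_degs_superset G) auto
  show "(\<Sum>d\<in>degs (x + y). G d (hproj d (x + y))) =
    (\<Sum>d\<in>degs x. G d (hproj d x)) + (\<Sum>d\<in>degs y. G d (hproj d y))"
    unfolding e[of x, simplified] e[of y, simplified] e[of "x + y", simplified]
    by (simp add: hproj_add linear_add[OF G] sum.distrib)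
next
  fix c :: real and x :: 'a
  let ?A = "degs x \<union> degs (c *\<^sub>R x)"
  have e: "(\<Sum>d\<in>degs z. G d (hproj d z)) = (\<Sum>d\<in>?A. G d (hproj d z))" if "z \<in> {x, c *\<^sub>R x}" for z
    using that by (intro sum_degs_superset G) auto
  show "(\<Sum>d\<in>degs (c *\<^sub>R x). G d (hproj d (c *\<^sub>R x))) = c *\<^sub>R (\<Sum>d\<in>degs x. G d (hproj d x))"
    unfolding e[of x, simplified] e[of "c *\<^sub>R x", simplified]
    by (simp add: hproj_scaleR linear_scale[OF G] scaleR_right.sum)
qed

lemma grading_from_generators:
  fixes P :: "int \<Rightarrow> 'a::real_vector \<Rightarrow> 'a"
  assumes lin: "\<And>n. linear (P n)" and sp: "span G = UNIV"
    and G: "\<And>g. g \<in> G \<Longrightarrow> \<exists>d. \<forall>n. P n g = (if n = d then g else 0)"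
  shows "P m (P n x) = (if m = n then P n x else 0)"
    and "finite {n. P n x \<noteq> 0}"
    and "(\<Sum>n | P n x \<noteq> 0. P n x) = x"
proof -
  have "\<forall>m n. P m (P n x) = (if m = n then P n x else 0)"
  proof (rule span_induct[of x G "\<lambda>x. \<forall>m n. P m (P n x) = (if m = n then P n x else 0)", simplified mem_Collect_eq])
    show "x \<in> span G" by (simp add: sp)
    show "subspace {x. \<forall>m n. P m (P n x) = (if m = n then P n x else 0)}"
      by (rule subspaceI) (auto simp: linear_0[OF lin] linear_add[OF lin] linear_scale[OF lin])
    fix g assume "g \<in> G"
    then obtain d where d: "\<And>n. P n g = (if n = d then g else 0)" using G by blast
    show "\<forall>m n. P m (P n g) = (if m = n then P n g else 0)"
      by (simp add: d linear_0[OF lin])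
  qed
  then show "P m (P n x) = (if m = n then P n x else 0)" by simp
  have ex: "\<exists>N. finite N \<and> (\<forall>n. n \<notin> N \<longrightarrow> P n x = 0) \<and> (\<Sum>n\<in>N. P n x) = x"
  proof (rule span_induct[of x G "\<lambda>x. \<exists>N. finite N \<and> (\<forall>n. n \<notin> N \<longrightarrow> P n x = 0) \<and> (\<Sum>n\<in>N. P n x) = x", simplified mem_Collect_eq])
    show "x \<in> span G" by (simp add: sp)
    show "subspace {x. \<exists>N. finite N \<and> (\<forall>n. n \<notin> N \<longrightarrow> P n x = 0) \<and> (\<Sum>n\<in>N. P n x) = x}"
    proof (rule subspaceI, goal_cases)
      case 1 show ?case by (auto simp: linear_0[OF lin])
    next
      case (2 x y)
      then obtain N M where N: "finite N" "\<forall>n. n \<notin> N \<longrightarrow> P n x = 0" "(\<Sum>n\<in>N. P n x) = x"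
        and M: "finite M" "\<forall>n. n \<notin> M \<longrightarrow> P n y = 0" "(\<Sum>n\<in>M. P n y) = y" by auto
      have "(\<Sum>n\<in>N \<union> M. P n x) = x"
        using N M by (metis (no_types, lifting) DiffD2 Un_upper1 finite_Un sum.mono_neutral_left)
      moreover have "(\<Sum>n\<in>N \<union> M. P n y) = y"
        using N M by (metis (no_types, lifting) DiffD2 Un_upper2 finite_Un sum.mono_neutral_left)
      ultimately have "(\<Sum>n\<in>N \<union> M. P n (x + y)) = x + y"
        by (simp add: linear_add[OF lin] sum.distrib)
      with N M show ?case
        by (intro CollectI exI[of _ "N \<union> M"]) (auto simp: linear_add[OF lin])
    next
      case (3 c x)
      then obtain N where "finite N" "\<forall>n. n \<notin> N \<longrightarrow> P n x = 0" "(\<Sum>n\<in>N. P n x) = x" by auto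
      then show ?case
        by (intro CollectI exI[of _ N]) (auto simp: linear_scale[OF lin] simp flip: scaleR_right.sum)
    qed
    fix g assume "g \<in> G"
    then obtain d where d: "\<And>n. P n g = (if n = d then g else 0)" using G by blast
    show "\<exists>N. finite N \<and> (\<forall>n. n \<notin> N \<longrightarrow> P n g = 0) \<and> (\<Sum>n\<in>N. P n g) = g"
      by (rule exI[of _ "{d}"]) (simp add: d)
  qed
  then obtain N where N: "finite N" "\<forall>n. n \<notin> N \<longrightarrow> P n x = 0" "(\<Sum>n\<in>N. P n x) = x" by blast
  have sub: "{n. P n x \<noteq> 0} \<subseteq> N" using N(2) by auto
  then show "finite {n. P n x \<noteq> 0}" using N(1) finite_subset by blast
  have "(\<Sum>n | P n x \<noteq> 0. P n x) = (\<Sum>n\<in>N. P n x)"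
    using sub N(1) by (intro sum.mono_neutral_left) auto
  then show "(\<Sum>n | P n x \<noteq> 0. P n x) = x" using N(3) by simp
qed

subsection \<open>The shift \<open>V[1]\<close>\<close>

typedef 'a shift = "UNIV :: 'a set" morphisms unshift Shift
  by simp

setup_lifting type_definition_shift

instantiation shift :: (real_vector) real_vector
begin

lift_definition zero_shift :: "'a shift" is 0 .
lift_definition plus_shift :: "'a shift \<Rightarrow> 'a shift \<Rightarrow> 'a shift" is "(+)" .
lift_definition uminus_shift :: "'a shift \<Rightarrow> 'a shift" is uminus .
lift_definition minus_shift :: "'a shift \<Rightarrow> 'a shift \<Rightarrow> 'a shift" is "(-)" .
lift_definition scaleR_shift :: "real \<Rightarrow> 'a shift \<Rightarrow> 'a shift" is scaleR .
instance
proof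
  fix a b c :: "'a shift" and r s :: real
  show "a + b + c = a + (b + c)" by transfer (rule add.assoc)
  show "a + b = b + a" by transfer (rule add.commute)
  show "0 + a = a" by transfer simp
  show "- a + a = 0" by transfer simp
  show "a - b = a + - b" by transfer simp
  show "r *\<^sub>R (a + b) = r *\<^sub>R a + r *\<^sub>R b" by transfer (rule scaleR_add_right)
  show "(r + s) *\<^sub>R a = r *\<^sub>R a + s *\<^sub>R a" by transfer (rule scaleR_add_left)
  show "r *\<^sub>R s *\<^sub>R a = (r * s) *\<^sub>R a" by transfer simp
  show "1 *\<^sub>R a = a" by transfer simp
qed

end

instantiation shift :: (graded_vector) graded_vector
begin

lift_definition hproj_shift :: "int \<Rightarrow> 'a shift \<Rightarrow> 'a shift" is "\<lambda>n. hproj (n + 1)" .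

instance
proof
  fix m n :: int and x :: "'a shift"
  show "hproj n (x + y) = hproj n x + hproj n y" for y
    by transfer (rule hproj_add)
  show "hproj n (c *\<^sub>R x) = c *\<^sub>R hproj n x" for c
    by transfer (rule hproj_scaleR)
  show "hproj m (hproj n x) = (if m = n then hproj n x else 0)"
    by transfer (simp add: hproj_hproj)
  have eq: "{n. hproj n x \<noteq> 0} = (\<lambda>n. n - 1) ` degs (unshift x)"
    by (transfer, force simp: degs_def image_iff)
  then show "finite {n. hproj n x \<noteq> 0}" by simp
  have us: "unshift (\<Sum>n\<in>A. f n) = (\<Sum>n\<in>A. unshift (f n))" for A :: "int set" and f :: "int \<Rightarrow> 'a shift"
    by (induction A rule: infinite_finite_induct) (simp_all add: zero_shift.rep_eq plus_shift.rep_eq)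
  have "unshift (\<Sum>n | hproj n x \<noteq> 0. hproj n x) = (\<Sum>n\<in>(\<lambda>n. n - 1) ` degs (unshift x). hproj (n + 1) (unshift x))"
    by (simp add: us eq hproj_shift.rep_eq)
  also have "\<dots> = unshift x"
    by (subst sum.reindex) (auto simp: inj_on_def sum_degs)
  finally show "(\<Sum>n | hproj n x \<noteq> 0. hproj n x) = x" by (simp add: unshift_inject)
qed

end

section \<open>Tensor products\<close>

definition lin_ext :: "('x \<Rightarrow> 'b::real_vector) \<Rightarrow> ('x \<Rightarrow>\<^sub>0 real) \<Rightarrow> 'b" where
  "lin_ext \<phi> p = (\<Sum>x\<in>Poly_Mapping.keys p. Poly_Mapping.lookup p x *\<^sub>R \<phi> x)"

abbreviation gen :: "'x \<Rightarrow> 'x \<Rightarrow>\<^sub>0 real" where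
  "gen x \<equiv> Poly_Mapping.single x 1"

lemma lookup_scaleR: "Poly_Mapping.lookup (c *\<^sub>R p) x = c *\<^sub>R Poly_Mapping.lookup p x"
  for p :: "'x \<Rightarrow>\<^sub>0 real"
proof -
  have "finite {x. c * Poly_Mapping.lookup p x \<noteq> 0}"
    by (rule finite_subset[OF _ finite_lookup[of p]]) auto
  then show ?thesis by (simp add: scaleR_poly_mapping_def)
qed

lemma lin_ext_superset:
  assumes "finite A" "Poly_Mapping.keys p \<subseteq> A"
  shows "lin_ext \<phi> p = (\<Sum>x\<in>A. Poly_Mapping.lookup p x *\<^sub>R \<phi> x)"
  unfolding lin_ext_def using assms by (intro sum.mono_neutral_left) (auto simp: in_keys_iff)

lemma linear_lin_ext: "linear (lin_ext \<phi>)"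
proof (rule linearI)
  fix p q :: "'a \<Rightarrow>\<^sub>0 real"
  let ?A = "Poly_Mapping.keys p \<union> Poly_Mapping.keys q \<union> Poly_Mapping.keys (p + q)"
  have "lin_ext \<phi> z = (\<Sum>x\<in>?A. Poly_Mapping.lookup z x *\<^sub>R \<phi> x)" if "z \<in> {p, q, p + q}" for z
    using that by (intro lin_ext_superset) auto
  then show "lin_ext \<phi> (p + q) = lin_ext \<phi> p + lin_ext \<phi> q"
    by (simp add: lookup_add scaleR_add_left sum.distrib)
next
  fix c and p :: "'a \<Rightarrow>\<^sub>0 real"
  let ?A = "Poly_Mapping.keys p \<union> Poly_Mapping.keys (c *\<^sub>R p)"
  have "lin_ext \<phi> z = (\<Sum>x\<in>?A. Poly_Mapping.lookup z x *\<^sub>R \<phi> x)" if "z \<in> {p, c *\<^sub>R p}" for z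
    using that by (intro lin_ext_superset) auto
  then show "lin_ext \<phi> (c *\<^sub>R p) = c *\<^sub>R lin_ext \<phi> p"
    by (simp add: lookup_scaleR scaleR_right.sum)
qed

lemma lin_ext_gen [simp]: "lin_ext \<phi> (gen x) = \<phi> x"
  by (simp add: lin_ext_def)

lemma span_gen: "span (range gen) = (UNIV :: ('x \<Rightarrow>\<^sub>0 real) set)"
proof -
  have "p = lin_ext gen p" for p :: "'x \<Rightarrow>\<^sub>0 real"
    by (rule poly_mapping_eqI)
       (simp add: lin_ext_def lookup_sum lookup_scaleR lookup_single when_def in_keys_iff if_distrib cong: if_cong)
  moreover have "lin_ext gen p \<in> span (range gen)" for p :: "'x \<Rightarrow>\<^sub>0 real"
    unfolding lin_ext_def by (intro span_sum span_scale span_base) auto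
  ultimately show ?thesis by (metis UNIV_eq_I)
qed

lemma linear_vanish_span:
  assumes "linear f" "\<And>r. r \<in> R \<Longrightarrow> f r = 0" "x \<in> span R" shows "f x = 0"
  using linear_eq_0_on_span[OF assms(1) _ assms(3)] assms(2) by blast

lemma equivp_span: "equivp (\<lambda>x y. x - y \<in> span R)"
proof (rule equivpI)
  show "reflp (\<lambda>x y. x - y \<in> span R)" by (simp add: reflp_def span_zero)
  show "symp (\<lambda>x y. x - y \<in> span R)" unfolding symp_def by (metis minus_diff_eq span_neg)
  show "transp (\<lambda>x y. x - y \<in> span R)"
    unfolding transp_def using span_add by fastforce
qed

lemma span_cong_add:
  "x - y \<in> span R \<Longrightarrow> x' - y' \<in> span R \<Longrightarrow> (x + x') - (y + y') \<in> span R"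
  using span_add[of "x - y" R "x' - y'"] by (simp add: algebra_simps)

lemma span_cong_diff:
  "x - y \<in> span R \<Longrightarrow> x' - y' \<in> span R \<Longrightarrow> (x - x') - (y - y') \<in> span R"
  using span_diff[of "x - y" R "x' - y'"] by (simp add: algebra_simps)

lemma span_cong_uminus: "x - y \<in> span R \<Longrightarrow> (- x) - (- y) \<in> span R"
  using span_neg[of "x - y" R] by (simp add: algebra_simps)

lemma span_cong_scale: "x - y \<in> span R \<Longrightarrow> c *\<^sub>R x - c *\<^sub>R y \<in> span R"
  using span_scale[of "x - y" R c] by (simp add: algebra_simps)

subsection \<open>The tensor product of two spaces\<close>

definition bilinear_rels :: "('a::real_vector \<times> 'b::real_vector \<Rightarrow>\<^sub>0 real) set" where
  "bilinear_rels =
     {gen (x + x', y) - (gen (x, y) + gen (x', y)) | x x' y. True} \<union>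
     {gen (x, y + y') - (gen (x, y) + gen (x, y')) | x y y'. True} \<union>
     {gen (c *\<^sub>R x, y) - c *\<^sub>R gen (x, y) | c x y. True} \<union>
     {gen (x, c *\<^sub>R y) - c *\<^sub>R gen (x, y) | c x y. True}"

quotient_type (overloaded) ('a, 'b) tensor (infixr "\<otimes>" 75) =
  "'a::real_vector \<times> 'b::real_vector \<Rightarrow>\<^sub>0 real" / "\<lambda>x y. x - y \<in> span bilinear_rels"
  by (rule equivp_span)

instantiation tensor :: (real_vector, real_vector) real_vector
begin

lift_definition zero_tensor :: "'a \<otimes> 'b" is 0 .
lift_definition plus_tensor :: "'a \<otimes> 'b \<Rightarrow> 'a \<otimes> 'b \<Rightarrow> 'a \<otimes> 'b" is "(+)" by (rule span_cong_add)
lift_definition uminus_tensor :: "'a \<otimes> 'b \<Rightarrow> 'a \<otimes> 'b" is uminus by (rule span_cong_uminus)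
lift_definition minus_tensor :: "'a \<otimes> 'b \<Rightarrow> 'a \<otimes> 'b \<Rightarrow> 'a \<otimes> 'b" is "(-)" by (rule span_cong_diff)
lift_definition scaleR_tensor :: "real \<Rightarrow> 'a \<otimes> 'b \<Rightarrow> 'a \<otimes> 'b" is scaleR by (rule span_cong_scale)

instance
  by standard (transfer; simp add: algebra_simps span_zero)+

end

lift_definition tens :: "'a::real_vector \<Rightarrow> 'b::real_vector \<Rightarrow> 'a \<otimes> 'b" (infixr "\<otimes>" 75)
  is "\<lambda>x y. gen (x, y)" .

text \<open>
  The linear map \<open>x \<otimes> y \<mapsto> \<phi> x y\<close>. It is meant for bilinear \<open>\<phi>\<close>, for which the
  choice of representative made by \<open>rep_tensor\<close> is immaterial.
\<close>

definition tensor_lift :: "('a::real_vector \<Rightarrow> 'b::real_vector \<Rightarrow> 'c::real_vector) \<Rightarrow> 'a \<otimes> 'b \<Rightarrow> 'c" where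
  "tensor_lift \<phi> t = lin_ext (\<lambda>(x, y). \<phi> x y) (rep_tensor t)"

lemma linear_abs_tensor: "linear abs_tensor"
  by (rule linearI) (simp_all add: plus_tensor.abs_eq scaleR_tensor.abs_eq)

lemma abs_rep_tensor: "abs_tensor (rep_tensor t) = t"
  by (rule Quotient_abs_rep[OF Quotient_tensor])

lemma abs_tensor_eq_iff: "abs_tensor x = abs_tensor y \<longleftrightarrow> x - y \<in> span bilinear_rels"
  using tensor.abs_eq_iff by blast

lemma span_tens: "span {x \<otimes> y | x y. True} = (UNIV :: ('a::real_vector \<otimes> 'b::real_vector) set)"
proof -
  have "(UNIV :: ('a \<otimes> 'b) set) = abs_tensor ` span (range gen)"
    using abs_rep_tensor by (metis UNIV_eq_I rangeI span_gen)
  also have "\<dots> = span (abs_tensor ` range gen)"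
    by (simp add: linear_span_image[OF linear_abs_tensor])
  also have "abs_tensor ` range gen = {x \<otimes> y | x y. True}"
    by (auto simp: tens.abs_eq image_iff)
  finally show ?thesis by simp
qed

lemma bilinear_rels:
  "gen (x + x', y) - (gen (x, y) + gen (x', y)) \<in> bilinear_rels"
  "gen (x, y + y') - (gen (x, y) + gen (x, y')) \<in> bilinear_rels"
  "gen (c *\<^sub>R x, y) - c *\<^sub>R gen (x, y) \<in> bilinear_rels"
  "gen (x, c *\<^sub>R y) - c *\<^sub>R gen (x, y) \<in> bilinear_rels"
  unfolding bilinear_rels_def by blast+

lemma linear_tens_left: "linear (\<lambda>x. x \<otimes> y)"
  by (rule linearI; transfer) (intro span_base bilinear_rels)+

lemma linear_tens_right: "linear (\<lambda>y. x \<otimes> y)"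
  by (rule linearI; transfer) (intro span_base bilinear_rels)+

lemma
  fixes \<phi> :: "'a::real_vector \<Rightarrow> 'b::real_vector \<Rightarrow> 'c::real_vector"
  assumes l: "\<And>y. linear (\<lambda>x. \<phi> x y)" and r: "\<And>x. linear (\<phi> x)"
  shows linear_tensor_lift: "linear (tensor_lift \<phi>)"
    and tensor_lift_tens [simp]: "tensor_lift \<phi> (x \<otimes> y) = \<phi> x y"
proof -
  let ?f = "lin_ext (\<lambda>(x, y). \<phi> x y)"
  have "?f z = 0" if "z \<in> span bilinear_rels" for z
  proof (rule linear_vanish_span[OF linear_lin_ext _ that])
    fix z assume "z \<in> (bilinear_rels :: ('a \<times> 'b \<Rightarrow>\<^sub>0 real) set)"
    then show "?f z = 0"
      by (auto simp: bilinear_rels_def linear_diff[OF linear_lin_ext] linear_scale[OF linear_lin_ext]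
          linear_add[OF linear_lin_ext] linear_add[OF l] linear_add[OF r] linear_scale[OF l] linear_scale[OF r])
  qed
  then have "?f z - ?f w = 0" if "abs_tensor z = abs_tensor w" for z w
    using that by (simp add: abs_tensor_eq_iff flip: linear_diff[OF linear_lin_ext])
  from this[of "rep_tensor (abs_tensor z)" z for z]
  have abs: "tensor_lift \<phi> (abs_tensor z) = ?f z" for z
    by (simp add: tensor_lift_def abs_rep_tensor)
  then show "tensor_lift \<phi> (x \<otimes> y) = \<phi> x y" by (simp add: tens.abs_eq)
  show "linear (tensor_lift \<phi>)"
  proof (rule linearI)
    fix s t show "tensor_lift \<phi> (s + t) = tensor_lift \<phi> s + tensor_lift \<phi> t"
      by (metis abs abs_rep_tensor linear_add[OF linear_lin_ext] plus_tensor.abs_eq)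
  next
    fix c s show "tensor_lift \<phi> (c *\<^sub>R s) = c *\<^sub>R tensor_lift \<phi> s"
      by (metis abs abs_rep_tensor linear_scale[OF linear_lin_ext] scaleR_tensor.abs_eq)
  qed
qed

instantiation tensor :: (graded_vector, graded_vector) graded_vector
begin

definition hproj_tensor :: "int \<Rightarrow> 'a \<otimes> 'b \<Rightarrow> 'a \<otimes> 'b" where
  "hproj_tensor n = tensor_lift (\<lambda>x y. \<Sum>i\<in>degs x. hproj i x \<otimes> hproj (n - i) y)"

instance
proof -
  have l: "linear (\<lambda>x. \<Sum>i\<in>degs x. hproj i x \<otimes> hproj (n - i) y)" for n and y :: 'b
    by (rule linear_sum_degs) (rule linear_tens_left)
  have r: "linear (\<lambda>y. \<Sum>i\<in>degs x. hproj i x \<otimes> hproj (n - i) y)" for n and x :: 'a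
    by (intro linear_compose_sum ballI linear_compose[OF linear_hproj linear_tens_right, unfolded o_def])
  have lin: "linear (hproj n :: 'a \<otimes> 'b \<Rightarrow> _)" for n
    unfolding hproj_tensor_def by (rule linear_tensor_lift[OF l r])
  let ?G = "{x \<otimes> y | (x::'a) (y::'b) i j. x \<in> gcomp i \<and> y \<in> gcomp j}"
  have "x \<otimes> y \<in> span ?G" for x :: 'a and y :: 'b
  proof -
    have "x \<otimes> y = (\<Sum>i\<in>degs x. \<Sum>j\<in>degs y. hproj i x \<otimes> hproj j y)"
      by (simp add: linear_sum[OF linear_tens_left, symmetric] linear_sum[OF linear_tens_right, symmetric] sum_degs)
    also have "\<dots> \<in> span ?G"
      by (intro span_sum span_base) (blast intro: hproj_gcomp)
    finally show ?thesis .
  qed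
  then have "span {x \<otimes> y | (x::'a) (y::'b). True} \<subseteq> span ?G"
    by (intro span_minimal) auto
  then have sp: "span ?G = UNIV" unfolding span_tens by (rule top_le)
  have G: "\<exists>d. \<forall>n. hproj n g = (if n = d then g else 0)" if g: "g \<in> ?G" for g
  proof -
    obtain x y i j where g: "g = x \<otimes> y" and x: "x \<in> gcomp i" and y: "y \<in> gcomp j" using g by blast
    have "hproj n g = (if n = i + j then g else 0)" for n
      unfolding g hproj_tensor_def tensor_lift_tens[OF l r]
      using x y by (auto simp: degs_homogeneous hproj_homogeneous linear_0[OF linear_tens_left] linear_0[OF linear_tens_right])
    then show ?thesis by blast
  qed
  show "OFCLASS('a \<otimes> 'b, graded_vector_class)"
    by standard (simp_all only: linear_add[OF lin] linear_scale[OF lin] grading_from_generators[OF lin sp G])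
qed

end

text \<open>
  \<open>f \<otimes> g\<close> with the Koszul sign \<open>(f \<otimes> g)(v \<otimes> w) = (-1)\<^bsup>|g||v|\<^esup> f v \<otimes> g w\<close>, where \<open>q = |g|\<close>.
\<close>

definition tmap :: "int \<Rightarrow> ('a::graded_vector \<Rightarrow> 'c::real_vector) \<Rightarrow> ('b::real_vector \<Rightarrow> 'd::real_vector)
    \<Rightarrow> 'a \<otimes> 'b \<Rightarrow> 'c \<otimes> 'd" where
  "tmap q f g = tensor_lift (\<lambda>v w. \<Sum>d\<in>degs v. msgn (q * d) *\<^sub>R (f (hproj d v) \<otimes> g w))"

definition tassoc :: "('a::real_vector \<otimes> 'b::real_vector) \<otimes> 'c::real_vector \<Rightarrow> 'a \<otimes> ('b \<otimes> 'c)" where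
  "tassoc = tensor_lift (\<lambda>t z. tensor_lift (\<lambda>x y. x \<otimes> (y \<otimes> z)) t)"

lemma tmap_homogeneous:
  assumes "linear f" "linear g" "v \<in> gcomp d"
  shows "tmap q f g (v \<otimes> w) = msgn (q * d) *\<^sub>R (f v \<otimes> g w)"
proof -
  have l: "linear (\<lambda>v. \<Sum>d\<in>degs v. msgn (q * d) *\<^sub>R (f (hproj d v) \<otimes> g w))" for w
    by (rule linear_sum_degs)
       (intro linear_compose_scale_right linear_compose[OF assms(1) linear_tens_left, unfolded o_def])
  have r: "linear (\<lambda>w. \<Sum>d\<in>degs v. msgn (q * d) *\<^sub>R (f (hproj d v) \<otimes> g w))" for v
    by (intro linear_compose_sum ballI linear_compose_scale_right
        linear_compose[OF assms(2) linear_tens_right, unfolded o_def])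
  show ?thesis
    unfolding tmap_def tensor_lift_tens[OF l r]
    using assms(3) by (auto simp: degs_homogeneous hproj_homogeneous linear_0[OF assms(1)] linear_0[OF linear_tens_left])
qed

subsection \<open>Tensor powers\<close>

text \<open>
  \<open>'a talg\<close> is \<open>\<Oplus>n. V\<^bsup>\<otimes>n\<^esup>\<close>, with \<open>word [v\<^sub>1, \<dots>, v\<^sub>n] = v\<^sub>1 \<otimes> \<dots> \<otimes> v\<^sub>n\<close>.
\<close>

definition multilinear_rels :: "('a::real_vector list \<Rightarrow>\<^sub>0 real) set" where
  "multilinear_rels =
     {gen (us @ (v + w) # ws) - (gen (us @ v # ws) + gen (us @ w # ws)) | us v w ws. True} \<union>
     {gen (us @ (c *\<^sub>R v) # ws) - c *\<^sub>R gen (us @ v # ws) | us c v ws. True}"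

quotient_type (overloaded) 'a talg =
  "'a::real_vector list \<Rightarrow>\<^sub>0 real" / "\<lambda>x y. x - y \<in> span multilinear_rels"
  by (rule equivp_span)

instantiation talg :: (real_vector) real_vector
begin

lift_definition zero_talg :: "'a talg" is 0 .
lift_definition plus_talg :: "'a talg \<Rightarrow> 'a talg \<Rightarrow> 'a talg" is "(+)" by (rule span_cong_add)
lift_definition uminus_talg :: "'a talg \<Rightarrow> 'a talg" is uminus by (rule span_cong_uminus)
lift_definition minus_talg :: "'a talg \<Rightarrow> 'a talg \<Rightarrow> 'a talg" is "(-)" by (rule span_cong_diff)
lift_definition scaleR_talg :: "real \<Rightarrow> 'a talg \<Rightarrow> 'a talg" is scaleR by (rule span_cong_scale)

instance
  by standard (transfer; simp add: algebra_simps span_zero)+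

end

lift_definition word :: "'a::real_vector list \<Rightarrow> 'a talg" is gen .

definition multilinear :: "('a::real_vector list \<Rightarrow> 'b::real_vector) \<Rightarrow> bool" where
  "multilinear \<phi> \<longleftrightarrow> (\<forall>us ws. linear (\<lambda>v. \<phi> (us @ v # ws)))"

text \<open>The linear map \<open>v\<^sub>1 \<otimes> \<dots> \<otimes> v\<^sub>n \<mapsto> \<phi> [v\<^sub>1, \<dots>, v\<^sub>n]\<close>, for multilinear \<open>\<phi>\<close>.\<close>

definition talg_lift :: "('a::real_vector list \<Rightarrow> 'b::real_vector) \<Rightarrow> 'a talg \<Rightarrow> 'b" where
  "talg_lift \<phi> t = lin_ext \<phi> (rep_talg t)"

lemma multilinear_rels:
  "gen (us @ (v + w) # ws) - (gen (us @ v # ws) + gen (us @ w # ws)) \<in> multilinear_rels"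
  "gen (us @ (c *\<^sub>R v) # ws) - c *\<^sub>R gen (us @ v # ws) \<in> multilinear_rels"
  unfolding multilinear_rels_def by blast+

lemma multilinear_word: "multilinear word"
  unfolding multilinear_def
  by (intro allI, rule linearI; transfer) (intro span_base multilinear_rels)+

lemma linear_abs_talg: "linear abs_talg"
  by (rule linearI) (simp_all add: plus_talg.abs_eq scaleR_talg.abs_eq)

lemma abs_rep_talg: "abs_talg (rep_talg t) = t"
  by (rule Quotient_abs_rep[OF Quotient_talg])

lemma abs_talg_eq_iff: "abs_talg x = abs_talg y \<longleftrightarrow> x - y \<in> span multilinear_rels"
  using talg.abs_eq_iff by blast

lemma span_word: "span (range word) = (UNIV :: 'a::real_vector talg set)"
proof -
  have "(UNIV :: 'a talg set) = abs_talg ` span (range gen)"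
    using abs_rep_talg by (metis UNIV_eq_I rangeI span_gen)
  also have "\<dots> = span (abs_talg ` range gen)"
    by (simp add: linear_span_image[OF linear_abs_talg])
  also have "abs_talg ` range gen = range word"
    by (auto simp: word.abs_eq image_iff)
  finally show ?thesis by simp
qed

lemma
  fixes \<phi> :: "'a::real_vector list \<Rightarrow> 'b::real_vector"
  assumes m: "multilinear \<phi>"
  shows linear_talg_lift: "linear (talg_lift \<phi>)"
    and talg_lift_word [simp]: "talg_lift \<phi> (word vs) = \<phi> vs"
proof -
  let ?f = "lin_ext \<phi>"
  have lin: "linear (\<lambda>v. \<phi> (us @ v # ws))" for us ws using m by (simp add: multilinear_def)
  have "?f z = 0" if "z \<in> span multilinear_rels" for z
  proof (rule linear_vanish_span[OF linear_lin_ext _ that])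
    fix z assume "z \<in> (multilinear_rels :: ('a list \<Rightarrow>\<^sub>0 real) set)"
    then show "?f z = 0"
      by (auto simp: multilinear_rels_def linear_diff[OF linear_lin_ext] linear_scale[OF linear_lin_ext]
          linear_add[OF linear_lin_ext] linear_add[OF lin] linear_scale[OF lin])
  qed
  then have "?f z - ?f w = 0" if "abs_talg z = abs_talg w" for z w
    using that by (simp add: abs_talg_eq_iff flip: linear_diff[OF linear_lin_ext])
  from this[of "rep_talg (abs_talg z)" z for z]
  have abs: "talg_lift \<phi> (abs_talg z) = ?f z" for z
    by (simp add: talg_lift_def abs_rep_talg)
  then show "talg_lift \<phi> (word vs) = \<phi> vs" by (simp add: word.abs_eq)
  show "linear (talg_lift \<phi>)"
  proof (rule linearI)
    fix s t show "talg_lift \<phi> (s + t) = talg_lift \<phi> s + talg_lift \<phi> t"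
      by (metis abs abs_rep_talg linear_add[OF linear_lin_ext] plus_talg.abs_eq)
  next
    fix c s show "talg_lift \<phi> (c *\<^sub>R s) = c *\<^sub>R talg_lift \<phi> s"
      by (metis abs abs_rep_talg linear_scale[OF linear_lin_ext] scaleR_talg.abs_eq)
  qed
qed

text \<open>
  Formulas involving Koszul signs are given on homogeneous vectors only. \<open>hext \<phi>\<close>
  extends such a formula multilinearly to all vectors: \<open>\<phi> [d\<^sub>1, \<dots>, d\<^sub>n] [v\<^sub>1, \<dots>, v\<^sub>n]\<close> is
  the value on homogeneous \<open>v\<^sub>i\<close> of degree \<open>d\<^sub>i\<close>.
\<close>

fun hext :: "(int list \<Rightarrow> 'a::graded_vector list \<Rightarrow> 'b::real_vector) \<Rightarrow> 'a list \<Rightarrow> 'b" where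
  "hext \<phi> [] = \<phi> [] []"
| "hext \<phi> (v # vs) = (\<Sum>d\<in>degs v. hext (\<lambda>ds ws. \<phi> (d # ds) (hproj d v # ws)) vs)"

abbreviation homogeneous :: "int list \<Rightarrow> 'a::graded_vector list \<Rightarrow> bool" where
  "homogeneous \<equiv> list_all2 (\<lambda>d v. v \<in> gcomp d)"

lemma multilinear_Cons: "multilinear \<phi> \<Longrightarrow> multilinear (\<lambda>ws. \<phi> (v # ws))"
  unfolding multilinear_def using append_Cons by (intro allI) (simp flip: append_Cons)

lemma multilinear_zero: "multilinear \<phi> \<Longrightarrow> \<phi> (us @ 0 # ws) = 0"
  unfolding multilinear_def by (rule linear_0[of "\<lambda>v. \<phi> (us @ v # ws)"]) simp

lemma multilinear_Nil: "multilinear \<phi> \<Longrightarrow> linear (\<lambda>v. \<phi> (v # ws))"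
  unfolding multilinear_def by (drule spec[of _ "[]"]) simp

lemma linear_hext:
  "(\<And>ds us. linear (\<lambda>w. \<psi> w ds us)) \<Longrightarrow> linear (\<lambda>w. hext (\<psi> w) ws)"
  by (induction ws arbitrary: \<psi>) (auto intro!: linear_compose_sum)

lemma multilinear_hext: "(\<And>ds. multilinear (\<phi> ds)) \<Longrightarrow> multilinear (hext \<phi>)"
proof -
  have "(\<And>ds. multilinear (\<phi> ds)) \<Longrightarrow> linear (\<lambda>v. hext \<phi> (us @ v # ws))" for us ws
  proof (induction us arbitrary: \<phi>)
    case Nil
    have "linear (\<lambda>w. \<phi> ds (w # us))" for ds us
      by (rule multilinear_Nil) (rule Nil)
    then show ?case by (auto intro!: linear_sum_degs linear_hext)
  next
    case (Cons u us)
    then show ?case by (auto intro!: linear_compose_sum Cons.IH multilinear_Cons)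
  qed
  then show "(\<And>ds. multilinear (\<phi> ds)) \<Longrightarrow> multilinear (hext \<phi>)" by (simp add: multilinear_def)
qed

lemma hext_homogeneous:
  "homogeneous ds vs \<Longrightarrow> (\<And>ds. multilinear (\<phi> ds)) \<Longrightarrow> hext \<phi> vs = \<phi> ds vs"
proof (induction arbitrary: \<phi> rule: list_all2_induct)
  case Nil then show ?case by simp
next
  case (Cons d ds v vs)
  have "hext (\<lambda>es ws. \<phi> (d # es) (v # ws)) vs = \<phi> (d # ds) (v # vs)"
    by (rule Cons.IH) (intro multilinear_Cons Cons.prems)
  then show ?case
    using Cons.hyps Cons.prems multilinear_zero[of "\<phi> (d # ds)" "[]"]
    by (auto simp: degs_homogeneous hproj_homogeneous)
qed

lemma hext_multilinear: "multilinear \<phi> \<Longrightarrow> hext (\<lambda>_. \<phi>) vs = \<phi> vs"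
proof (induction vs arbitrary: \<phi>)
  case Nil then show ?case by simp
next
  case (Cons v vs)
  have lin: "linear (\<lambda>v. \<phi> (v # vs))"
    by (rule multilinear_Nil) (rule Cons.prems)
  have "hext (\<lambda>_. \<phi>) (v # vs) = (\<Sum>d\<in>degs v. \<phi> (hproj d v # vs))"
    using Cons.IH[OF multilinear_Cons[OF Cons.prems]] by simp
  also have "\<dots> = \<phi> (v # vs)"
    by (simp add: sum_degs flip: linear_sum[OF lin, unfolded o_def])
  finally show ?case .
qed

lemma hext_in_span:
  "(\<And>ds ws. homogeneous ds ws \<Longrightarrow> \<phi> ds ws \<in> span S) \<Longrightarrow> hext \<phi> vs \<in> span S"
proof (induction vs arbitrary: \<phi>)
  case Nil then show ?case by simp
next
  case (Cons v vs)
  show ?case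
    by (auto intro!: span_sum Cons.IH Cons.prems simp: hproj_gcomp)
qed

instantiation talg :: (graded_vector) graded_vector
begin

definition hproj_talg :: "int \<Rightarrow> 'a talg \<Rightarrow> 'a talg" where
  "hproj_talg n = talg_lift (hext (\<lambda>ds vs. if sum_list ds = n then word vs else 0))"

lemma multilinear_hproj_talg:
  "multilinear (\<lambda>vs :: 'a list. if b then word vs else 0)"
  using multilinear_word by (cases b) (auto simp: multilinear_def linear_zero)

lemma linear_hproj_talg: "linear (hproj n :: 'a talg \<Rightarrow> _)"
  unfolding hproj_talg_def by (intro linear_talg_lift multilinear_hext multilinear_hproj_talg)

lemma hproj_talg_word:
  assumes "homogeneous ds (vs :: 'a list)"
  shows "hproj n (word vs) = (if n = sum_list ds then word vs else 0)"
  using hext_homogeneous[OF assms multilinear_hproj_talg]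
  by (auto simp: hproj_talg_def talg_lift_word[OF multilinear_hext[OF multilinear_hproj_talg]])

lemma span_homogeneous_words: "span {word vs | ds (vs :: 'a list). homogeneous ds vs} = UNIV"
proof -
  have "hext (\<lambda>_. word) vs \<in> span {word vs | ds (vs :: 'a list). homogeneous ds vs}" for vs :: "'a list"
    by (rule hext_in_span) (auto intro: span_base)
  then have "span (range word) \<subseteq> span {word vs | ds (vs :: 'a list). homogeneous ds vs}"
    by (intro span_minimal) (auto simp: hext_multilinear[OF multilinear_word])
  then show ?thesis unfolding span_word by (rule top_le)
qed

instance
proof -
  have G: "\<exists>d. \<forall>n. hproj n g = (if n = d then g else 0)"
    if "g \<in> {word vs | ds (vs :: 'a list). homogeneous ds vs}" for g
    using that hproj_talg_word by auto
  show "OFCLASS('a talg, graded_vector_class)"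
    by standard (simp_all only: linear_add[OF linear_hproj_talg] linear_scale[OF linear_hproj_talg]
        grading_from_generators[OF linear_hproj_talg span_homogeneous_words G])
qed

end

definition talg_cons :: "'a::real_vector \<otimes> 'a talg \<Rightarrow> 'a talg" where
  "talg_cons = tensor_lift (\<lambda>v. talg_lift (\<lambda>vs. word (v # vs)))"

text \<open>
  \<open>f \<otimes> \<dots> \<otimes> f\<close> for \<open>f\<close> of degree \<open>q\<close>. The Koszul sign is that of moving the \<open>j\<close>-th
  factor \<open>f\<close> past \<open>v\<^sub>i\<close> for all \<open>i < j\<close>.
\<close>

definition tpow_map :: "int \<Rightarrow> ('a::graded_vector \<Rightarrow> 'b::real_vector) \<Rightarrow> 'a talg \<Rightarrow> 'b talg" where
  "tpow_map q f = talg_lift (hext (\<lambda>ds vs.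
     msgn (\<Sum>j<length vs. \<Sum>i<j. q * ds ! i) *\<^sub>R word (map f vs)))"

section \<open>Symmetric and exterior powers\<close>

definition koszul :: "(nat \<Rightarrow> nat) \<Rightarrow> int list \<Rightarrow> real" where
  "koszul \<sigma> ds =
     (\<Prod>(i, j) \<in> {(i, j). i < j \<and> j < length ds \<and> \<sigma> j < \<sigma> i}. msgn (ds ! \<sigma> i * ds ! \<sigma> j))"

definition perm_rels :: "((nat \<Rightarrow> nat) \<Rightarrow> int list \<Rightarrow> real) \<Rightarrow> 'a::graded_vector talg set" where
  "perm_rels c = {word vs - c \<sigma> ds *\<^sub>R word (permute_list \<sigma> vs) | vs ds \<sigma>.
     homogeneous ds vs \<and> \<sigma> permutes {..<length vs}}"

lemma hproj_perm_rels:
  assumes "x - y \<in> span (perm_rels c)"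
  shows "hproj n x - hproj n y \<in> span (perm_rels c)"
proof -
  have "hproj n z \<in> span (perm_rels c)" if "z \<in> span (perm_rels c)" for z :: "'a talg"
  proof (rule span_induct[OF that])
    show "subspace {z. hproj n z \<in> span (perm_rels c)}"
      by (rule subspaceI) (auto simp: hproj_add hproj_scaleR span_zero span_add span_scale)
    fix r :: "'a talg" assume r: "r \<in> perm_rels c"
    then obtain vs ds \<sigma> where req: "r = word vs - c \<sigma> ds *\<^sub>R word (permute_list \<sigma> vs)"
      and h: "homogeneous ds vs" and p: "\<sigma> permutes {..<length vs}"
      unfolding perm_rels_def by blast
    have len: "length ds = length vs" using h by (rule list_all2_lengthD)
    have h': "homogeneous (permute_list \<sigma> ds) (permute_list \<sigma> vs)"
      using h p len by (simp add: list_all2_permute_list_iff)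
    have "sum_list (permute_list \<sigma> ds) = sum_list ds"
      using p len by (metis mset_permute_list sum_mset_sum_list)
    then have "hproj n r = (if n = sum_list ds then r else 0)"
      by (simp add: req linear_diff[OF linear_hproj] hproj_scaleR hproj_talg_word[OF h] hproj_talg_word[OF h'])
    then show "hproj n r \<in> span (perm_rels c)" using r by (auto intro: span_base span_zero)
  qed
  from this[OF assms] show ?thesis by (simp add: linear_diff[OF linear_hproj])
qed

subsection \<open>The graded symmetric algebra \<open>S(V)\<close>\<close>

quotient_type (overloaded) 'a sym =
  "'a::graded_vector talg" / "\<lambda>x y. x - y \<in> span (perm_rels koszul)"
  by (rule equivp_span)

instantiation sym :: (graded_vector) real_vector
begin

lift_definition zero_sym :: "'a sym" is 0 .
lift_definition plus_sym :: "'a sym \<Rightarrow> 'a sym \<Rightarrow> 'a sym" is "(+)" by (rule span_cong_add)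
lift_definition uminus_sym :: "'a sym \<Rightarrow> 'a sym" is uminus by (rule span_cong_uminus)
lift_definition minus_sym :: "'a sym \<Rightarrow> 'a sym \<Rightarrow> 'a sym" is "(-)" by (rule span_cong_diff)
lift_definition scaleR_sym :: "real \<Rightarrow> 'a sym \<Rightarrow> 'a sym" is scaleR by (rule span_cong_scale)

instance
  by standard (transfer; simp add: algebra_simps span_zero)+

end

text \<open>\<open>sprod [v\<^sub>1, \<dots>, v\<^sub>n] = v\<^sub>1 \<or> \<dots> \<or> v\<^sub>n\<close>\<close>

lift_definition sprod :: "'a::graded_vector list \<Rightarrow> 'a sym" is word .

lemma linear_abs_sym: "linear abs_sym"
  by (rule linearI) (simp_all add: plus_sym.abs_eq scaleR_sym.abs_eq)

lemma abs_rep_sym: "abs_sym (rep_sym s) = s"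
  by (rule Quotient_abs_rep[OF Quotient_sym])

lemma abs_sym_eq_iff: "abs_sym x = abs_sym y \<longleftrightarrow> x - y \<in> span (perm_rels koszul)"
  using sym.abs_eq_iff by blast

instantiation sym :: (graded_vector) graded_vector
begin

lift_definition hproj_sym :: "int \<Rightarrow> 'a sym \<Rightarrow> 'a sym" is hproj
  by (rule hproj_perm_rels)

instance
proof -
  have lin: "linear (hproj n :: 'a sym \<Rightarrow> _)" for n
    by (rule linearI; transfer; simp add: hproj_add hproj_scaleR span_zero)
  let ?G = "abs_sym ` {word vs | ds (vs :: 'a list). homogeneous ds vs}"
  have "span ?G = range abs_sym"
    by (simp add: linear_span_image[OF linear_abs_sym] span_homogeneous_words)
  then have sp: "span ?G = UNIV" using abs_rep_sym by (metis surjI)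
  have G: "\<exists>d. \<forall>n. hproj n g = (if n = d then g else 0)" if g: "g \<in> ?G" for g
  proof -
    obtain ds vs where g: "g = abs_sym (word vs)" and h: "homogeneous ds vs" using g by blast
    have "hproj n g = (if n = sum_list ds then g else 0)" for n
      by (simp add: g hproj_sym.abs_eq hproj_talg_word[OF h] zero_sym.abs_eq)
    then show ?thesis by blast
  qed
  show "OFCLASS('a sym, graded_vector_class)"
    by standard (simp_all only: linear_add[OF lin] linear_scale[OF lin] grading_from_generators[OF lin sp G])
qed

end

text \<open>
  The linear map \<open>v\<^sub>1 \<or> \<dots> \<or> v\<^sub>n \<mapsto> \<phi> [v\<^sub>1, \<dots>, v\<^sub>n]\<close>, for multilinear graded symmetric \<open>\<phi>\<close>.
\<close>

definition sym_lift :: "('a::graded_vector list \<Rightarrow> 'b::real_vector) \<Rightarrow> 'a sym \<Rightarrow> 'b" where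
  "sym_lift \<phi> s = talg_lift \<phi> (rep_sym s)"

lemma
  fixes \<phi> :: "'a::graded_vector list \<Rightarrow> 'b::real_vector"
  assumes m: "multilinear \<phi>"
    and symm: "\<And>ds vs \<sigma>. homogeneous ds vs \<Longrightarrow> \<sigma> permutes {..<length vs} \<Longrightarrow>
      \<phi> vs = koszul \<sigma> ds *\<^sub>R \<phi> (permute_list \<sigma> vs)"
  shows linear_sym_lift: "linear (sym_lift \<phi>)"
    and sym_lift_sprod: "sym_lift \<phi> (sprod vs) = \<phi> vs"
proof -
  note lin = linear_talg_lift[OF m]
  have "talg_lift \<phi> z = 0" if "z \<in> span (perm_rels koszul)" for z
  proof (rule linear_vanish_span[OF lin _ that])
    fix z assume "z \<in> (perm_rels koszul :: 'a talg set)"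
    then obtain vs ds \<sigma> where z: "z = word vs - koszul \<sigma> ds *\<^sub>R word (permute_list \<sigma> vs)"
      and h: "homogeneous ds vs" and p: "\<sigma> permutes {..<length vs}"
      unfolding perm_rels_def by blast
    show "talg_lift \<phi> z = 0"
      unfolding z linear_diff[OF lin] linear_scale[OF lin] talg_lift_word[OF m]
      using symm[OF h p] by simp
  qed
  then have "talg_lift \<phi> z - talg_lift \<phi> w = 0" if "abs_sym z = abs_sym w" for z w
    using that by (simp add: abs_sym_eq_iff flip: linear_diff[OF lin])
  from this[of "rep_sym (abs_sym z)" z for z]
  have abs: "sym_lift \<phi> (abs_sym z) = talg_lift \<phi> z" for z
    by (simp add: sym_lift_def abs_rep_sym)
  then show "sym_lift \<phi> (sprod vs) = \<phi> vs" by (simp add: sprod.abs_eq talg_lift_word[OF m])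
  show "linear (sym_lift \<phi>)"
  proof (rule linearI)
    fix s t show "sym_lift \<phi> (s + t) = sym_lift \<phi> s + sym_lift \<phi> t"
      by (metis abs abs_rep_sym linear_add[OF lin] plus_sym.abs_eq)
  next
    fix c s show "sym_lift \<phi> (c *\<^sub>R s) = c *\<^sub>R sym_lift \<phi> s"
      by (metis abs abs_rep_sym linear_scale[OF lin] scaleR_sym.abs_eq)
  qed
qed

definition sym_unit :: "'a::graded_vector sym" where
  "sym_unit = sprod []"

definition sym_incl :: "'a::graded_vector \<Rightarrow> 'a sym" where
  "sym_incl v = sprod [v]"

definition sym_mult :: "'a::graded_vector sym \<otimes> 'a sym \<Rightarrow> 'a sym" where
  "sym_mult = tensor_lift (\<lambda>x y. sym_lift (\<lambda>us. sym_lift (\<lambda>vs. sprod (us @ vs)) y) x)"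

definition sym_map :: "('a::graded_vector \<Rightarrow> 'b::graded_vector) \<Rightarrow> 'a sym \<Rightarrow> 'b sym" where
  "sym_map F = sym_lift (\<lambda>vs. sprod (map F vs))"

definition Sh :: "nat \<Rightarrow> nat \<Rightarrow> (nat \<Rightarrow> nat) set" where
  "Sh k l = {\<sigma>. \<sigma> permutes {..<k + l} \<and> strict_mono_on {..<k} \<sigma> \<and> strict_mono_on {k..<k + l} \<sigma>}"

definition coprod :: "'a::graded_vector sym \<Rightarrow> 'a sym \<otimes> 'a sym" where
  "coprod = sym_lift (hext (\<lambda>ds vs. \<Sum>k\<le>length vs. \<Sum>\<sigma>\<in>Sh k (length vs - k).
     koszul \<sigma> ds *\<^sub>R
       (sprod (take k (permute_list \<sigma> vs)) \<otimes> sprod (drop k (permute_list \<sigma> vs)))))"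

text \<open>\<open>coprod_iter m = \<Delta>\<^sup>m : S(V) \<rightarrow> S(V)\<^bsup>\<otimes>(m+1)\<^esup>\<close>\<close>

primrec coprod_iter :: "nat \<Rightarrow> 'a::graded_vector sym \<Rightarrow> 'a sym talg" where
  "coprod_iter 0 x = word [x]"
| "coprod_iter (Suc m) x = talg_cons (tmap 0 id (coprod_iter m) (coprod x))"

subsection \<open>Exterior powers\<close>

text \<open>\<open>'a wedge\<close> is \<open>\<Oplus>k. \<And>\<^sup>kV\<close>, with \<open>\<And>\<^sup>kV\<close> spanned by the \<open>wprod vs\<close>, \<open>length vs = k\<close>.\<close>

quotient_type (overloaded) 'a wedge =
  "'a::graded_vector talg" / "\<lambda>x y. x - y \<in> span (perm_rels (\<lambda>\<sigma> ds. of_int (sign \<sigma>) * koszul \<sigma> ds))"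
  by (rule equivp_span)

instantiation wedge :: (graded_vector) real_vector
begin

lift_definition zero_wedge :: "'a wedge" is 0 .
lift_definition plus_wedge :: "'a wedge \<Rightarrow> 'a wedge \<Rightarrow> 'a wedge" is "(+)" by (rule span_cong_add)
lift_definition uminus_wedge :: "'a wedge \<Rightarrow> 'a wedge" is uminus by (rule span_cong_uminus)
lift_definition minus_wedge :: "'a wedge \<Rightarrow> 'a wedge \<Rightarrow> 'a wedge" is "(-)" by (rule span_cong_diff)
lift_definition scaleR_wedge :: "real \<Rightarrow> 'a wedge \<Rightarrow> 'a wedge" is scaleR by (rule span_cong_scale)

instance
  by standard (transfer; simp add: algebra_simps span_zero)+

end

definition wedge_proj :: "'a::graded_vector talg \<Rightarrow> 'a wedge" where
  "wedge_proj = abs_wedge"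

definition wprod :: "'a::graded_vector list \<Rightarrow> 'a wedge" where
  "wprod vs = wedge_proj (word vs)"

lemma linear_wedge_proj: "linear wedge_proj"
  unfolding wedge_proj_def by (rule linearI) (simp_all add: plus_wedge.abs_eq scaleR_wedge.abs_eq)

lemma wedge_proj_rep: "wedge_proj (rep_wedge s) = s"
  unfolding wedge_proj_def by (rule Quotient_abs_rep[OF Quotient_wedge])

instantiation wedge :: (graded_vector) graded_vector
begin

lift_definition hproj_wedge :: "int \<Rightarrow> 'a wedge \<Rightarrow> 'a wedge" is hproj
  by (rule hproj_perm_rels)

instance
proof -
  have lin: "linear (hproj n :: 'a wedge \<Rightarrow> _)" for n
    by (rule linearI; transfer; simp add: hproj_add hproj_scaleR span_zero)
  let ?G = "wedge_proj ` {word vs | ds (vs :: 'a list). homogeneous ds vs}"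
  have "span ?G = range wedge_proj"
    by (simp add: linear_span_image[OF linear_wedge_proj] span_homogeneous_words)
  then have sp: "span ?G = UNIV" using wedge_proj_rep by (metis surjI)
  have G: "\<exists>d. \<forall>n. hproj n g = (if n = d then g else 0)" if g: "g \<in> ?G" for g
  proof -
    obtain ds vs where g: "g = wedge_proj (word vs)" and h: "homogeneous ds vs" using g by blast
    have "hproj n g = (if n = sum_list ds then g else 0)" for n
      by (simp add: g wedge_proj_def hproj_wedge.abs_eq hproj_talg_word[OF h] zero_wedge.abs_eq)
    then show ?thesis by blast
  qed
  show "OFCLASS('a wedge, graded_vector_class)"
    by standard (simp_all only: linear_add[OF lin] linear_scale[OF lin] grading_from_generators[OF lin sp G])
qed

end

section \<open>\<open>L\<^sub>\<infinity>\<close>-algebras and their extensions\<close>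

definition coder :: "('a::graded_vector sym \<Rightarrow> 'a) \<Rightarrow> 'a sym \<Rightarrow> 'a sym" where
  "coder lam = sym_mult \<circ> tmap 0 (sym_incl \<circ> lam) id \<circ> coprod"

text \<open>
  The type \<open>'g\<close> is \<open>\<gg>\<close>, so \<open>'g shift\<close> is \<open>\<gg>[1]\<close>. Since \<open>S(\<gg>[1])\<close> is the direct sum of the
  \<open>S\<^sup>k(\<gg>[1])\<close>, the family \<open>(\<lambda>\<^sub>k)\<close>, \<open>k \<ge> 1\<close>, is the single map \<open>lam = (\<Sum>k. \<lambda>\<^sub>k)\<close> with
  \<open>lam 1 = 0\<close>.
\<close>

definition linf_algebra :: "('g::graded_vector shift sym \<Rightarrow> 'g shift) \<Rightarrow> bool" where
  "linf_algebra lam \<longleftrightarrow>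
     (\<forall>n>0. gcomp n = ({0} :: 'g set)) \<and>
     lam \<in> Hom 1 \<and> lam sym_unit = 0 \<and>
     (\<forall>x. coder lam (coder lam x) = 0)"

definition linf_morphism ::
  "('a::graded_vector shift sym \<Rightarrow> 'a shift) \<Rightarrow> ('b::graded_vector shift sym \<Rightarrow> 'b shift) \<Rightarrow>
   ('a shift sym \<Rightarrow> 'b shift sym) \<Rightarrow> bool" where
  "linf_morphism lam lam' F \<longleftrightarrow>
     F \<in> Hom 0 \<and> F sym_unit = sym_unit \<and>
     coprod \<circ> F = tmap 0 F F \<circ> coprod \<and>
     F \<circ> coder lam = coder lam' \<circ> F"

text \<open>A strict morphism \<open>F = S(F1)\<close> is given by its linear part \<open>F1 : \<gg>[1] \<rightarrow> \<gg>'[1]\<close>.\<close>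

definition strict_linf_morphism ::
  "('a::graded_vector shift sym \<Rightarrow> 'a shift) \<Rightarrow> ('b::graded_vector shift sym \<Rightarrow> 'b shift) \<Rightarrow>
   ('a shift \<Rightarrow> 'b shift) \<Rightarrow> bool" where
  "strict_linf_morphism lam lam' F1 \<longleftrightarrow> F1 \<in> Hom 0 \<and> linf_morphism lam lam' (sym_map F1)"

definition linf_extension ::
  "('n::graded_vector shift sym \<Rightarrow> 'n shift) \<Rightarrow> ('h::graded_vector shift sym \<Rightarrow> 'h shift) \<Rightarrow>
   ('g::graded_vector shift sym \<Rightarrow> 'g shift) \<Rightarrow> ('n shift \<Rightarrow> 'h shift) \<Rightarrow> ('h shift \<Rightarrow> 'g shift) \<Rightarrow> bool" where
  "linf_extension lam_n lam_h lam_g \<iota> \<pi> \<longleftrightarrow>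
     linf_algebra lam_n \<and> linf_algebra lam_h \<and> linf_algebra lam_g \<and>
     strict_linf_morphism lam_n lam_h \<iota> \<and> strict_linf_morphism lam_h lam_g \<pi> \<and>
     inj \<iota> \<and> range \<iota> = {x. \<pi> x = 0} \<and> surj \<pi>"

definition is_section ::
  "('h::graded_vector shift \<Rightarrow> 'g::graded_vector shift) \<Rightarrow> ('g shift \<Rightarrow> 'h shift) \<Rightarrow> bool" where
  "is_section \<pi> h \<longleftrightarrow> h \<in> Hom 0 \<and> \<pi> \<circ> h = id"

text \<open>
  The identification of \<open>\<nn>[1]\<close> with its image is made explicit: maps whose values lie in
  \<open>range \<iota>\<close> are composed with \<open>inv \<iota>\<close>.
\<close>

definition curvature ::
  "('h::graded_vector shift sym \<Rightarrow> 'h shift) \<Rightarrow> ('g::graded_vector shift sym \<Rightarrow> 'g shift) \<Rightarrow>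
   ('n::graded_vector shift \<Rightarrow> 'h shift) \<Rightarrow> ('g shift \<Rightarrow> 'h shift) \<Rightarrow> 'g shift sym \<Rightarrow> 'n shift" where
  "curvature lam_h lam_g \<iota> h x = inv \<iota> (lam_h (sym_map h x) - h (lam_g x))"

section \<open>Representations up to homotopy\<close>

definition ruth ::
  "('g::graded_vector shift sym \<Rightarrow> 'g shift) \<Rightarrow> ('g shift sym \<otimes> 'v::graded_vector \<Rightarrow> 'v) \<Rightarrow> bool" where
  "ruth lam \<rho> \<longleftrightarrow>
     \<rho> \<in> Hom 1 \<and>
     (\<forall>t. \<rho> (tmap 0 (coder lam) id t) + \<rho> (tmap 1 id \<rho> (tassoc (tmap 0 coprod id t))) = 0)"

text \<open>
  The differential \<open>D\<^sub>\<rho>\<close> on \<open>C\<^sup>p(\<gg>, V) = Hom p\<close>, where \<open>p\<close> is the degree of its argument.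
\<close>

definition D ::
  "('g::graded_vector shift sym \<Rightarrow> 'g shift) \<Rightarrow> ('g shift sym \<otimes> 'v::graded_vector \<Rightarrow> 'v) \<Rightarrow> int \<Rightarrow>
   ('g shift sym \<Rightarrow> 'v) \<Rightarrow> 'g shift sym \<Rightarrow> 'v" where
  "D lam \<rho> p \<alpha> x = \<rho> (tmap p id \<alpha> (coprod x)) - msgn p *\<^sub>R \<alpha> (coder lam x)"

definition cocycles ::
  "('g::graded_vector shift sym \<Rightarrow> 'g shift) \<Rightarrow> ('g shift sym \<otimes> 'v::graded_vector \<Rightarrow> 'v) \<Rightarrow> int \<Rightarrow>
   ('g shift sym \<Rightarrow> 'v) set" where
  "cocycles lam \<rho> q = {\<alpha> \<in> Hom q. \<forall>x. D lam \<rho> q \<alpha> x = 0}"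

definition coboundaries ::
  "('g::graded_vector shift sym \<Rightarrow> 'g shift) \<Rightarrow> ('g shift sym \<otimes> 'v::graded_vector \<Rightarrow> 'v) \<Rightarrow> int \<Rightarrow>
   ('g shift sym \<Rightarrow> 'v) set" where
  "coboundaries lam \<rho> q = D lam \<rho> (q - 1) ` Hom (q - 1)"

text \<open>The element \<open>[\<alpha>]\<close> of \<open>H\<^sup>q(\<gg>, V)\<close>, as a coset of the coboundaries in the cocycles.\<close>

definition coh_class ::
  "('g::graded_vector shift sym \<Rightarrow> 'g shift) \<Rightarrow> ('g shift sym \<otimes> 'v::graded_vector \<Rightarrow> 'v) \<Rightarrow> int \<Rightarrow>
   ('g shift sym \<Rightarrow> 'v) \<Rightarrow> ('g shift sym \<Rightarrow> 'v) set" where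
  "coh_class lam \<rho> q \<alpha> = {\<beta> \<in> cocycles lam \<rho> q. (\<lambda>x. \<beta> x - \<alpha> x) \<in> coboundaries lam \<rho> q}"

definition pullback ::
  "('h::graded_vector shift \<Rightarrow> 'g::graded_vector shift) \<Rightarrow> ('g shift sym \<otimes> 'v::real_vector \<Rightarrow> 'v) \<Rightarrow>
   'h shift sym \<otimes> 'v \<Rightarrow> 'v" where
  "pullback \<pi> \<rho> = \<rho> \<circ> tmap 0 (sym_map \<pi>) id"

text \<open>\<open>ad|\<^sub>\<nn>(x \<otimes> y) = \<lambda>(x \<or> y)\<close>, which lies in \<open>range \<iota>\<close> because \<open>\<pi>\<close> is a morphism.\<close>

definition ad_restr ::
  "('h::graded_vector shift sym \<Rightarrow> 'h shift) \<Rightarrow> ('n::graded_vector shift \<Rightarrow> 'h shift) \<Rightarrow>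
   'h shift sym \<otimes> 'n shift \<Rightarrow> 'n shift" where
  "ad_restr lam_h \<iota> = inv \<iota> \<circ> lam_h \<circ> sym_mult \<circ> tmap 0 id (sym_incl \<circ> \<iota>)"

text \<open>The ruths induced by \<open>\<rho>\<close> on all tensor powers, and then on all exterior powers, at once.\<close>

definition talg_ruth ::
  "('a::graded_vector sym \<otimes> 'v::graded_vector \<Rightarrow> 'v) \<Rightarrow> 'a sym \<otimes> 'v talg \<Rightarrow> 'v talg" where
  "talg_ruth \<rho> = tensor_lift (\<lambda>x t. \<Sum>e\<in>degs x. talg_lift (hext (\<lambda>ds vs.
     \<Sum>i<length vs. msgn ((e + 1) * sum_list (take i ds)) *\<^sub>R
       word (vs[i := \<rho> (hproj e x \<otimes> vs ! i)]))) t)"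

definition wedge_ruth ::
  "('a::graded_vector sym \<otimes> 'v::graded_vector \<Rightarrow> 'v) \<Rightarrow> 'a sym \<otimes> 'v wedge \<Rightarrow> 'v wedge" where
  "wedge_ruth \<rho> = tensor_lift (\<lambda>x w. wedge_proj (talg_ruth \<rho> (x \<otimes> rep_wedge w)))"

text \<open>
  The degree \<open>p\<close> ruth maps from \<open>\<And>\<^sup>k\<nn>[1]\<close> to \<open>V\<close>. A linear map on \<open>\<And>\<^sup>k\<nn>[1]\<close> is encoded by its
  extension by zero to \<open>\<Oplus>j. \<And>\<^sup>j\<nn>[1]\<close>.
\<close>

definition invariant_maps ::
  "('h::graded_vector shift sym \<Rightarrow> 'h shift) \<Rightarrow> ('n::graded_vector shift \<Rightarrow> 'h shift) \<Rightarrow>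
   ('h shift \<Rightarrow> 'g::graded_vector shift) \<Rightarrow> ('g shift sym \<otimes> 'v::graded_vector \<Rightarrow> 'v) \<Rightarrow>
   nat \<Rightarrow> int \<Rightarrow> ('n shift wedge \<Rightarrow> 'v) set" where
  "invariant_maps lam_h \<iota> \<pi> \<rho> k p =
     {f \<in> Hom p. (\<forall>vs. length vs \<noteq> k \<longrightarrow> f (wprod vs) = 0) \<and>
       (\<forall>t. f (wedge_ruth (ad_restr lam_h \<iota>) t) = msgn p *\<^sub>R pullback \<pi> \<rho> (tmap p id f t))}"

text \<open>\<open>K\<^bsup>\<and>k\<^esup> = (K \<otimes> \<dots> \<otimes> K) \<circ> \<Delta>\<^bsup>k-1\<^esup>\<close> for \<open>K\<close> of degree \<open>1\<close> and \<open>k \<ge> 1\<close>.\<close>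

definition curv_power :: "('a::graded_vector sym \<Rightarrow> 'n::graded_vector) \<Rightarrow> nat \<Rightarrow> 'a sym \<Rightarrow> 'n talg" where
  "curv_power K k = tpow_map 1 K \<circ> coprod_iter (k - 1)"

definition char_cochain :: "('n::graded_vector wedge \<Rightarrow> 'v) \<Rightarrow> ('a::graded_vector sym \<Rightarrow> 'n) \<Rightarrow> nat \<Rightarrow>
   'a sym \<Rightarrow> 'v" where
  "char_cochain f K k = f \<circ> wedge_proj \<circ> curv_power K k"

end

(*
  Composition with multiplication by a homogeneous v is a graded derivation of every convolution
  product on maps out of S(g[1]), so the identities between such maps that are needed below follow by
  induction on words.

  For a section h, the map S(h) is not a chain map: its defect is the coderivation along S(h) given by
  K_h. Corestricting the square of the codifferential to zero gives the Bianchi identity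
  nabla^h K_h = 0, where nabla^h is the (not flat) covariant differential on maps into n[1]. The
  invariance of f turns D_rho (f o beta) into f o nabla^h beta up to sign, and nabla^h satisfies the
  Leibniz rule on tensor words, so f o K_h^k is a cocycle.

  For sections h, h' put b = h' - h and h_t = h + t b. Then the derivative of K_(h_t) is nabla^(h_t) b,
  so the derivative of f o K_(h_t)^k is D_rho of an explicit cochain depending polynomially on t;
  integrating over [0, 1] gives a primitive of the difference.
*)

theory Submission
  imports Defs "HOL-Analysis.Linear_Algebra"
begin

text \<open>The computations are done with tensor words; the exterior power is entered only through
  \<open>f\<close>. Its action \<open>wedge_ruth\<close> is defined by chosen representatives, so
  the action on tensor words has to be shown compatible with the exterior relations before the
  invariance of \<open>f\<close> can be used.

  The action on n[1] places the vector of n[1] on the right of the symmetric product, whereas the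
  coderivation along S(h) places the value of the curvature on the left. Cocommutativity identifies
  the two and thereby gives the Bianchi identity its form nabla^h K_h = 0.

  The difference b of two sections is defined on g[1] only. To become a cochain, it is composed with
  the projection of S(g[1]) onto its linear part.

  Evaluated at a word, the cochains along the path h_t are polynomial in t, but their degree may
  grow with the length of the word, so no bound holds for all arguments. Polynomiality, derivatives
  and integrals are therefore taken at one argument at a time; linearity and homogeneity of the
  integral as a cochain are separate statements.\<close>

lemma msgn_add: "msgn (m + n) = msgn m * msgn n"
  by (simp add: power_int_add)

subsection \<open>Koszul signs\<close>

abbreviation ordered_pairs :: "nat \<Rightarrow> (nat \<times> nat) set" where
  "ordered_pairs n \<equiv> {(i, j). i < j \<and> j < n}"

lemma finite_ordered_pairs: "finite (ordered_pairs n)"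
  by (rule finite_subset[of _ "{..<n} \<times> {..<n}"]) auto

lemma koszul_ordered_pairs:
  "koszul \<sigma> ds = (\<Prod>(i, j)\<in>ordered_pairs (length ds).
     if \<sigma> j < \<sigma> i then msgn (ds ! \<sigma> i * ds ! \<sigma> j) else 1)"
  unfolding koszul_def
  by (rule prod.mono_neutral_cong_left) (auto simp: finite_ordered_pairs split: if_splits)

text \<open>Compare the factors of one pair \<open>i < j\<close>. The only delicate case is a pair
  that \<open>\<tau>\<close> inverts and \<open>\<sigma>\<close> inverts back: it is no inversion of
  the composite, and its two equal signs cancel. Taking sorted images under \<open>\<tau>\<close>
  permutes the ordered pairs, which reindexes the product for \<open>\<sigma>\<close>.\<close>

lemma koszul_compose:
  assumes \<sigma>: "\<sigma> permutes {..<length ds}" and \<tau>: "\<tau> permutes {..<length ds}"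
  shows "koszul (\<sigma> \<circ> \<tau>) ds = koszul \<sigma> ds * koszul \<tau> (permute_list \<sigma> ds)"
proof -
  let ?n = "length ds"
  let ?P = "ordered_pairs ?n"
  define srt :: "(nat \<Rightarrow> nat) \<Rightarrow> nat \<times> nat \<Rightarrow> nat \<times> nat"
    where "srt f = (\<lambda>(i, j). (min (f i) (f j), max (f i) (f j)))" for f
  have lt: "\<tau> i < ?n" "inv \<tau> i < ?n" if "i < ?n" for i
    using that \<tau> permutes_inv[OF \<tau>] permutes_in_image by fastforce+
  have inj: "\<tau> i = \<tau> j \<longleftrightarrow> i = j" "inv \<tau> i = inv \<tau> j \<longleftrightarrow> i = j" for i j
    using permutes_inj[OF \<tau>] permutes_inj[OF permutes_inv[OF \<tau>]] by (auto dest: injD)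
  have injs: "\<sigma> i = \<sigma> j \<longleftrightarrow> i = j" for i j
    using permutes_inj[OF \<sigma>] by (auto dest: injD)
  have srt_inv: "srt (inv \<tau>) (srt \<tau> p) = p" "srt \<tau> (srt (inv \<tau>) p) = p" if "p \<in> ?P" for p
    using that permutes_inverses[OF \<tau>] by (auto simp: srt_def min_def max_def split: if_splits)
  have srt_in: "srt \<tau> p \<in> ?P" "srt (inv \<tau>) p \<in> ?P" if "p \<in> ?P" for p
  proof -
    obtain i j where p: "p = (i, j)" "i < j" "j < ?n" using \<open>p \<in> ?P\<close> by auto
    then have "\<tau> i \<noteq> \<tau> j" "inv \<tau> i \<noteq> inv \<tau> j" using inj by auto
    then show "srt \<tau> p \<in> ?P" "srt (inv \<tau>) p \<in> ?P"
      using lt[of i] lt[of j] p by (auto simp: srt_def min_def max_def)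
  qed
  have "koszul \<sigma> ds = (\<Prod>p\<in>?P. case srt \<tau> p of (i, j) \<Rightarrow>
     if \<sigma> j < \<sigma> i then msgn (ds ! \<sigma> i * ds ! \<sigma> j) else 1)"
    unfolding koszul_ordered_pairs
    by (rule prod.reindex_bij_witness[of _ "srt \<tau>" "srt (inv \<tau>)"]) (simp_all only: srt_inv srt_in)
  moreover have "koszul \<tau> (permute_list \<sigma> ds) = (\<Prod>(i, j)\<in>?P.
     if \<tau> j < \<tau> i then msgn (ds ! \<sigma> (\<tau> i) * ds ! \<sigma> (\<tau> j)) else 1)"
    unfolding koszul_ordered_pairs
    by (rule prod.cong) (auto simp: permute_list_nth[OF \<sigma>] lt)
  moreover have "koszul (\<sigma> \<circ> \<tau>) ds = (\<Prod>p\<in>?P.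
     (case srt \<tau> p of (i, j) \<Rightarrow> if \<sigma> j < \<sigma> i then msgn (ds ! \<sigma> i * ds ! \<sigma> j) else 1) *
     (case p of (i, j) \<Rightarrow> if \<tau> j < \<tau> i then msgn (ds ! \<sigma> (\<tau> i) * ds ! \<sigma> (\<tau> j)) else 1))"
    unfolding koszul_ordered_pairs
  proof (rule prod.cong[OF refl], clarify, goal_cases)
    case (1 i j)
    then have "\<tau> i \<noteq> \<tau> j" "\<sigma> (\<tau> i) \<noteq> \<sigma> (\<tau> j)" using inj injs by auto
    then show ?case by (auto simp: srt_def min_def max_def mult.commute)
  qed
  ultimately show ?thesis by (simp add: prod.distrib)
qed

lemma koszul_id: "koszul id ds = 1"
  by (auto simp: koszul_def intro!: prod.neutral)

lemma koszul_adjacent: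
  assumes "Suc i < length ds"
  shows "koszul (transpose i (Suc i)) ds = msgn (ds ! i * ds ! Suc i)"
proof -
  have eq: "{(k, j). k < j \<and> j < length ds \<and> transpose i (Suc i) j < transpose i (Suc i) k} = {(i, Suc i)}"
  proof (intro equalityI subsetI; clarify)
    fix k j assume "k < j" "transpose i (Suc i) j < transpose i (Suc i) k"
    then show "k = i \<and> j = Suc i"
      by (cases "k = i"; cases "k = Suc i"; cases "j = i"; cases "j = Suc i") simp_all
  qed (use assms in simp)
  show ?thesis unfolding koszul_def eq by (simp add: mult.commute)
qed

lemma permute_list_adjacent:
  "permute_list (transpose (length us) (Suc (length us))) (us @ v # w # ws) = us @ w # v # ws"
proof (rule nth_equalityI, goal_cases)
  case (2 i)
  have p: "transpose (length us) (Suc (length us)) permutes {..<length (us @ v # w # ws)}"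
    by (intro permutes_swap_id) auto
  show ?case
  proof (cases "Suc (length us) < i")
    case True
    then obtain j where "i = Suc (Suc (length us)) + j" using less_iff_Suc_add by fastforce
    with 2 show ?thesis by (simp add: permute_list_nth[OF p] nth_append)
  next
    case False
    then consider "i < length us" | "i = length us" | "i = Suc (length us)" by linarith
    then show ?thesis using 2 by cases (simp_all add: permute_list_nth[OF p] nth_append)
  qed
qed simp

lemma homogeneous_permute:
  "homogeneous ds vs \<Longrightarrow> \<sigma> permutes {..<length vs} \<Longrightarrow> homogeneous (permute_list \<sigma> ds) (permute_list \<sigma> vs)"
  using list_all2_permute_list_iff list_all2_lengthD by metis

text \<open>Adjacent transpositions generate the permutations and the sign is multiplicative in the
  sense of \<open>koszul_compose\<close>, so symmetry need only be tested on neighbouring letters.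
  The two values of \<open>s\<close> serve the symmetric and the exterior powers.\<close>

lemma signed_symmetry_from_swaps:
  fixes \<phi> :: "'a::graded_vector list \<Rightarrow> 'b::real_vector"
  assumes s: "s \<in> {1, - 1}"
    and swap: "\<And>us v w ws d e ds es. homogeneous ds us \<Longrightarrow> v \<in> gcomp d \<Longrightarrow> w \<in> gcomp e \<Longrightarrow>
      homogeneous es ws \<Longrightarrow> \<phi> (us @ v # w # ws) = (real_of_int s * msgn (d * e)) *\<^sub>R \<phi> (us @ w # v # ws)"
    and hom: "homogeneous ds vs" and p: "\<sigma> permutes {..<length vs}"
  shows "\<phi> vs = ((if s = 1 then 1 else of_int (sign \<sigma>)) * koszul \<sigma> ds) *\<^sub>R \<phi> (permute_list \<sigma> vs)"
proof -
  define n where "n = length vs"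
  define c where "c \<sigma> ds = (if s = 1 then 1 else of_int (sign \<sigma>)) * koszul \<sigma> ds" for \<sigma> ds
  \<comment> \<open>Composition applies the claim for \<open>\<tau>\<close> to the word already
    permuted by \<open>\<sigma>\<close>, whose degrees are permuted too; hence the quantification
    over all homogeneous words of length \<open>n\<close>.\<close>
  define Q where "Q \<sigma> \<longleftrightarrow> \<sigma> permutes {..<n} \<and> (\<forall>ds vs. homogeneous ds vs \<longrightarrow> length vs = n \<longrightarrow>
      \<phi> vs = c \<sigma> ds *\<^sub>R \<phi> (permute_list \<sigma> vs))" for \<sigma>
  have perm: "permutation \<sigma>" if "\<sigma> permutes {..<n}" for \<sigma>
    using that finite_lessThan unfolding permutation_permutes by blast
  have compose: "Q (\<sigma> \<circ> \<tau>)" if "Q \<sigma>" "Q \<tau>" for \<sigma> \<tau>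
    unfolding Q_def
  proof (intro conjI allI impI)
    show "\<sigma> \<circ> \<tau> permutes {..<n}" using that by (simp add: Q_def permutes_compose)
    fix ds and vs :: "'a list" assume h: "homogeneous ds vs" and len: "length vs = n"
    have \<sigma>: "\<sigma> permutes {..<length vs}" and \<tau>: "\<tau> permutes {..<length vs}" using that len by (auto simp: Q_def)
    have len': "length ds = length vs" using h by (rule list_all2_lengthD)
    have "\<phi> vs = c \<sigma> ds *\<^sub>R \<phi> (permute_list \<sigma> vs)"
      using that h len by (simp add: Q_def)
    also have "\<phi> (permute_list \<sigma> vs) = c \<tau> (permute_list \<sigma> ds) *\<^sub>R \<phi> (permute_list \<tau> (permute_list \<sigma> vs))"
      using that homogeneous_permute[OF h \<sigma>] len by (simp add: Q_def)
    also have "c \<sigma> ds *\<^sub>R \<dots> = c (\<sigma> \<circ> \<tau>) ds *\<^sub>R \<phi> (permute_list (\<sigma> \<circ> \<tau>) vs)"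
      using \<sigma> \<tau> len len' by (simp add: c_def koszul_compose permute_list_compose sign_compose perm)
    finally show "\<phi> vs = c (\<sigma> \<circ> \<tau>) ds *\<^sub>R \<phi> (permute_list (\<sigma> \<circ> \<tau>) vs)" .
  qed
  have Qid: "Q id" by (simp add: Q_def c_def koszul_id permutes_id)
  have adj: "Q (transpose i (Suc i))" if i: "Suc i < n" for i
    unfolding Q_def
  proof (intro conjI allI impI)
    show "transpose i (Suc i) permutes {..<n}" using i by (intro permutes_swap_id) auto
    fix ds and vs :: "'a list" assume h: "homogeneous ds vs" and len: "length vs = n"
    have vs: "vs = take i vs @ vs ! i # vs ! Suc i # drop (Suc (Suc i)) vs"
      using i len by (simp add: Cons_nth_drop_Suc)
    have len': "length ds = length vs" using h by (rule list_all2_lengthD)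
    have "\<phi> (take i vs @ vs ! i # vs ! Suc i # drop (Suc (Suc i)) vs) =
      (real_of_int s * msgn (ds ! i * ds ! Suc i)) *\<^sub>R \<phi> (take i vs @ vs ! Suc i # vs ! i # drop (Suc (Suc i)) vs)"
    proof (rule swap)
      show "homogeneous (take i ds) (take i vs)" "homogeneous (drop (Suc (Suc i)) ds) (drop (Suc (Suc i)) vs)"
        using h by simp_all
      show "vs ! i \<in> gcomp (ds ! i)" "vs ! Suc i \<in> gcomp (ds ! Suc i)"
        using list_all2_nthD[OF h] i len len' by auto
    qed
    also have "take i vs @ vs ! Suc i # vs ! i # drop (Suc (Suc i)) vs = permute_list (transpose i (Suc i)) vs"
    proof -
      have "length (take i vs) = i" using i len by simp
      then show ?thesis
        using permute_list_adjacent[of "take i vs" "vs ! i" "vs ! Suc i" "drop (Suc (Suc i)) vs"]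
        by (simp only: vs[symmetric])
    qed
    also have "real_of_int s * msgn (ds ! i * ds ! Suc i) = c (transpose i (Suc i)) ds"
      using s i len len' by (auto simp: c_def koszul_adjacent sign_swap_id)
    finally show "\<phi> vs = c (transpose i (Suc i)) ds *\<^sub>R \<phi> (permute_list (transpose i (Suc i)) vs)"
      by (simp only: vs[symmetric])
  qed
  have seq: "Q (apply_adj_transps xs)" if "\<forall>x\<in>set xs. Suc x < n" for xs
    using that
  proof (induction xs)
    case Nil
    then show ?case using Qid unfolding id_def by simp
  next
    case (Cons x xs)
    then show ?case using compose[OF adj[of x]] by (simp add: o_def)
  qed
  have "Q (transpose a b)" if "a < b" "b < n" for a b
    using seq[of "adj_transp_seq a b"] that by (auto simp: set_adj_transp_seq adj_transp_seq_correct)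
  then have tr: "Q (transpose a b)" if "a \<noteq> b" "a < n" "b < n" for a b
    using that by (metis linorder_neqE_nat transpose_commute)
  have "Q \<sigma>"
    using p[folded n_def] finite_lessThan
  proof (induction rule: permutes_induct)
    case id
    show ?case using Qid unfolding id_def by simp
  next
    case (swap a b p)
    then show ?case by (intro compose tr) auto
  qed
  then show ?thesis using hom by (simp add: Q_def c_def n_def)
qed

lemmas symmetry_from_swaps = signed_symmetry_from_swaps[of 1, simplified]
lemmas antisymmetry_from_swaps = signed_symmetry_from_swaps[of "-1", simplified]

subsection \<open>Homogeneous maps and generators\<close>

lemma subspace_gcomp: "subspace (gcomp n)"
  by (rule subspaceI) (simp_all add: gcomp_def hproj_add hproj_scaleR)

lemma gcomp_simps [simp]:
  "0 \<in> gcomp n"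
  "x \<in> gcomp n \<Longrightarrow> c *\<^sub>R x \<in> gcomp n"
  "x \<in> gcomp n \<Longrightarrow> y \<in> gcomp n \<Longrightarrow> x + y \<in> gcomp n"
  "x \<in> gcomp n \<Longrightarrow> y \<in> gcomp n \<Longrightarrow> x - y \<in> gcomp n"
  using subspace_gcomp[of n] by (auto intro: subspace_0 subspace_scale subspace_add subspace_diff)

lemma Hom_linear: "f \<in> Hom p \<Longrightarrow> linear f"
  by (simp add: Hom_def)

lemma Hom_gcomp: "f \<in> Hom p \<Longrightarrow> x \<in> gcomp n \<Longrightarrow> f x \<in> gcomp (n + p)"
  by (auto simp: Hom_def)

lemma HomI: "linear f \<Longrightarrow> (\<And>n x. x \<in> gcomp n \<Longrightarrow> f x \<in> gcomp (n + p)) \<Longrightarrow> f \<in> Hom p"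
  by (auto simp: Hom_def)

lemma Hom_compose:
  assumes "f \<in> Hom p" "g \<in> Hom q" shows "(\<lambda>x. f (g x)) \<in> Hom (p + q)"
proof (rule HomI)
  show "linear (\<lambda>x. f (g x))"
    using linear_compose[OF Hom_linear[OF assms(2)] Hom_linear[OF assms(1)]] by (simp add: o_def)
  show "f (g x) \<in> gcomp (n + (p + q))" if "x \<in> gcomp n" for n x
    using Hom_gcomp[OF assms(1) Hom_gcomp[OF assms(2) that]] by (simp add: ac_simps)
qed

lemma Hom_ident: "(\<lambda>x. x) \<in> Hom 0"
  by (rule HomI) (auto simp: linear_iff)

lemma Hom_hproj:
  assumes "f \<in> Hom p" shows "hproj (n + p) (f x) = f (hproj n x)"
proof -
  have "f x = (\<Sum>m\<in>degs x. f (hproj m x))"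
    by (simp add: sum_degs flip: linear_sum[OF Hom_linear[OF assms]])
  also have "hproj (n + p) \<dots> = (\<Sum>m\<in>degs x. if n = m then f (hproj m x) else 0)"
    unfolding linear_sum[OF linear_hproj]
    by (intro sum.cong) (auto simp: hproj_homogeneous[OF Hom_gcomp[OF assms hproj_gcomp]])
  also have "\<dots> = f (hproj n x)"
    using linear_0[OF Hom_linear[OF assms]] by (simp add: degs_def finite_hproj)
  finally show ?thesis .
qed

lemma tens_gcomp: "x \<in> gcomp i \<Longrightarrow> y \<in> gcomp j \<Longrightarrow> x \<otimes> y \<in> gcomp (i + j)"
proof -
  assume x: "x \<in> gcomp i" and y: "y \<in> gcomp j"
  have l: "linear (\<lambda>x. \<Sum>i\<in>degs x. hproj i x \<otimes> hproj (n - i) y)" for n and y :: 'b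
    by (rule linear_sum_degs) (rule linear_tens_left)
  have r: "linear (\<lambda>y. \<Sum>i\<in>degs x. hproj i x \<otimes> hproj (n - i) y)" for n and x :: 'a
    by (intro linear_compose_sum ballI linear_compose[OF linear_hproj linear_tens_right, unfolded o_def])
  show ?thesis
    unfolding gcomp_def mem_Collect_eq hproj_tensor_def tensor_lift_tens[OF l r]
    using x y by (auto simp: degs_homogeneous hproj_homogeneous linear_0[OF linear_tens_left] linear_0[OF linear_tens_right])
qed

lemma tensor_induct_homogeneous [case_names subspace tens]:
  fixes t :: "'a::graded_vector \<otimes> 'b::graded_vector"
  assumes P: "subspace {t. P t}"
    and tens: "\<And>x y d e. x \<in> gcomp d \<Longrightarrow> y \<in> gcomp e \<Longrightarrow> P (x \<otimes> y)"
  shows "P t"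
proof -
  have "x \<otimes> y \<in> {t. P t}" for x y
  proof -
    have "x \<otimes> y = (\<Sum>i\<in>degs x. \<Sum>j\<in>degs y. hproj i x \<otimes> hproj j y)"
      by (simp add: linear_sum[OF linear_tens_left, symmetric] linear_sum[OF linear_tens_right, symmetric] sum_degs)
    also have "\<dots> \<in> {t. P t}"
      by (intro subspace_sum[OF P]) (auto intro: tens hproj_gcomp)
    finally show ?thesis .
  qed
  then have "span {x \<otimes> y | x y. True} \<subseteq> {t. P t}"
    by (intro span_minimal[OF _ P]) blast
  then show ?thesis unfolding span_tens by blast
qed

lemma subspace_linear_eq: "linear f \<Longrightarrow> linear g \<Longrightarrow> subspace {x. f x = g x}"
  by (rule subspaceI) (auto simp: linear_0 linear_add linear_scale)

lemma tensor_eqI: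
  fixes t :: "'a::graded_vector \<otimes> 'b::graded_vector"
  assumes "linear F" "linear G"
    and "\<And>x y d e. x \<in> gcomp d \<Longrightarrow> y \<in> gcomp e \<Longrightarrow> F (x \<otimes> y) = G (x \<otimes> y)"
  shows "F t = G t"
  by (rule tensor_induct_homogeneous[OF subspace_linear_eq]) (use assms in auto)

lemma linear_tmap:
  assumes "linear f" "linear g" shows "linear (tmap q f g)"
  unfolding tmap_def
proof (rule linear_tensor_lift)
  show "linear (\<lambda>v. \<Sum>d\<in>degs v. msgn (q * d) *\<^sub>R (f (hproj d v) \<otimes> g w))" for w
    by (rule linear_sum_degs)
       (intro linear_compose_scale_right linear_compose[OF assms(1) linear_tens_left, unfolded o_def])
  show "linear (\<lambda>w. \<Sum>d\<in>degs v. msgn (q * d) *\<^sub>R (f (hproj d v) \<otimes> g w))" for v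
    by (intro linear_compose_sum ballI linear_compose_scale_right
        linear_compose[OF assms(2) linear_tens_right, unfolded o_def])
qed

lemma Hom_tensorI:
  fixes F :: "'a::graded_vector \<otimes> 'b::graded_vector \<Rightarrow> 'c::graded_vector"
  assumes F: "linear F"
    and deg: "\<And>x y d e. x \<in> gcomp d \<Longrightarrow> y \<in> gcomp e \<Longrightarrow> F (x \<otimes> y) \<in> gcomp (d + e + p)"
  shows "F \<in> Hom p"
proof (rule HomI[OF F])
  fix n and t :: "'a \<otimes> 'b" assume t: "t \<in> gcomp n"
  \<comment> \<open>Induction over generators has to run over arbitrary \<open>t\<close>.
    Homogeneity is therefore encoded by the projection, which is the identity on
    \<open>gcomp n\<close>.\<close>
  have "F (hproj n t) \<in> gcomp (n + p)"
  proof (induction t rule: tensor_induct_homogeneous)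
    case subspace
    show ?case
      by (rule subspaceI) (simp_all add: linear_0[OF F] linear_add[OF F] linear_scale[OF F] hproj_add hproj_scaleR)
  next
    case (tens x y d e)
    then show ?case
      using deg[OF tens] by (auto simp: hproj_homogeneous[OF tens_gcomp[OF tens]] linear_0[OF F])
  qed
  then show "F t \<in> gcomp (n + p)" using t by (simp add: gcomp_def)
qed

lemma Hom_tmap: "f \<in> Hom p \<Longrightarrow> g \<in> Hom q \<Longrightarrow> tmap r f g \<in> Hom (p + q)"
proof (rule Hom_tensorI)
  fix x :: 'a and y :: 'c and d e assume *: "f \<in> Hom p" "g \<in> Hom q" "x \<in> gcomp d" "y \<in> gcomp e"
  show "tmap r f g (x \<otimes> y) \<in> gcomp (d + e + (p + q))"
    using tens_gcomp[OF Hom_gcomp[OF *(1,3)] Hom_gcomp[OF *(2,4)]] *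
    by (simp add: tmap_homogeneous[OF Hom_linear Hom_linear] algebra_simps)
qed (simp add: linear_tmap Hom_linear)

lemma linear_talg_induct [case_names subspace word]:
  fixes t :: "'a::graded_vector talg"
  assumes P: "subspace {t. P t}" and "\<And>ds vs. homogeneous ds vs \<Longrightarrow> P (word vs)"
  shows "P t"
proof -
  have "span {word vs | ds (vs :: 'a list). homogeneous ds vs} \<subseteq> {t. P t}"
    using assms(2) by (intro span_minimal[OF _ P]) blast
  then show ?thesis unfolding span_homogeneous_words by blast
qed

lemma word_gcomp: "homogeneous ds vs \<Longrightarrow> word vs \<in> gcomp (sum_list ds)"
  by (simp add: gcomp_def hproj_talg_word)

lemma sprod_eq_abs: "sprod vs = abs_sym (word vs)"
  by (simp add: sprod.abs_eq)

lemma sprod_gcomp: "homogeneous ds vs \<Longrightarrow> sprod vs \<in> gcomp (sum_list ds)"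
  by (simp add: gcomp_def sprod_eq_abs hproj_sym.abs_eq hproj_talg_word)

lemma sym_induct_homogeneous [case_names subspace sprod]:
  fixes x :: "'a::graded_vector sym"
  assumes P: "subspace {x. P x}" and "\<And>ds vs. homogeneous ds vs \<Longrightarrow> P (sprod vs)"
  shows "P x"
proof -
  have "P (abs_sym t)" for t
  proof (induction t rule: linear_talg_induct)
    case subspace
    show ?case
      using P unfolding subspace_def
      by (simp add: linear_0[OF linear_abs_sym] linear_add[OF linear_abs_sym] linear_scale[OF linear_abs_sym])
  next
    case (word ds vs)
    then show ?case using assms(2) by (simp add: sprod_eq_abs)
  qed
  from this[of "rep_sym x"] show ?thesis by (simp add: abs_rep_sym)
qed

lemma sym_eqI:
  assumes "linear F" "linear G" and "\<And>ds vs. homogeneous ds vs \<Longrightarrow> F (sprod vs) = G (sprod vs)"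
  shows "F x = G x"
  by (rule sym_induct_homogeneous[OF subspace_linear_eq]) (use assms in auto)

lemma Hom_symI:
  fixes F :: "'a::graded_vector sym \<Rightarrow> 'c::graded_vector"
  assumes F: "linear F"
    and deg: "\<And>ds vs. homogeneous ds vs \<Longrightarrow> F (sprod vs) \<in> gcomp (sum_list ds + p)"
  shows "F \<in> Hom p"
proof (rule HomI[OF F])
  fix n and x :: "'a sym" assume x: "x \<in> gcomp n"
  have "F (hproj n x) \<in> gcomp (n + p)"
  proof (induction x rule: sym_induct_homogeneous)
    case subspace
    show ?case
      by (rule subspaceI) (simp_all add: linear_0[OF F] linear_add[OF F] linear_scale[OF F] hproj_add hproj_scaleR)
  next
    case (sprod ds vs)
    then show ?case
      using deg[OF sprod] by (auto simp: hproj_homogeneous[OF sprod_gcomp[OF sprod]] linear_0[OF F])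
  qed
  then show "F x \<in> gcomp (n + p)" using x by (simp add: gcomp_def)
qed

lemma multilinearI: "(\<And>us ws. linear (\<lambda>v. \<phi> (us @ v # ws))) \<Longrightarrow> multilinear \<phi>"
  by (simp add: multilinear_def)

lemma multilinearD: "multilinear \<phi> \<Longrightarrow> linear (\<lambda>v. \<phi> (us @ v # ws))"
  by (simp add: multilinear_def)

lemma multilinear_compose: "multilinear \<phi> \<Longrightarrow> linear f \<Longrightarrow> multilinear (\<lambda>vs. f (\<phi> vs))"
  unfolding multilinear_def using linear_compose[unfolded o_def] by blast

lemma multilinear_sprod: "multilinear sprod"
  using multilinear_compose[OF multilinear_word linear_abs_sym] by (simp add: sprod_eq_abs[abs_def])

lemma sprod_swap:
  assumes "homogeneous ds us" "v \<in> gcomp d" "w \<in> gcomp e" "homogeneous es ws"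
  shows "sprod (us @ v # w # ws) = msgn (d * e) *\<^sub>R sprod (us @ w # v # ws)"
proof -
  let ?\<sigma> = "transpose (length us) (Suc (length us))"
  let ?ds = "ds @ d # e # es"
  have len: "length ds = length us" using assms by (auto dest: list_all2_lengthD)
  have "word (us @ v # w # ws) - koszul ?\<sigma> ?ds *\<^sub>R word (permute_list ?\<sigma> (us @ v # w # ws)) \<in> perm_rels koszul"
    unfolding perm_rels_def
  proof (intro CollectI exI conjI)
    show "homogeneous ?ds (us @ v # w # ws)" using assms by (simp add: list_all2_appendI)
    show "?\<sigma> permutes {..<length (us @ v # w # ws)}" by (intro permutes_swap_id) auto
  qed (rule refl)
  moreover have "koszul ?\<sigma> ?ds = msgn (d * e)"
    by (subst koszul_adjacent) (auto simp: len nth_append simp flip: len)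
  ultimately have "abs_sym (word (us @ v # w # ws)) = abs_sym (msgn (d * e) *\<^sub>R word (us @ w # v # ws))"
    by (simp add: abs_sym_eq_iff permute_list_adjacent span_base)
  then show ?thesis by (simp add: sprod_eq_abs scaleR_sym.abs_eq)
qed

lemma
  fixes \<phi> :: "'a::graded_vector list \<Rightarrow> 'b::real_vector"
  assumes "multilinear \<phi>"
    and "\<And>us v w ws d e ds es. homogeneous ds us \<Longrightarrow> v \<in> gcomp d \<Longrightarrow> w \<in> gcomp e \<Longrightarrow>
      homogeneous es ws \<Longrightarrow> \<phi> (us @ v # w # ws) = msgn (d * e) *\<^sub>R \<phi> (us @ w # v # ws)"
  shows linear_sym_lift_swap: "linear (sym_lift \<phi>)"
    and sym_lift_sprod_swap: "sym_lift \<phi> (sprod vs) = \<phi> vs"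
proof -
  have symm: "\<phi> vs = koszul \<sigma> ds *\<^sub>R \<phi> (permute_list \<sigma> vs)"
    if "homogeneous ds vs" "\<sigma> permutes {..<length vs}" for ds vs \<sigma>
    by (rule symmetry_from_swaps[OF _ that]) (rule assms(2))
  show "linear (sym_lift \<phi>)" "sym_lift \<phi> (sprod vs) = \<phi> vs"
    by (rule linear_sym_lift[OF assms(1) symm] sym_lift_sprod[OF assms(1) symm]; assumption)+
qed

subsection \<open>The product of the symmetric algebra\<close>

lemma
  fixes us :: "'a::graded_vector list"
  shows linear_sym_mult_inner: "linear (sym_lift (\<lambda>vs. sprod (us @ vs)))"
    and sym_mult_inner: "sym_lift (\<lambda>vs. sprod (us @ vs)) (sprod ws) = sprod (us @ ws)"
proof -
  let ?\<phi> = "\<lambda>vs. sprod (us @ vs)"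
  have mlin: "multilinear ?\<phi>"
    using multilinearD[OF multilinear_sprod, of "us @ _"] by (auto intro!: multilinearI)
  have "\<phi>' (us' @ v # w # ws) = msgn (d * e) *\<^sub>R \<phi>' (us' @ w # v # ws)"
    if h: "homogeneous ds us'" "v \<in> gcomp d" "w \<in> gcomp e" "homogeneous es ws" and \<phi>': "\<phi>' = ?\<phi>"
    for us' v w ws d e ds es \<phi>'
  proof -
    \<comment> \<open>The prefix \<open>us\<close> is arbitrary, but \<open>sprod_swap\<close> needs
      homogeneous letters. The defect \<open>T\<close> is multilinear in the prefix, so
      \<open>hext\<close> splits it into defects at homogeneous prefixes, all of them zero;
      membership in \<open>span {0}\<close> expresses that it vanishes.\<close>
    define T where "T = (\<lambda>xs. sprod (xs @ us' @ v # w # ws) - msgn (d * e) *\<^sub>R sprod (xs @ us' @ w # v # ws))"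
    have "multilinear T"
      unfolding T_def using multilinearD[OF multilinear_sprod]
      by (auto intro!: multilinearI linear_compose_sub linear_compose_scale_right)
    then have "T us = hext (\<lambda>_. T) us" by (simp add: hext_multilinear)
    also have "\<dots> \<in> span {0}"
    proof (rule hext_in_span)
      fix es' xs assume "homogeneous es' (xs :: 'a list)"
      then have "T xs = 0"
        using sprod_swap[of "es' @ ds" "xs @ us'" v d w e es ws] h by (simp add: T_def list_all2_appendI)
      then show "T xs \<in> span {0}" by (simp add: span_zero)
    qed
    finally show ?thesis by (simp add: T_def \<phi>')
  qed
  note swap = this[OF _ _ _ _ refl]
  show "linear (sym_lift ?\<phi>)" by (rule linear_sym_lift_swap[OF mlin swap])
  show "sym_lift ?\<phi> (sprod ws) = sprod (us @ ws)" by (rule sym_lift_sprod_swap[OF mlin swap])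
qed

lemma
  fixes y :: "'a::graded_vector sym"
  shows linear_sym_mult_outer: "linear (sym_lift (\<lambda>us. sym_lift (\<lambda>vs. sprod (us @ vs)) y))"
    and sym_mult_outer: "sym_lift (\<lambda>us. sym_lift (\<lambda>vs. sprod (us @ vs)) y) (sprod ws) = sym_lift (\<lambda>vs. sprod (ws @ vs)) y"
proof -
  let ?\<phi> = "\<lambda>us. sym_lift (\<lambda>vs. sprod (us @ vs)) y"
  have mlin: "multilinear ?\<phi>"
  proof (rule multilinearI)
    fix us ws :: "'a list"
    have "linear (\<lambda>v. sym_lift (\<lambda>vs. sprod ((us @ v # ws) @ vs)) x)" for x
    proof (induction x rule: sym_induct_homogeneous)
      case subspace
      show ?case
        by (rule subspaceI)
          (simp_all add: linear_0[OF linear_sym_mult_inner] linear_add[OF linear_sym_mult_inner]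
              linear_scale[OF linear_sym_mult_inner] linear_zero linear_compose_add linear_compose_scale_right
            del: append_assoc)
    next
      case (sprod ds vs)
      show ?case
        unfolding sym_mult_inner using multilinearD[OF multilinear_sprod, of us "ws @ vs"] by simp
    qed
    then show "linear (\<lambda>v. sym_lift (\<lambda>vs. sprod ((us @ v # ws) @ vs)) y)" .
  qed
  have swap: "?\<phi> (us @ v # w # ws) = msgn (d * e) *\<^sub>R ?\<phi> (us @ w # v # ws)"
    if h: "homogeneous ds us" "v \<in> gcomp d" "w \<in> gcomp e" "homogeneous es ws" for us v w ws d e ds es
  proof (rule sym_eqI[where F = "sym_lift (\<lambda>vs. sprod ((us @ v # w # ws) @ vs))"
        and G = "\<lambda>y. msgn (d * e) *\<^sub>R sym_lift (\<lambda>vs. sprod ((us @ w # v # ws) @ vs)) y"])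
    fix fs and xs :: "'a list" assume "homogeneous fs xs"
    then show "sym_lift (\<lambda>vs. sprod ((us @ v # w # ws) @ vs)) (sprod xs) =
        msgn (d * e) *\<^sub>R sym_lift (\<lambda>vs. sprod ((us @ w # v # ws) @ vs)) (sprod xs)"
      unfolding sym_mult_inner
      using sprod_swap[of ds us v d w e "es @ fs" "ws @ xs"] h by (simp add: list_all2_appendI)
  qed (intro linear_compose_scale_right linear_sym_mult_inner)+
  show "linear (sym_lift ?\<phi>)" by (rule linear_sym_lift_swap[OF mlin swap])
  show "sym_lift ?\<phi> (sprod ws) = sym_lift (\<lambda>vs. sprod (ws @ vs)) y" by (rule sym_lift_sprod_swap[OF mlin swap])
qed

lemma
  fixes us vs :: "'a::graded_vector list"
  shows linear_sym_mult: "linear (sym_mult :: 'a sym \<otimes> 'a sym \<Rightarrow> 'a sym)"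
    and sym_mult_sprod: "sym_mult (sprod us \<otimes> sprod vs) = sprod (us @ vs)"
proof -
  have r: "linear (\<lambda>y. sym_lift (\<lambda>us. sym_lift (\<lambda>vs. sprod (us @ vs)) y) x)" for x :: "'a sym"
  proof (induction x rule: sym_induct_homogeneous)
    case subspace
    show ?case
      by (rule subspaceI)
        (simp_all add: linear_0[OF linear_sym_mult_outer] linear_add[OF linear_sym_mult_outer]
            linear_scale[OF linear_sym_mult_outer] linear_zero linear_compose_add linear_compose_scale_right)
  next
    case (sprod ds vs)
    show ?case unfolding sym_mult_outer by (rule linear_sym_mult_inner)
  qed
  show "linear (sym_mult :: 'a sym \<otimes> 'a sym \<Rightarrow> 'a sym)"
    unfolding sym_mult_def by (intro linear_tensor_lift linear_sym_mult_outer r)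
  show "sym_mult (sprod us \<otimes> sprod vs) = sprod (us @ vs)"
    unfolding sym_mult_def
    unfolding tensor_lift_tens[OF linear_sym_mult_outer r]
    by (rule trans[OF sym_mult_outer sym_mult_inner])
qed

text \<open>Every word arises from \<open>sym_unit\<close> by iterating \<open>smul\<close>. An
  identity on words thus follows from rules saying how each structure map behaves under composition
  with \<open>smul v\<close>.\<close>

definition smul :: "'a::graded_vector \<Rightarrow> 'a sym \<Rightarrow> 'a sym" where
  "smul v x = sym_mult (sym_incl v \<otimes> x)"

lemma linear_sym_incl: "linear sym_incl"
  using multilinearD[OF multilinear_sprod, of "[]" "[]"] by (simp add: sym_incl_def[abs_def])

lemma linear_smul: "linear (smul v)" and linear_smul_left: "linear (\<lambda>v. smul v x)"
  unfolding smul_def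
  by (rule linear_compose[OF linear_tens_right linear_sym_mult, unfolded o_def],
      rule linear_compose[OF linear_compose[OF linear_sym_incl linear_tens_left] linear_sym_mult, unfolded o_def])

lemma linear_comp: "linear g \<Longrightarrow> linear f \<Longrightarrow> linear (\<lambda>x. g (f x))"
  by (drule (1) linear_compose) (simp add: o_def)

lemmas linear_intros = linear_ident linear_zero linear_compose_add linear_compose_sub linear_compose_scale_right
  linear_comp[OF linear_tens_left] linear_comp[OF linear_tens_right]
  linear_comp[OF linear_sym_mult] linear_comp[OF linear_smul] linear_comp[OF linear_sym_incl]
  linear_comp[OF linear_smul_left]

lemma smul_sprod: "smul v (sprod vs) = sprod (v # vs)"
  by (simp add: smul_def sym_incl_def sym_mult_sprod)

lemma smul_commute:
  fixes v w :: "'a::graded_vector"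
  assumes "v \<in> gcomp d" "w \<in> gcomp e"
  shows "smul v (smul w x) = msgn (d * e) *\<^sub>R smul w (smul v x)"
proof (rule sym_eqI[where F = "\<lambda>x. smul v (smul w x)" and G = "\<lambda>x. msgn (d * e) *\<^sub>R smul w (smul v x)"])
  fix ds and vs :: "'a list" assume "homogeneous ds vs"
  then show "smul v (smul w (sprod vs)) = msgn (d * e) *\<^sub>R smul w (smul v (sprod vs))"
    using sprod_swap[of "[]" "[]" v d w e ds vs] assms by (simp add: smul_sprod)
qed (intro linear_compose_scale_right linear_compose[OF linear_smul linear_smul, unfolded o_def])+

lemma Hom_smul:
  fixes v :: "'a::graded_vector"
  assumes "v \<in> gcomp d" shows "smul v \<in> Hom d"
proof (rule Hom_symI)
  fix ds and vs :: "'a list" assume "homogeneous ds vs"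
  then show "smul v (sprod vs) \<in> gcomp (sum_list ds + d)"
    using assms sprod_gcomp[of "d # ds" "v # vs"] by (simp add: smul_sprod add.commute)
qed (rule linear_smul)

lemma sym_mult_smul: "sym_mult (smul v x \<otimes> y) = smul v (sym_mult (x \<otimes> y))"
  for v :: "'a::graded_vector"
proof (rule sym_eqI[where F = "\<lambda>x. sym_mult (smul v x \<otimes> y)" and G = "\<lambda>x. smul v (sym_mult (x \<otimes> y))"])
  show "sym_mult (smul v (sprod vs) \<otimes> y) = smul v (sym_mult (sprod vs \<otimes> y))" for vs :: "'a list"
    by (rule sym_eqI[where F = "\<lambda>y. sym_mult (smul v (sprod vs) \<otimes> y)" and G = "\<lambda>y. smul v (sym_mult (sprod vs \<otimes> y))"])
      (auto simp: smul_sprod sym_mult_sprod intro!: linear_intros)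
qed (intro linear_intros)+

lemma sym_unit_gcomp: "sym_unit \<in> gcomp 0"
  using sprod_gcomp[of "[]" "[]"] by (simp add: sym_unit_def)

lemma sym_mult_unit: "sym_mult (sym_unit \<otimes> x) = x"
  by (rule sym_eqI[where G = "\<lambda>x. x"])
    (auto simp: sym_unit_def sym_mult_sprod intro!: linear_intros)

section \<open>Functoriality of the symmetric algebra\<close>

lemma
  assumes F: "F \<in> Hom 0"
  shows linear_sym_map: "linear (sym_map F)"
    and sym_map_sprod: "sym_map F (sprod vs) = sprod (map F vs)"
proof -
  have mlin: "multilinear (\<lambda>vs. sprod (map F vs))"
    using linear_compose[OF Hom_linear[OF F] multilinearD[OF multilinear_sprod], unfolded o_def]
    by (auto intro!: multilinearI)
  have hF: "homogeneous ds (map F vs)" if "homogeneous ds vs" for ds vs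
    using that Hom_gcomp[OF F] by (auto simp: list_all2_conv_all_nth)
  have swap: "sprod (map F (us @ v # w # ws)) = msgn (d * e) *\<^sub>R sprod (map F (us @ w # v # ws))"
    if "homogeneous ds us" "v \<in> gcomp d" "w \<in> gcomp e" "homogeneous es ws" for us v w ws d e ds es
    using that sprod_swap[of ds "map F us" "F v" d "F w" e es "map F ws"] Hom_gcomp[OF F] hF by auto
  show "linear (sym_map F)" "sym_map F (sprod vs) = sprod (map F vs)"
    unfolding sym_map_def
    by (rule linear_sym_lift_swap[OF mlin swap] sym_lift_sprod_swap[OF mlin swap]; assumption)+
qed

lemma sym_map_smul: "F \<in> Hom 0 \<Longrightarrow> sym_map F (smul v x) = smul (F v) (sym_map F x)"
  by (rule sym_eqI[where F = "\<lambda>x. sym_map F (smul v x)" and G = "\<lambda>x. smul (F v) (sym_map F x)"])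
    (auto simp: smul_sprod sym_map_sprod intro!: linear_intros linear_comp[OF linear_sym_map])

lemma sym_map_unit: "F \<in> Hom 0 \<Longrightarrow> sym_map F sym_unit = sym_unit"
  by (simp add: sym_unit_def sym_map_sprod)

lemma Hom_sym_map:
  assumes "F \<in> Hom 0" shows "sym_map F \<in> Hom 0"
proof (rule Hom_symI)
  fix ds vs assume "homogeneous ds (vs :: 'a list)"
  then have "homogeneous ds (map F vs)"
    using Hom_gcomp[OF assms] by (auto simp: list_all2_conv_all_nth)
  then show "sym_map F (sprod vs) \<in> gcomp (sum_list ds + 0)"
    using assms by (simp add: sym_map_sprod sprod_gcomp)
qed (rule linear_sym_map[OF assms])

subsection \<open>The coproduct\<close>

text \<open>
  A \<open>(k, l)\<close>-shuffle takes the value \<open>0\<close> at \<open>0\<close> or at \<open>k\<close>. Deleting this position leaves a shuffle of one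
  point less; \<open>ext_perm\<close> and \<open>cyc\<close> invert the deletion, which yields a recursion for the coproduct of a word.
\<close>

definition ext_perm :: "(nat \<Rightarrow> nat) \<Rightarrow> nat \<Rightarrow> nat" where
  "ext_perm \<tau> i = (case i of 0 \<Rightarrow> 0 | Suc j \<Rightarrow> Suc (\<tau> j))"

definition cyc :: "nat \<Rightarrow> nat \<Rightarrow> nat" where
  "cyc k i = (if i < k then Suc i else if i = k then 0 else i)"

lemma ext_perm_simps [simp]: "ext_perm \<tau> 0 = 0" "ext_perm \<tau> (Suc j) = Suc (\<tau> j)"
  by (simp_all add: ext_perm_def)

lemma ext_perm_permutes:
  assumes "\<tau> permutes {..<n}" shows "ext_perm \<tau> permutes {..<Suc n}"
proof (rule inj_imp_permutes)
  show "inj_on (ext_perm \<tau>) {..<Suc n}"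
    by (auto simp: inj_on_def ext_perm_def inj_eq[OF permutes_inj[OF assms]] split: nat.splits)
  show "ext_perm \<tau> i \<in> {..<Suc n}" if "i \<in> {..<Suc n}" for i
    using that permutes_in_image[OF assms, of "i - 1"] by (cases i) auto
  show "ext_perm \<tau> i = i" if "i \<notin> {..<Suc n}" for i
    using that permutes_not_in[OF assms, of "i - 1"] by (cases i) auto
qed simp

lemma cyc_permutes:
  assumes "k \<le> n" shows "cyc k permutes {..<Suc n}"
  by (rule inj_imp_permutes) (use assms in \<open>auto simp: inj_on_def cyc_def split: if_splits\<close>)

lemma permutes_Suc_cases:
  assumes \<sigma>: "\<sigma> permutes {..<Suc n}" and 0: "\<sigma> 0 = 0"
  obtains \<tau> where "\<tau> permutes {..<n}" "\<sigma> = ext_perm \<tau>"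
proof
  define \<tau> where "\<tau> i = \<sigma> (Suc i) - 1" for i
  have nz: "\<sigma> (Suc i) \<noteq> 0" for i
    using permutes_inj[OF \<sigma>] 0 by (metis injD nat.distinct(1))
  show "\<sigma> = ext_perm \<tau>"
  proof
    show "\<sigma> i = ext_perm \<tau> i" for i
      using 0 nz by (cases i) (auto simp: \<tau>_def)
  qed
  show "\<tau> permutes {..<n}"
  proof (rule inj_imp_permutes)
    show "inj_on \<tau> {..<n}"
    proof (rule inj_onI)
      fix i j assume "\<tau> i = \<tau> j"
      then have "\<sigma> (Suc i) = \<sigma> (Suc j)" using nz[of i] nz[of j] by (simp add: \<tau>_def)
      then show "i = j" using injD[OF permutes_inj[OF \<sigma>]] by blast
    qed
    show "\<tau> i \<in> {..<n}" if "i \<in> {..<n}" for i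
      using that permutes_in_image[OF \<sigma>, of "Suc i"] nz[of i] by (auto simp: \<tau>_def)
    show "\<tau> i = i" if "i \<notin> {..<n}" for i
      using that permutes_not_in[OF \<sigma>, of "Suc i"] by (auto simp: \<tau>_def)
  qed simp
qed

lemma ext_perm_inj: "ext_perm \<tau> = ext_perm \<tau>' \<Longrightarrow> \<tau> = \<tau>'"
  by (metis ext_perm_simps(2) ext nat.inject)

lemma finite_Sh: "finite (Sh k l)"
  by (rule finite_subset[OF _ finite_permutations[of "{..<k + l}"]]) (auto simp: Sh_def)

lemma Sh_first:
  assumes "k \<le> n"
  shows "{\<sigma> \<in> Sh (Suc k) (n - k). \<sigma> 0 = 0} = ext_perm ` Sh k (n - k)"
proof (intro equalityI subsetI)
  fix \<sigma> assume "\<sigma> \<in> {\<sigma> \<in> Sh (Suc k) (n - k). \<sigma> 0 = 0}"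
  then have *: "\<sigma> permutes {..<Suc n}" "strict_mono_on {..<Suc k} \<sigma>" "strict_mono_on {Suc k..<Suc n} \<sigma>" "\<sigma> 0 = 0"
    using assms by (simp_all add: Sh_def)
  obtain \<tau> where \<tau>: "\<tau> permutes {..<n}" "\<sigma> = ext_perm \<tau>" using permutes_Suc_cases *(1,4) .
  have "strict_mono_on {..<k} \<tau>" "strict_mono_on {k..<n} \<tau>"
    using strict_mono_onD[OF *(2), of "Suc _" "Suc _"] strict_mono_onD[OF *(3), of "Suc _" "Suc _"]
    by (auto intro!: strict_mono_onI simp: \<tau>(2))
  then show "\<sigma> \<in> ext_perm ` Sh k (n - k)" using \<tau> assms by (auto simp: Sh_def)
next
  fix \<sigma> assume "\<sigma> \<in> ext_perm ` Sh k (n - k)"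
  then obtain \<tau> where \<sigma>: "\<sigma> = ext_perm \<tau>" and
    \<tau>: "\<tau> permutes {..<n}" "strict_mono_on {..<k} \<tau>" "strict_mono_on {k..<n} \<tau>"
    using assms by (auto simp: Sh_def)
  have "strict_mono_on {..<Suc k} \<sigma>" "strict_mono_on {Suc k..<Suc n} \<sigma>"
    using strict_mono_onD[OF \<tau>(2)] strict_mono_onD[OF \<tau>(3)]
    by (auto intro!: strict_mono_onI simp: \<sigma> ext_perm_def split: nat.splits)
  then show "\<sigma> \<in> {\<sigma> \<in> Sh (Suc k) (n - k). \<sigma> 0 = 0}"
    using ext_perm_permutes[OF \<tau>(1)] assms by (simp add: Sh_def \<sigma>)
qed

lemma Sh_second:
  assumes "k \<le> n"
  shows "{\<sigma> \<in> Sh k (Suc n - k). \<sigma> k = 0} = (\<lambda>\<tau>. ext_perm \<tau> \<circ> cyc k) ` Sh k (n - k)"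
proof (intro equalityI subsetI)
  fix \<sigma> assume "\<sigma> \<in> {\<sigma> \<in> Sh k (Suc n - k). \<sigma> k = 0}"
  then have *: "\<sigma> permutes {..<Suc n}" "strict_mono_on {..<k} \<sigma>" "strict_mono_on {k..<Suc n} \<sigma>" "\<sigma> k = 0"
    using assms by (simp_all add: Sh_def)
  note cyc = cyc_permutes[OF assms]
  \<comment> \<open>\<open>cyc k\<close> sends position \<open>k\<close> to 0, so undoing it moves
    the value 0 to the front, where \<open>permutes_Suc_cases\<close> applies.\<close>
  have "(\<sigma> \<circ> inv (cyc k)) 0 = 0"
    using permutes_inverses(2)[OF cyc, of k] *(4) by (simp add: cyc_def)
  then obtain \<tau> where \<tau>: "\<tau> permutes {..<n}" "\<sigma> \<circ> inv (cyc k) = ext_perm \<tau>"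
    using permutes_Suc_cases[OF permutes_compose[OF permutes_inv[OF cyc] *(1)]] by blast
  have \<sigma>: "\<sigma> = ext_perm \<tau> \<circ> cyc k"
    unfolding \<tau>(2)[symmetric] using permutes_inv_o(2)[OF cyc] by (simp add: comp_assoc)
  have "strict_mono_on {..<k} \<tau>"
  proof (rule strict_mono_onI)
    fix i j assume "i \<in> {..<k}" "j \<in> {..<k}" "i < j"
    then show "\<tau> i < \<tau> j"
      using strict_mono_onD[OF *(2), of i j] by (simp add: \<sigma> cyc_def)
  qed
  moreover have "strict_mono_on {k..<n} \<tau>"
  proof (rule strict_mono_onI)
    fix i j assume "i \<in> {k..<n}" "j \<in> {k..<n}" "i < j"
    then show "\<tau> i < \<tau> j"
      using strict_mono_onD[OF *(3), of "Suc i" "Suc j"] by (simp add: \<sigma> cyc_def)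
  qed
  ultimately show "\<sigma> \<in> (\<lambda>\<tau>. ext_perm \<tau> \<circ> cyc k) ` Sh k (n - k)" using \<tau> \<sigma> assms by (auto simp: Sh_def)
next
  fix \<sigma> assume "\<sigma> \<in> (\<lambda>\<tau>. ext_perm \<tau> \<circ> cyc k) ` Sh k (n - k)"
  then obtain \<tau> where \<sigma>: "\<sigma> = ext_perm \<tau> \<circ> cyc k" and
    \<tau>: "\<tau> permutes {..<n}" "strict_mono_on {..<k} \<tau>" "strict_mono_on {k..<n} \<tau>"
    using assms by (auto simp: Sh_def)
  have "strict_mono_on {..<k} \<sigma>"
    using strict_mono_onD[OF \<tau>(2)] by (auto intro!: strict_mono_onI simp: \<sigma> cyc_def)
  moreover have "strict_mono_on {k..<Suc n} \<sigma>"
    using strict_mono_onD[OF \<tau>(3)]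
    by (auto intro!: strict_mono_onI simp: \<sigma> cyc_def ext_perm_def split: nat.splits)
  ultimately show "\<sigma> \<in> {\<sigma> \<in> Sh k (Suc n - k). \<sigma> k = 0}"
    using permutes_compose[OF cyc_permutes[OF assms] ext_perm_permutes[OF \<tau>(1)]] assms
    by (auto simp: Sh_def \<sigma> cyc_def)
qed

lemma sum_Sh_Suc:
  fixes F :: "nat \<Rightarrow> (nat \<Rightarrow> nat) \<Rightarrow> 'b::comm_monoid_add"
  shows "(\<Sum>k\<le>Suc n. \<Sum>\<sigma>\<in>Sh k (Suc n - k). F k \<sigma>) =
    (\<Sum>k\<le>n. \<Sum>\<tau>\<in>Sh k (n - k). F (Suc k) (ext_perm \<tau>) + F k (ext_perm \<tau> \<circ> cyc k))"
proof -
  let ?S = "\<lambda>k. Sh k (Suc n - k)"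
  \<comment> \<open>The bounds \<open>0 < k\<close> and \<open>k \<le> n\<close> say that the block
    headed by the value 0 is not empty; for \<open>k = 0\<close> the two positions would coincide.
    They make \<open>?A 0\<close> and \<open>?B (Suc n)\<close> empty, so that both sums shrink to
    \<open>n + 1\<close> terms.\<close>
  let ?A = "\<lambda>k. {\<sigma> \<in> ?S k. 0 < k \<and> \<sigma> 0 = 0}" and ?B = "\<lambda>k. {\<sigma> \<in> ?S k. k \<le> n \<and> \<sigma> k = 0}"
  have split: "sum (F k) (?S k) = sum (F k) (?A k) + sum (F k) (?B k)" if k: "k \<le> Suc n" for k
  proof -
    have "\<sigma> \<in> ?A k \<union> ?B k" if "\<sigma> \<in> ?S k" for \<sigma>
    proof -
      have *: "\<sigma> permutes {..<Suc n}" "strict_mono_on {..<k} \<sigma>" "strict_mono_on {k..<Suc n} \<sigma>"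
        using that k by (simp_all add: Sh_def)
      obtain i where i: "\<sigma> i = 0" "i < Suc n"
        using permutes_surj[OF *(1)] permutes_not_in[OF *(1)] by (metis lessThan_iff surjD zero_less_Suc)
      show ?thesis
      proof (cases "i < k")
        case True
        then have "i = 0" using strict_mono_onD[OF *(2), of 0 i] i by (cases "i = 0") auto
        then show ?thesis using True i that by auto
      next
        case False
        then have "i = k" using strict_mono_onD[OF *(3), of k i] i by (cases "i = k") auto
        then show ?thesis using i that by auto
      qed
    qed
    then have un: "?S k = ?A k \<union> ?B k" by blast
    have "?A k \<inter> ?B k = {}"
      using permutes_inj[of _ "{..<Suc n}"] k by (auto simp: Sh_def) (metis injD less_irrefl)
    then show ?thesis by (subst un, subst sum.union_disjoint) (auto intro: finite_subset[OF _ finite_Sh])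
  qed
  have "(\<Sum>k\<le>Suc n. sum (F k) (?S k)) = (\<Sum>k\<le>Suc n. sum (F k) (?A k)) + (\<Sum>k\<le>Suc n. sum (F k) (?B k))"
    by (simp add: split sum.distrib del: sum.atMost_Suc)
  also have "(\<Sum>k\<le>Suc n. sum (F k) (?A k)) = (\<Sum>k\<le>n. sum (F (Suc k)) (?A (Suc k)))"
    by (subst sum.atMost_Suc_shift) simp
  also have "\<dots> = (\<Sum>k\<le>n. \<Sum>\<tau>\<in>Sh k (n - k). F (Suc k) (ext_perm \<tau>))"
  proof (rule sum.cong[OF refl])
    fix k assume "k \<in> {..n}"
    then have "?A (Suc k) = ext_perm ` Sh k (n - k)" using Sh_first[of k n] by simp
    then show "sum (F (Suc k)) (?A (Suc k)) = (\<Sum>\<tau>\<in>Sh k (n - k). F (Suc k) (ext_perm \<tau>))"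
      by (simp add: sum.reindex inj_on_def ext_perm_inj)
  qed
  also have "(\<Sum>k\<le>Suc n. sum (F k) (?B k)) = (\<Sum>k\<le>n. sum (F k) (?B k))"
    by simp
  also have "\<dots> = (\<Sum>k\<le>n. \<Sum>\<tau>\<in>Sh k (n - k). F k (ext_perm \<tau> \<circ> cyc k))"
  proof (rule sum.cong[OF refl])
    fix k assume k: "k \<in> {..n}"
    then have "?B k = (\<lambda>\<tau>. ext_perm \<tau> \<circ> cyc k) ` Sh k (n - k)" using Sh_second[of k n] by simp
    moreover have "inj_on (\<lambda>\<tau>. ext_perm \<tau> \<circ> cyc k) (Sh k (n - k))"
    proof (rule inj_onI)
      fix \<tau> \<tau>' assume "ext_perm \<tau> \<circ> cyc k = ext_perm \<tau>' \<circ> cyc k"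
      then have "ext_perm \<tau> \<circ> cyc k \<circ> inv (cyc k) = ext_perm \<tau>' \<circ> cyc k \<circ> inv (cyc k)" by simp
      then show "\<tau> = \<tau>'"
        using permutes_inv_o(1)[OF cyc_permutes[of k n]] k by (simp add: comp_assoc ext_perm_inj)
    qed
    ultimately show "sum (F k) (?B k) = (\<Sum>\<tau>\<in>Sh k (n - k). F k (ext_perm \<tau> \<circ> cyc k))"
      by (simp add: sum.reindex)
  qed
  finally show ?thesis by (simp add: sum.distrib)
qed

lemma permute_list_ext_perm: "permute_list (ext_perm \<tau>) (v # vs) = v # permute_list \<tau> vs"
  by (rule nth_equalityI) (auto simp: permute_list_def ext_perm_def nth_Cons simp del: upt_Suc split: nat.splits)

lemma permute_list_cyc:
  assumes "k \<le> length vs" shows "permute_list (cyc k) (v # vs) = take k vs @ v # drop k vs"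
proof (rule nth_equalityI)
  show "length (permute_list (cyc k) (v # vs)) = length (take k vs @ v # drop k vs)" using assms by simp
  fix i assume "i < length (permute_list (cyc k) (v # vs))"
  then have i: "i < Suc (length vs)" by simp
  then have nth: "permute_list (cyc k) (v # vs) ! i = (v # vs) ! cyc k i"
    by (simp add: permute_list_def del: upt_Suc)
  show "permute_list (cyc k) (v # vs) ! i = (take k vs @ v # drop k vs) ! i"
  proof (cases "k < i")
    case True
    then obtain j where "i = Suc (k + j)" using less_iff_Suc_add by auto
    then show ?thesis unfolding nth using assms i by (simp add: cyc_def nth_append)
  next
    case False
    then show ?thesis unfolding nth using assms by (auto simp: cyc_def nth_append)
  qed
qed

lemma koszul_ext_perm:
  assumes "\<tau> permutes {..<length ds}"
  shows "koszul (ext_perm \<tau>) (d # ds) = koszul \<tau> ds"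
proof -
  have "{(i, j). i < j \<and> j < length (d # ds) \<and> ext_perm \<tau> j < ext_perm \<tau> i} =
    (\<lambda>(i, j). (Suc i, Suc j)) ` {(i, j). i < j \<and> j < length ds \<and> \<tau> j < \<tau> i}"
    (is "?L = ?R")
  proof (intro equalityI subsetI)
    fix p assume "p \<in> ?L"
    then obtain i j where p: "p = (i, j)" "i < j" "j < length (d # ds)" "ext_perm \<tau> j < ext_perm \<tau> i" by blast
    moreover from p obtain j' where "j = Suc j'" by (cases j) auto
    moreover from p obtain i' where "i = Suc i'" by (cases i) auto
    ultimately show "p \<in> ?R" by auto
  qed auto
  then show ?thesis
    unfolding koszul_def by (simp add: prod.reindex inj_on_def case_prod_unfold)
qed

lemma koszul_cyc:
  assumes "k \<le> length ds" shows "koszul (cyc k) (d # ds) = msgn (d * sum_list (take k ds))"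
proof -
  have "{(i, j). i < j \<and> j < length (d # ds) \<and> cyc k j < cyc k i} = (\<lambda>i. (i, k)) ` {..<k}"
    using assms by (auto simp: cyc_def split: if_splits)
  then have "koszul (cyc k) (d # ds) = (\<Prod>i<k. msgn (ds ! i * d))"
    unfolding koszul_def by (simp add: prod.reindex inj_on_def cyc_def)
  also have "\<dots> = msgn (d * sum_list (take k ds))"
    using assms
  proof (induction k)
    case (Suc k)
    then show ?case by (simp add: take_Suc_conv_app_nth distrib_left msgn_add mult.commute)
  qed simp
  finally show ?thesis .
qed

section \<open>Recursion for the coproduct of a word\<close>

definition shuffle_sum :: "int list \<Rightarrow> 'a::graded_vector list \<Rightarrow> 'a sym \<otimes> 'a sym" where
  "shuffle_sum ds vs = (\<Sum>k\<le>length vs. \<Sum>\<sigma>\<in>Sh k (length vs - k).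
     koszul \<sigma> ds *\<^sub>R
       (sprod (take k (permute_list \<sigma> vs)) \<otimes> sprod (drop k (permute_list \<sigma> vs))))"

lemma coprod_eq: "coprod = sym_lift (hext shuffle_sum)"
  unfolding coprod_def shuffle_sum_def ..

text \<open>Left multiplication by \<open>v \<otimes> 1 + 1 \<otimes> v\<close>, the coproduct of
  \<open>v\<close>, on the tensor square; \<open>d\<close> is the degree of \<open>v\<close> that
  enters the Koszul sign.\<close>

definition smul2 :: "int \<Rightarrow> 'a::graded_vector \<Rightarrow> 'a sym \<otimes> 'a sym \<Rightarrow> 'a sym \<otimes> 'a sym" where
  "smul2 d v t = tmap 0 (smul v) (\<lambda>x. x) t + tmap d (\<lambda>x. x) (smul v) t"

lemma linear_smul2: "linear (smul2 d v)"
  unfolding smul2_def by (intro linear_compose_add linear_tmap linear_smul linear_ident)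

lemma smul2_tens:
  "x \<in> gcomp a \<Longrightarrow> smul2 d v (x \<otimes> y) = smul v x \<otimes> y + msgn (d * a) *\<^sub>R (x \<otimes> smul v y)"
  by (simp add: smul2_def tmap_homogeneous linear_smul linear_ident)

text \<open>The coproduct of a word as it must be if \<open>coprod\<close> is multiplicative, each
  letter \<open>v\<close> contributing the factor \<open>v \<otimes> 1 + 1 \<otimes> v\<close>. The
  last equation is meant for the empty word; its value when one list is longer is a default.\<close>

fun cop :: "int list \<Rightarrow> 'a::graded_vector list \<Rightarrow> 'a sym \<otimes> 'a sym" where
  "cop (d # ds) (v # vs) = smul2 d v (cop ds vs)"
| "cop _ _ = sym_unit \<otimes> sym_unit"

lemma shuffle_sum_eq_cop:
  assumes "homogeneous ds vs" shows "shuffle_sum ds vs = cop ds vs"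
  using assms
proof (induction rule: list_all2_induct)
  case Nil
  have "Sh 0 0 = {id}" by (auto simp: Sh_def permutes_id)
  then show ?case by (simp add: shuffle_sum_def koszul_id sym_unit_def)
next
  case (Cons d ds v vs)
  have len: "length ds = length vs" using Cons.hyps by (auto dest: list_all2_lengthD)
  \<comment> \<open>The two shuffles obtained from \<open>\<tau>\<close> put \<open>v\<close> at the
    head of the left or of the right block and give the two summands of \<open>smul2\<close>. In the
    second, \<open>v\<close> passes the whole left block, whose total degree is
    \<open>sum_list (take k (permute_list \<tau> ds))\<close>.\<close>
  have step: "koszul (ext_perm \<tau>) (d # ds) *\<^sub>R
       (sprod (take (Suc k) (permute_list (ext_perm \<tau>) (v # vs))) \<otimes> sprod (drop (Suc k) (permute_list (ext_perm \<tau>) (v # vs)))) +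
      koszul (ext_perm \<tau> \<circ> cyc k) (d # ds) *\<^sub>R
       (sprod (take k (permute_list (ext_perm \<tau> \<circ> cyc k) (v # vs))) \<otimes> sprod (drop k (permute_list (ext_perm \<tau> \<circ> cyc k) (v # vs)))) =
      smul2 d v (koszul \<tau> ds *\<^sub>R (sprod (take k (permute_list \<tau> vs)) \<otimes> sprod (drop k (permute_list \<tau> vs))))"
    if k: "k \<le> length vs" and \<tau>: "\<tau> \<in> Sh k (length vs - k)" for k \<tau>
  proof -
    have p: "\<tau> permutes {..<length vs}" using k \<tau> by (simp add: Sh_def)
    have p': "ext_perm \<tau> permutes {..<length (d # ds)}" "cyc k permutes {..<length (d # ds)}"
      using ext_perm_permutes[OF p] cyc_permutes[OF k] len by auto
    have "homogeneous (take k (permute_list \<tau> ds)) (take k (permute_list \<tau> vs))"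
      using homogeneous_permute[OF Cons.hyps(2) p] by simp
    note h = sprod_gcomp[OF this]
    have perm: "permute_list (ext_perm \<tau> \<circ> cyc k) (v # vs) =
       take k (permute_list \<tau> vs) @ v # drop k (permute_list \<tau> vs)"
      using p' len k by (subst permute_list_compose) (simp_all add: permute_list_ext_perm permute_list_cyc)
    have kos: "koszul (ext_perm \<tau> \<circ> cyc k) (d # ds) = koszul \<tau> ds * msgn (d * sum_list (take k (permute_list \<tau> ds)))"
      using p p' len k
      by (subst koszul_compose) (simp_all add: permute_list_ext_perm koszul_cyc koszul_ext_perm)
    show ?thesis
      unfolding perm kos linear_scale[OF linear_smul2] smul2_tens[OF h] permute_list_ext_perm
      using p k len by (simp add: koszul_ext_perm smul_sprod scaleR_add_right)
  qed
  have "shuffle_sum (d # ds) (v # vs) = (\<Sum>k\<le>length vs. \<Sum>\<tau>\<in>Sh k (length vs - k).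
      smul2 d v (koszul \<tau> ds *\<^sub>R (sprod (take k (permute_list \<tau> vs)) \<otimes> sprod (drop k (permute_list \<tau> vs)))))"
    unfolding shuffle_sum_def length_Cons sum_Sh_Suc
    by (intro sum.cong refl) (simp only: step atMost_iff)
  also have "\<dots> = smul2 d v (shuffle_sum ds vs)"
    by (simp add: shuffle_sum_def linear_sum[OF linear_smul2])
  finally show ?case by (simp add: Cons.IH)
qed

lemma multilinear_update:
  assumes "multilinear \<phi>" "i < length xs" shows "linear (\<lambda>v. \<phi> (xs[i := v]))"
  using multilinearD[OF assms(1), of "take i xs" "drop (Suc i) xs"] assms(2)
  by (simp add: upd_conv_take_nth_drop)

lemma multilinear_shuffle_sum: "multilinear (shuffle_sum ds)"
proof (rule multilinearI)
  fix us ws :: "'a list"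
  have "linear (\<lambda>v. sprod (take k (permute_list \<sigma> (us @ v # ws))) \<otimes> sprod (drop k (permute_list \<sigma> (us @ v # ws))))"
    if k: "k \<le> Suc (length us + length ws)" and \<sigma>: "\<sigma> \<in> Sh k (Suc (length us + length ws) - k)" for k \<sigma>
  proof -
    let ?n = "Suc (length us + length ws)"
    have p: "\<sigma> permutes {..<?n}" using k \<sigma> by (simp add: Sh_def)
    \<comment> \<open>\<open>i\<close> is the place where the varying letter lands. The permuted
      word is a fixed list updated at \<open>i\<close>, so exactly one of the two blocks depends on
      \<open>v\<close>, and it does so linearly.\<close>
    obtain i where i: "\<sigma> i = length us" "i < ?n"
      using permutes_surj[OF p] permutes_not_in[OF p] by (metis add.commute lessThan_iff less_add_Suc2 surjD)
    define xs where "xs = permute_list \<sigma> (us @ 0 # ws)"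
    have len: "length xs = ?n" by (simp add: xs_def)
    have upd: "permute_list \<sigma> (us @ v # ws) = xs[i := v]" for v
    proof (rule nth_equalityI)
      fix j assume j: "j < length (permute_list \<sigma> (us @ v # ws))"
      have "\<sigma> j = length us \<longleftrightarrow> j = i" using inj_eq[OF permutes_inj[OF p], of j i] i by simp
      moreover have "(us @ v # ws) ! m = (us @ w # ws) ! m" if "m \<noteq> length us" for m and v w :: 'a
        using that by (auto simp: nth_append nth_Cons split: nat.splits)
      ultimately show "permute_list \<sigma> (us @ v # ws) ! j = xs[i := v] ! j"
        using j p i by (cases "j = i") (auto simp: xs_def permute_list_nth)
    qed (simp add: len)
    show ?thesis
    proof (cases "i < k")
      case True
      then have "linear (\<lambda>v. sprod ((take k xs)[i := v]))"
        using i len by (intro multilinear_update[OF multilinear_sprod]) simp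
      then show ?thesis
        using True unfolding upd
        by (auto simp: take_update_swap intro!: linear_intros)
    next
      case False
      then have "linear (\<lambda>v. sprod ((drop k xs)[i - k := v]))"
        using i len by (intro multilinear_update[OF multilinear_sprod]) auto
      then show ?thesis
        using False unfolding upd
        by (auto simp: drop_update_swap intro!: linear_intros)
    qed
  qed
  then show "linear (\<lambda>v. shuffle_sum ds (us @ v # ws))"
    unfolding shuffle_sum_def length_append length_Cons add_Suc_right
    by (intro linear_compose_sum ballI linear_compose_scale_right) auto
qed

text \<open>Through \<open>cop\<close>, the graded symmetry of the shuffle formula reduces to this
  relation between two operators, and no identity between shuffles has to be checked.\<close>

lemma smul2_commute:
  fixes v w :: "'a::graded_vector"
  assumes v: "v \<in> gcomp d" and w: "w \<in> gcomp e"
  shows "smul2 d v (smul2 e w t) = msgn (d * e) *\<^sub>R smul2 e w (smul2 d v t)"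
proof (rule tensor_eqI[where F = "\<lambda>t. smul2 d v (smul2 e w t)" and G = "\<lambda>t. msgn (d * e) *\<^sub>R smul2 e w (smul2 d v t)"])
  fix x y :: "'a sym" and a b assume x: "x \<in> gcomp a" and y: "y \<in> gcomp b"
  have wx: "smul w x \<in> gcomp (a + e)" "smul v x \<in> gcomp (a + d)"
    using Hom_gcomp[OF Hom_smul] v w x by auto
  show "smul2 d v (smul2 e w (x \<otimes> y)) = msgn (d * e) *\<^sub>R smul2 e w (smul2 d v (x \<otimes> y))"
    unfolding smul2_tens[OF x] linear_add[OF linear_smul2] linear_scale[OF linear_smul2]
      smul2_tens[OF wx(1)] smul2_tens[OF wx(2)] smul_commute[OF v w]
    by (simp add: linear_scale[OF linear_tens_left] linear_scale[OF linear_tens_right] algebra_simps msgn_add)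
qed (intro linear_compose_scale_right linear_comp[OF linear_smul2] linear_smul2)+

lemma cop_swap:
  assumes "homogeneous ds us" and v: "v \<in> gcomp d" and w: "w \<in> gcomp e"
  shows "cop (ds @ d # e # es) (us @ v # w # ws) = msgn (d * e) *\<^sub>R cop (ds @ e # d # es) (us @ w # v # ws)"
  using assms(1)
  by (induction rule: list_all2_induct) (simp_all add: smul2_commute[OF v w] linear_scale[OF linear_smul2])

lemma hext_shuffle_sum: "homogeneous ds vs \<Longrightarrow> hext shuffle_sum vs = cop ds vs"
  by (simp add: hext_homogeneous[OF _ multilinear_shuffle_sum] shuffle_sum_eq_cop)

lemma
  shows linear_coprod: "linear (coprod :: 'a::graded_vector sym \<Rightarrow> _)"
    and coprod_sprod: "homogeneous ds (vs :: 'a list) \<Longrightarrow> coprod (sprod vs) = cop ds vs"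
proof -
  have mlin: "multilinear (hext shuffle_sum)"
    by (rule multilinear_hext[OF multilinear_shuffle_sum])
  have swap: "hext shuffle_sum (us @ v # w # ws) = msgn (d * e) *\<^sub>R hext shuffle_sum (us @ w # v # ws)"
    if "homogeneous ds us" "v \<in> gcomp d" "w \<in> gcomp e" "homogeneous es ws"
    for us ws and v w :: 'a and d e ds es
    using cop_swap[OF that(1-3)] that
      hext_shuffle_sum[of "ds @ d # e # es" "us @ v # w # ws"] hext_shuffle_sum[of "ds @ e # d # es" "us @ w # v # ws"]
    by (simp add: list_all2_appendI)
  show "linear (coprod :: 'a sym \<Rightarrow> _)"
    unfolding coprod_eq by (rule linear_sym_lift_swap[OF mlin swap])
  show "coprod (sprod vs) = cop ds vs" if "homogeneous ds vs" for vs :: "'a list"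
    unfolding coprod_eq hext_shuffle_sum[OF that, symmetric]
    by (rule sym_lift_sprod_swap[OF mlin swap])
qed

lemma coprod_unit: "coprod sym_unit = sym_unit \<otimes> sym_unit"
  using coprod_sprod[of "[]" "[]"] by (simp add: sym_unit_def)

lemma coprod_smul:
  fixes v :: "'a::graded_vector"
  assumes "v \<in> gcomp d" shows "coprod (smul v x) = smul2 d v (coprod x)"
proof (rule sym_eqI[where F = "\<lambda>x. coprod (smul v x)" and G = "\<lambda>x. smul2 d v (coprod x)"])
  fix ds vs assume "homogeneous ds (vs :: 'a list)"
  then show "coprod (smul v (sprod vs)) = smul2 d v (coprod (sprod vs))"
    using assms coprod_sprod[of "d # ds" "v # vs"] by (simp add: smul_sprod coprod_sprod)
qed (intro linear_comp[OF linear_coprod] linear_comp[OF linear_smul2] linear_smul linear_coprod)+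

lemma Hom_coprod: "(coprod :: 'a::graded_vector sym \<Rightarrow> _) \<in> Hom 0"
proof (rule Hom_symI[OF linear_coprod])
  have smul2: "smul2 d v \<in> Hom d" if "v \<in> gcomp d" for d and v :: 'a
  proof (rule Hom_tensorI[OF linear_smul2])
    fix x y :: "'a sym" and a b assume *: "x \<in> gcomp a" "y \<in> gcomp b"
    show "smul2 d v (x \<otimes> y) \<in> gcomp (a + b + d)"
      using tens_gcomp[OF Hom_gcomp[OF Hom_smul[OF that] *(1)] *(2)]
        tens_gcomp[OF *(1) Hom_gcomp[OF Hom_smul[OF that] *(2)]]
      by (simp add: smul2_tens[OF *(1)] ac_simps)
  qed
  fix ds vs assume h: "homogeneous ds (vs :: 'a list)"
  then have "cop ds vs \<in> gcomp (sum_list ds)"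
  proof (induction rule: list_all2_induct)
    case Nil
    then show ?case using tens_gcomp[OF sym_unit_gcomp sym_unit_gcomp] by simp
  next
    case (Cons d ds v vs)
    then show ?case using Hom_gcomp[OF smul2[OF Cons.hyps(1)] Cons.IH] by (simp add: add.commute)
  qed
  then show "coprod (sprod vs) \<in> gcomp (sum_list ds + 0)" by (simp add: coprod_sprod[OF h])
qed

subsection \<open>Convolution\<close>

text \<open>
  The parameter \<open>q\<close> is the degree of \<open>\<beta>\<close> that enters the Koszul sign.
  By \<open>conv_smul\<close> below, composition with \<open>smul v\<close> acts on convolutions as a graded derivation; hence
  identities between convolutions follow by induction on a word, generalising over the cochains involved.
\<close>

definition conv :: "int \<Rightarrow> ('b::real_vector \<Rightarrow> 'c::real_vector \<Rightarrow> 'd::real_vector) \<Rightarrow>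
    ('a::graded_vector sym \<Rightarrow> 'b) \<Rightarrow> ('a sym \<Rightarrow> 'c) \<Rightarrow> 'a sym \<Rightarrow> 'd" where
  "conv q m \<alpha> \<beta> x = tensor_lift m (tmap q \<alpha> \<beta> (coprod x))"

lemma bilinearD: "bilinear m \<Longrightarrow> linear (m x)" "bilinear m \<Longrightarrow> linear (\<lambda>x. m x y)"
  by (simp_all add: bilinear_def)

lemma bilinearI: "(\<And>x. linear (m x)) \<Longrightarrow> (\<And>y. linear (\<lambda>x. m x y)) \<Longrightarrow> bilinear m"
  by (simp add: bilinear_def)

lemma linear_tensor_lift_bilinear: "bilinear m \<Longrightarrow> linear (tensor_lift m)"
  by (intro linear_tensor_lift bilinearD)

lemma tensor_lift_bilinear: "bilinear m \<Longrightarrow> tensor_lift m (x \<otimes> y) = m x y"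
  by (intro tensor_lift_tens bilinearD)

lemma linear_conv: "bilinear m \<Longrightarrow> linear \<alpha> \<Longrightarrow> linear \<beta> \<Longrightarrow> linear (conv q m \<alpha> \<beta>)"
  unfolding conv_def
  by (intro linear_comp[OF linear_tensor_lift_bilinear] linear_comp[OF linear_tmap] linear_coprod)

lemma tensor_lift_tmap_homogeneous:
  assumes "bilinear m" "linear \<alpha>" "linear \<beta>" "x \<in> gcomp d"
  shows "tensor_lift m (tmap q \<alpha> \<beta> (x \<otimes> y)) = msgn (q * d) *\<^sub>R m (\<alpha> x) (\<beta> y)"
  by (simp add: tmap_homogeneous[OF assms(2-4)] linear_scale[OF linear_tensor_lift_bilinear]
      tensor_lift_bilinear assms(1))

lemma conv_unit:
  assumes "bilinear m" "linear \<alpha>" "linear \<beta>"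
  shows "conv q m \<alpha> \<beta> sym_unit = m (\<alpha> sym_unit) (\<beta> sym_unit)"
  by (simp add: conv_def coprod_unit tensor_lift_tmap_homogeneous[OF assms sym_unit_gcomp])

text \<open>Both sides are linear maps applied to \<open>coprod x\<close>, so they may be compared
  on homogeneous tensors, without any property of the coproduct. The outer map \<open>f\<close>
  carries the signs and linear maps that are pulled out of a convolution.\<close>

lemma conv_cong:
  fixes \<alpha> :: "'a::graded_vector sym \<Rightarrow> 'b::real_vector" and \<beta> :: "'a sym \<Rightarrow> 'c::real_vector"
  assumes lin: "bilinear m" "linear \<alpha>" "linear \<beta>" "bilinear m'" "linear \<alpha>'" "linear \<beta>'"
    and f: "linear f"
    and eq: "\<And>x y d e. x \<in> gcomp d \<Longrightarrow> y \<in> gcomp e \<Longrightarrow>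
      msgn (q * d) *\<^sub>R m (\<alpha> x) (\<beta> y) = msgn (q' * d) *\<^sub>R f (m' (\<alpha>' x) (\<beta>' y))"
  shows "conv q m \<alpha> \<beta> x = f (conv q' m' \<alpha>' \<beta>' x)"
  unfolding conv_def
  by (rule tensor_eqI[where F = "\<lambda>t. tensor_lift m (tmap q \<alpha> \<beta> t)" and G = "\<lambda>t. f (tensor_lift m' (tmap q' \<alpha>' \<beta>' t))"])
    (auto intro!: linear_comp[OF linear_tensor_lift_bilinear] linear_comp[OF f] linear_tmap lin
      simp: tensor_lift_tmap_homogeneous lin eq linear_scale[OF f])

text \<open>\<open>smul2\<close> has two terms. In the first, the left factor gains degree
  \<open>d\<close>, which yields the visible sign. In the second, the sign of moving
  \<open>v\<close> past the left factor is absorbed into the sign parameter, which becomes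
  \<open>q + d\<close>, the degree of \<open>\<beta>\<close> composed with
  \<open>smul v\<close>.\<close>

lemma conv_smul:
  fixes \<alpha> :: "'a::graded_vector sym \<Rightarrow> 'b::real_vector" and \<beta> :: "'a sym \<Rightarrow> 'c::real_vector"
  assumes lin: "bilinear m" "linear \<alpha>" "linear \<beta>" and v: "v \<in> gcomp d"
  shows "conv q m \<alpha> \<beta> (smul v x) = msgn (q * d) *\<^sub>R conv q m (\<lambda>x. \<alpha> (smul v x)) \<beta> x +
    conv (q + d) m \<alpha> (\<lambda>x. \<beta> (smul v x)) x"
proof -
  note lin' = linear_comp[OF lin(2) linear_smul] linear_comp[OF lin(3) linear_smul]
  note linL = linear_comp[OF linear_tensor_lift_bilinear] linear_comp[OF linear_tmap] lin lin' linear_smul2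
    linear_compose_add linear_compose_scale_right linear_ident
  have "tensor_lift m (tmap q \<alpha> \<beta> (smul2 d v t)) =
    msgn (q * d) *\<^sub>R tensor_lift m (tmap q (\<lambda>x. \<alpha> (smul v x)) \<beta> t) +
    tensor_lift m (tmap (q + d) \<alpha> (\<lambda>x. \<beta> (smul v x)) t)" for t
  proof (rule tensor_eqI[where F = "\<lambda>t. tensor_lift m (tmap q \<alpha> \<beta> (smul2 d v t))" and
        G = "\<lambda>t. msgn (q * d) *\<^sub>R tensor_lift m (tmap q (\<lambda>x. \<alpha> (smul v x)) \<beta> t) +
    tensor_lift m (tmap (q + d) \<alpha> (\<lambda>x. \<beta> (smul v x)) t)"])
    fix x y :: "'a sym" and a b assume x: "x \<in> gcomp a" and y: "y \<in> gcomp b"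
    have vx: "smul v x \<in> gcomp (a + d)" using Hom_gcomp[OF Hom_smul[OF v] x] .
    show "tensor_lift m (tmap q \<alpha> \<beta> (smul2 d v (x \<otimes> y))) =
      msgn (q * d) *\<^sub>R tensor_lift m (tmap q (\<lambda>x. \<alpha> (smul v x)) \<beta> (x \<otimes> y)) +
      tensor_lift m (tmap (q + d) \<alpha> (\<lambda>x. \<beta> (smul v x)) (x \<otimes> y))"
      unfolding smul2_tens[OF x]
      by (simp add: linear_add[OF linear_tmap] linear_scale[OF linear_tmap] lin lin'
          linear_add[OF linear_tensor_lift_bilinear] linear_scale[OF linear_tensor_lift_bilinear]
          tensor_lift_tmap_homogeneous[OF _ _ _ x] tensor_lift_tmap_homogeneous[OF _ _ _ vx] algebra_simps msgn_add)
  qed (intro linL)+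
  then show ?thesis by (simp add: conv_def coprod_smul[OF v])
qed

lemma conv_add_left:
  fixes \<alpha> :: "'a::graded_vector sym \<Rightarrow> 'b::real_vector" and \<beta> :: "'a sym \<Rightarrow> 'c::real_vector"
  assumes lin: "bilinear m" "linear \<alpha>" "linear \<alpha>'" "linear \<beta>"
  shows "conv q m (\<lambda>x. \<alpha> x + \<alpha>' x) \<beta> x = conv q m \<alpha> \<beta> x + conv q m \<alpha>' \<beta> x"
  unfolding conv_def
  by (rule tensor_eqI[where F = "\<lambda>t. tensor_lift m (tmap q (\<lambda>x. \<alpha> x + \<alpha>' x) \<beta> t)" and
        G = "\<lambda>t. tensor_lift m (tmap q \<alpha> \<beta> t) + tensor_lift m (tmap q \<alpha>' \<beta> t)"])
    (auto intro!: linear_comp[OF linear_tensor_lift_bilinear] linear_tmap linear_compose_add lin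
      simp: tensor_lift_tmap_homogeneous lin linear_compose_add linear_add[OF bilinearD(2)] scaleR_add_right)

lemma conv_add_right:
  fixes \<alpha> :: "'a::graded_vector sym \<Rightarrow> 'b::real_vector" and \<beta> :: "'a sym \<Rightarrow> 'c::real_vector"
  assumes lin: "bilinear m" "linear \<alpha>" "linear \<beta>" "linear \<beta>'"
  shows "conv q m \<alpha> (\<lambda>x. \<beta> x + \<beta>' x) x = conv q m \<alpha> \<beta> x + conv q m \<alpha> \<beta>' x"
  unfolding conv_def
  by (rule tensor_eqI[where F = "\<lambda>t. tensor_lift m (tmap q \<alpha> (\<lambda>x. \<beta> x + \<beta>' x) t)" and
        G = "\<lambda>t. tensor_lift m (tmap q \<alpha> \<beta> t) + tensor_lift m (tmap q \<alpha> \<beta>' t)"])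
    (auto intro!: linear_comp[OF linear_tensor_lift_bilinear] linear_tmap linear_compose_add lin
      simp: tensor_lift_tmap_homogeneous lin linear_compose_add linear_add[OF bilinearD(1)] scaleR_add_right)

lemma conv_scale_left:
  assumes lin: "bilinear m" "linear \<alpha>" "linear \<beta>"
  shows "conv q m (\<lambda>x. c *\<^sub>R \<alpha> x) \<beta> x = c *\<^sub>R conv q m \<alpha> \<beta> x"
  by (rule conv_cong)
    (auto intro: lin linear_compose_scale_right linear_ident simp: linear_scale[OF bilinearD(2)] lin)

lemma conv_scale_right:
  assumes lin: "bilinear m" "linear \<alpha>" "linear \<beta>"
  shows "conv q m \<alpha> (\<lambda>x. c *\<^sub>R \<beta> x) x = c *\<^sub>R conv q m \<alpha> \<beta> x"
  by (rule conv_cong)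
    (auto intro: lin linear_compose_scale_right linear_ident simp: linear_scale[OF bilinearD(1)] lin)

lemma conv_zero_left:
  assumes lin: "bilinear m" "linear \<beta>"
  shows "conv q m (\<lambda>x. 0) \<beta> x = 0"
  using conv_scale_left[OF lin(1) linear_zero lin(2), of q 0 x] by simp

lemma conv_zero_right:
  assumes lin: "bilinear m" "linear \<alpha>"
  shows "conv q m \<alpha> (\<lambda>x. 0) x = 0"
  using conv_scale_right[OF lin linear_zero, of q 0 x] by simp

lemma Hom_conv:
  assumes m: "bilinear m" "\<And>x y i j. x \<in> gcomp i \<Longrightarrow> y \<in> gcomp j \<Longrightarrow> m x y \<in> gcomp (i + j + e)"
    and "\<alpha> \<in> Hom a" "\<beta> \<in> Hom b"
  shows "conv q m \<alpha> \<beta> \<in> Hom (a + b + e)"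
proof -
  have "tensor_lift m \<in> Hom e"
    by (rule Hom_tensorI) (simp_all add: linear_tensor_lift_bilinear tensor_lift_bilinear m)
  from Hom_compose[OF this Hom_compose[OF Hom_tmap[OF assms(3,4)] Hom_coprod]]
  show ?thesis by (simp add: conv_def[abs_def] add.commute)
qed

section \<open>The counit and the projection onto the linear part\<close>

definition counit :: "'a::graded_vector sym \<Rightarrow> real" where
  "counit = sym_lift (\<lambda>vs. if vs = [] then 1 else 0)"

definition sym_proj :: "'a::graded_vector sym \<Rightarrow> 'a" where
  "sym_proj = sym_lift (\<lambda>vs. case vs of [v] \<Rightarrow> v | _ \<Rightarrow> 0)"

lemma
  fixes vs :: "'a::graded_vector list"
  shows linear_counit: "linear (counit :: 'a sym \<Rightarrow> real)"
    and counit_sprod: "counit (sprod vs) = (if vs = [] then 1 else 0)"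
proof -
  have mlin: "multilinear (\<lambda>vs :: 'a list. if vs = [] then 1 else 0 :: real)"
    by (intro multilinearI) (simp add: linear_zero)
  show "linear (counit :: 'a sym \<Rightarrow> real)" "counit (sprod vs) = (if vs = [] then 1 else 0)"
    unfolding counit_def by (rule linear_sym_lift_swap[OF mlin] sym_lift_sprod_swap[OF mlin]; simp)+
qed

lemma
  fixes vs :: "'a::graded_vector list"
  shows linear_sym_proj: "linear (sym_proj :: 'a sym \<Rightarrow> 'a)"
    and sym_proj_sprod: "sym_proj (sprod vs) = (case vs of [v] \<Rightarrow> v | _ \<Rightarrow> 0)"
proof -
  have mlin: "multilinear (\<lambda>vs :: 'a list. case vs of [v] \<Rightarrow> v | _ \<Rightarrow> 0)"
  proof (rule multilinearI)
    fix us ws :: "'a list"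
    consider "us = []" "ws = []" | w ws' where "us = []" "ws = w # ws'" | u us' where "us = u # us'"
      by (meson list.exhaust)
    then show "linear (\<lambda>v. case us @ v # ws of [v] \<Rightarrow> v | _ \<Rightarrow> 0)"
    proof cases
      case 3
      then have "(\<lambda>v. case us @ v # ws of [v] \<Rightarrow> v | _ \<Rightarrow> 0) = (\<lambda>v. 0)"
        by (auto simp: fun_eq_iff split: list.splits)
      then show ?thesis by (simp only: linear_zero)
    qed (simp_all add: linear_zero linear_ident)
  qed
  have swap: "(case us @ v # w # ws of [v] \<Rightarrow> v | _ \<Rightarrow> 0) = c *\<^sub>R (case us @ w # v # ws of [v] \<Rightarrow> v | _ \<Rightarrow> 0)"
    for us ws and v w :: 'a and c
    by (auto simp: append_eq_Cons_conv split: list.splits)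
  show "linear (sym_proj :: 'a sym \<Rightarrow> 'a)" "sym_proj (sprod vs) = (case vs of [v] \<Rightarrow> v | _ \<Rightarrow> 0)"
    unfolding sym_proj_def by (rule linear_sym_lift_swap[OF mlin] sym_lift_sprod_swap[OF mlin]; rule swap)+
qed

lemma counit_unit: "counit sym_unit = 1"
  by (simp add: sym_unit_def counit_sprod)

lemma counit_smul: "counit (smul v x) = 0"
  by (rule sym_eqI[where F = "\<lambda>x. counit (smul v x)"])
    (auto simp: smul_sprod counit_sprod intro!: linear_comp[OF linear_counit] linear_smul linear_zero)

lemma sym_proj_unit: "sym_proj sym_unit = 0"
  by (simp add: sym_unit_def sym_proj_sprod)

lemma linear_counit_scale: "linear (\<lambda>x. counit x *\<^sub>R e)"
  by (rule linearI) (simp_all add: linear_add[OF linear_counit] linear_scale[OF linear_counit] scaleR_add_left)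

lemma sym_proj_smul: "sym_proj (smul v x) = counit x *\<^sub>R v"
  by (rule sym_eqI[where F = "\<lambda>x. sym_proj (smul v x)"])
    (auto simp: smul_sprod counit_sprod sym_proj_sprod intro!: linear_comp[OF linear_sym_proj] linear_smul linear_counit_scale
      split: list.splits)

lemma sym_proj_sym_map:
  assumes "F \<in> Hom 0" shows "sym_proj (sym_map F x) = F (sym_proj x)"
  by (rule sym_eqI[OF linear_comp[OF linear_sym_proj linear_sym_map[OF assms]]
        linear_comp[OF Hom_linear[OF assms] linear_sym_proj]])
    (simp add: sym_map_sprod[OF assms] sym_proj_sprod linear_0[OF Hom_linear[OF assms]] split: list.splits)

lemma conv_counit_right:
  fixes \<alpha> :: "'a::graded_vector sym \<Rightarrow> 'b::real_vector"
  assumes m: "bilinear m" and lin: "linear \<alpha>"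
  shows "conv 0 m \<alpha> (\<lambda>x. counit x *\<^sub>R e) x = m (\<alpha> x) e"
proof (rule sym_eqI[where G = "\<lambda>x. m (\<alpha> x) e"])
  fix ds and vs :: "'a list" assume "homogeneous ds vs"
  then show "conv 0 m \<alpha> (\<lambda>x. counit x *\<^sub>R e) (sprod vs) = m (\<alpha> (sprod vs)) e"
    using lin
  proof (induction arbitrary: \<alpha> rule: list_all2_induct)
    case Nil
    then show ?case by (simp add: conv_unit m linear_counit_scale counit_unit flip: sym_unit_def)
  next
    case (Cons d ds v vs)
    note lin' = Cons.prems Cons.prems[THEN linear_comp[OF _ linear_smul, of _ v]]
    show ?case
      by (simp add: conv_smul[OF m lin'(1) linear_counit_scale Cons.hyps(1)] Cons.IH[OF lin'(2)]
          counit_smul conv_zero_right m lin' flip: smul_sprod)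
  qed
qed (intro linear_conv m lin linear_counit_scale linear_comp[OF bilinearD(2)[OF m] lin])+

text \<open>The Koszul sign is trivial for every \<open>q\<close>, since the left factor is
  supported on the empty word, which has degree 0.\<close>

lemma conv_counit_left:
  fixes \<beta> :: "'a::graded_vector sym \<Rightarrow> 'b::real_vector"
  assumes m: "bilinear m" and lin: "linear \<beta>"
  shows "conv q m (\<lambda>x. counit x *\<^sub>R e) \<beta> x = m e (\<beta> x)"
proof (rule sym_eqI[where G = "\<lambda>x. m e (\<beta> x)"])
  fix ds and vs :: "'a list" assume "homogeneous ds vs"
  then show "conv q m (\<lambda>x. counit x *\<^sub>R e) \<beta> (sprod vs) = m e (\<beta> (sprod vs))"
    using lin
  proof (induction arbitrary: \<beta> q rule: list_all2_induct)
    case Nil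
    then show ?case by (simp add: conv_unit m linear_counit_scale counit_unit flip: sym_unit_def)
  next
    case (Cons d ds v vs)
    note lin' = Cons.prems Cons.prems[THEN linear_comp[OF _ linear_smul, of _ v]]
    show ?case
      by (simp add: conv_smul[OF m linear_counit_scale lin'(1) Cons.hyps(1)] Cons.IH[OF lin'(2)]
          counit_smul conv_zero_left m lin' flip: smul_sprod)
  qed
qed (intro linear_conv m lin linear_counit_scale linear_comp[OF bilinearD(1)[OF m] lin])+

subsection \<open>Coderivations\<close>

lemma bilinear_smul: "bilinear smul"
  by (intro bilinearI linear_smul linear_smul_left)

lemma coder_conv:
  fixes lam :: "'a::graded_vector sym \<Rightarrow> 'a"
  assumes "linear lam" shows "coder lam x = conv 0 smul lam (\<lambda>x. x) x"
  unfolding coder_def conv_def o_def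
proof (rule tensor_eqI[where F = "\<lambda>t. sym_mult (tmap 0 (\<lambda>x. sym_incl (lam x)) id t)"])
  fix x y :: "'a sym" and d assume x: "x \<in> gcomp d"
  show "sym_mult (tmap 0 (\<lambda>x. sym_incl (lam x)) id (x \<otimes> y)) = tensor_lift smul (tmap 0 lam (\<lambda>x. x) (x \<otimes> y))"
    using tmap_homogeneous[OF linear_comp[OF linear_sym_incl assms] linear_id x, of 0 y]
    by (simp add: tensor_lift_tmap_homogeneous[OF bilinear_smul assms linear_ident x] smul_def id_def)
qed (intro linear_comp[OF linear_sym_mult] linear_comp[OF linear_tensor_lift_bilinear] bilinear_smul linear_tmap
    linear_comp[OF linear_sym_incl] linear_id linear_ident assms)+

lemma coder_eq: "linear lam \<Longrightarrow> coder lam = conv 0 smul lam (\<lambda>x. x)"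
  by (rule ext) (rule coder_conv)

lemma linear_coder: "linear lam \<Longrightarrow> linear (coder lam)"
  using linear_conv[OF bilinear_smul _ linear_ident, of lam 0] by (simp add: coder_eq)

text \<open>At an argument of degree \<open>a\<close>, the vector \<open>w\<close> passes a value of
  \<open>\<kappa>\<close> of degree \<open>a + l\<close>. The part of the sign belonging to
  \<open>a\<close> turns the parameter \<open>q + d\<close> back into \<open>q\<close>; the part
  belonging to \<open>l\<close> remains.\<close>

lemma conv_smul_out:
  fixes \<kappa> :: "'a::graded_vector sym \<Rightarrow> 'b::graded_vector"
  assumes \<kappa>: "\<kappa> \<in> Hom l" and lin: "linear \<beta>" and w: "w \<in> gcomp d"
  shows "conv (q + d) smul \<kappa> (\<lambda>x. smul w (\<beta> x)) x = msgn (l * d) *\<^sub>R smul w (conv q smul \<kappa> \<beta> x)"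
proof (rule conv_cong[where f = "\<lambda>y. msgn (l * d) *\<^sub>R smul w y"])
  fix x y :: "'a sym" and a assume x: "x \<in> gcomp a"
  show "msgn ((q + d) * a) *\<^sub>R smul (\<kappa> x) (smul w (\<beta> y)) =
       msgn (q * a) *\<^sub>R msgn (l * d) *\<^sub>R smul w (smul (\<kappa> x) (\<beta> y))"
    by (simp add: smul_commute[OF Hom_gcomp[OF \<kappa> x] w] algebra_simps msgn_add)
qed (intro bilinear_smul linear_comp[OF linear_smul] linear_compose_scale_right linear_smul Hom_linear[OF \<kappa>] lin)+

text \<open>The graded commutator of a coderivation with left multiplication by \<open>v\<close> is
  again a coderivation, with corestriction \<open>lam\<close> composed with \<open>smul v\<close>,
  of degree \<open>l + d\<close>. For this reason \<open>conv_coder\<close> is proved for all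
  \<open>lam\<close> and \<open>l\<close> at once.\<close>

lemma coder_smul:
  assumes lam: "lam \<in> Hom l" and v: "v \<in> gcomp d"
  shows "coder lam (smul v x) = coder (\<lambda>x. lam (smul v x)) x + msgn (l * d) *\<^sub>R smul v (coder lam x)"
  using conv_smul[OF bilinear_smul Hom_linear[OF lam] linear_ident v, of 0 x]
    conv_smul_out[OF lam linear_ident v, of 0 x]
  by (simp add: coder_conv Hom_linear[OF lam] linear_comp[OF Hom_linear[OF lam] linear_smul])

lemma Hom_compose_smul: "lam \<in> Hom l \<Longrightarrow> v \<in> gcomp d \<Longrightarrow> (\<lambda>x. lam (smul v x)) \<in> Hom (l + d)"
  by (rule Hom_compose[OF _ Hom_smul])

lemma coder_unit: "linear lam \<Longrightarrow> coder lam sym_unit = smul (lam sym_unit) sym_unit"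
  by (simp add: coder_conv conv_unit bilinear_smul linear_ident)

text \<open>Tested against pairs of cochains, this is the coderivation property of
  \<open>coder lam\<close>. Contraction with a letter gives both sides the same recursion, in which
  \<open>lam\<close>, \<open>\<alpha>\<close> or \<open>\<beta>\<close> is replaced by its
  contraction; hence all three vary in the induction.\<close>

lemma conv_coder:
  fixes \<alpha> :: "'a::graded_vector sym \<Rightarrow> 'b::real_vector" and \<beta> :: "'a sym \<Rightarrow> 'c::real_vector"
  assumes m: "bilinear m" and lam: "lam \<in> Hom l" and lin: "linear \<alpha>" "linear \<beta>"
  shows "conv q m \<alpha> \<beta> (coder lam x) =
    conv (q + l) m \<alpha> (\<lambda>x. \<beta> (coder lam x)) x + msgn (l * q) *\<^sub>R conv q m (\<lambda>x. \<alpha> (coder lam x)) \<beta> x"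
proof (rule sym_eqI[where F = "\<lambda>x. conv q m \<alpha> \<beta> (coder lam x)" and
    G = "\<lambda>x. conv (q + l) m \<alpha> (\<lambda>x. \<beta> (coder lam x)) x + msgn (l * q) *\<^sub>R conv q m (\<lambda>x. \<alpha> (coder lam x)) \<beta> x"])
  fix ds and vs :: "'a list" assume "homogeneous ds vs"
  then show "conv q m \<alpha> \<beta> (coder lam (sprod vs)) =
      conv (q + l) m \<alpha> (\<lambda>x. \<beta> (coder lam x)) (sprod vs) + msgn (l * q) *\<^sub>R conv q m (\<lambda>x. \<alpha> (coder lam x)) \<beta> (sprod vs)"
    using lam lin
  proof (induction arbitrary: \<alpha> \<beta> lam l q rule: list_all2_induct)
    case Nil
    \<comment> \<open>This value need not vanish, even for an original \<open>lam\<close> that kills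
      the unit: after contraction with all letters of a word, it is the value of \<open>lam\<close>
      on that word.\<close>
    have u: "lam sym_unit \<in> gcomp l" using Hom_gcomp[OF Nil(1) sym_unit_gcomp] by simp
    note cl = linear_coder[OF Hom_linear[OF Nil(1)]]
    show ?case
      using Nil conv_smul[OF m Nil(2,3) u, of q sym_unit]
      by (simp add: coder_unit Hom_linear conv_unit m linear_comp[OF _ linear_smul] linear_comp[OF _ cl] mult.commute
        flip: sym_unit_def)
  next
    case (Cons d ds v vs)
    note lam = Cons.prems(1) and v = Cons.hyps(1)
    note lamv = Hom_compose_smul[OF lam v]
    note lin = Cons.prems(2,3) Cons.prems(2,3)[THEN linear_comp[OF _ linear_smul, of _ v]]
    have cl: "linear (coder lam)" "linear (coder (\<lambda>x. lam (smul v x)))"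
      using lam lamv by (auto intro: linear_coder Hom_linear)
    note lin2 = lin[THEN linear_comp[OF _ cl(1)]] lin[THEN linear_comp[OF _ cl(2)]]
      lin(1)[THEN linear_comp[OF _ linear_smul], THEN linear_comp[OF _ cl(1)]]
      lin(2)[THEN linear_comp[OF _ linear_smul], THEN linear_comp[OF _ cl(1)]]
    have dist: "\<phi> (coder lam (smul v x)) = \<phi> (coder (\<lambda>x. lam (smul v x)) x) + msgn (l * d) *\<^sub>R \<phi> (smul v (coder lam x))"
      if "linear \<phi>" for x and \<phi> :: "'a sym \<Rightarrow> 'e::real_vector"
      by (simp add: coder_smul[OF lam v] linear_add[OF that] linear_scale[OF that])
    note c = linear_conv[OF m lin(1,2), of q]
    have "conv q m \<alpha> \<beta> (coder lam (smul v (sprod vs))) =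
      conv q m \<alpha> \<beta> (coder (\<lambda>x. lam (smul v x)) (sprod vs)) +
      msgn (l * d) *\<^sub>R (msgn (q * d) *\<^sub>R conv q m (\<lambda>x. \<alpha> (smul v x)) \<beta> (coder lam (sprod vs)) +
        conv (q + d) m \<alpha> (\<lambda>x. \<beta> (smul v x)) (coder lam (sprod vs)))"
      by (simp add: dist[OF c] conv_smul[OF m lin(1,2) v])
    also have "\<dots> = conv (q + l) m \<alpha> (\<lambda>x. \<beta> (coder lam x)) (smul v (sprod vs)) +
        msgn (l * q) *\<^sub>R conv q m (\<lambda>x. \<alpha> (coder lam x)) \<beta> (smul v (sprod vs))"
      unfolding Cons.IH[OF lam lin(3,2)] Cons.IH[OF lam lin(1,4)] Cons.IH[OF lamv lin(1,2)]
        conv_smul[OF m lin(1) lin2(2) v] conv_smul[OF m lin2(1) lin(2) v]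
        dist[OF lin(1)] dist[OF lin(2)]
      by (simp add: conv_add_left conv_add_right conv_scale_left conv_scale_right m lin lin2
          linear_compose_scale_right algebra_simps msgn_add)
    finally show ?case by (simp add: smul_sprod)
  qed
qed (intro linear_comp[OF linear_conv] linear_conv linear_compose_add linear_compose_scale_right m lin
    linear_comp[OF lin(1)] linear_comp[OF lin(2)] linear_coder Hom_linear[OF lam])+

text \<open>This is the coalgebra morphism property of \<open>sym_map F\<close>, tested against
  pairs of cochains. Contracting with \<open>v\<close> before the map amounts to contracting with
  \<open>F v\<close> after it, so both sides satisfy the recursion of
  \<open>conv_smul\<close>.\<close>

lemma conv_sym_map:
  fixes \<alpha> :: "'b::graded_vector sym \<Rightarrow> 'c::real_vector" and F :: "'a::graded_vector \<Rightarrow> 'b"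
  assumes m: "bilinear m" and F: "F \<in> Hom 0" and lin: "linear \<alpha>" "linear \<beta>"
  shows "conv q m \<alpha> \<beta> (sym_map F x) = conv q m (\<lambda>x. \<alpha> (sym_map F x)) (\<lambda>x. \<beta> (sym_map F x)) x"
proof (rule sym_eqI[where F = "\<lambda>x. conv q m \<alpha> \<beta> (sym_map F x)"])
  fix ds and vs :: "'a list" assume "homogeneous ds vs"
  then show "conv q m \<alpha> \<beta> (sym_map F (sprod vs)) = conv q m (\<lambda>x. \<alpha> (sym_map F x)) (\<lambda>x. \<beta> (sym_map F x)) (sprod vs)"
    using lin
  proof (induction arbitrary: \<alpha> \<beta> q rule: list_all2_induct)
    case Nil
    then show ?case
      by (simp add: sym_map_unit[OF F] conv_unit m linear_comp[OF _ linear_sym_map[OF F]] flip: sym_unit_def)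
  next
    case (Cons d ds v vs)
    have Fv: "F v \<in> gcomp d" using Hom_gcomp[OF F Cons.hyps(1)] by simp
    note lin = Cons.prems Cons.prems[THEN linear_comp[OF _ linear_smul, of _ "F v"]]
    note lin2 = lin[THEN linear_comp[OF _ linear_sym_map[OF F]]]
    show ?case
      unfolding smul_sprod[symmetric] sym_map_smul[OF F] conv_smul[OF m lin(1,2) Fv]
        conv_smul[OF m lin2(1,2) Cons.hyps(1)] Cons.IH[OF lin(3,2)] Cons.IH[OF lin(1,4)] ..
  qed
qed (intro linear_comp[OF linear_conv] linear_conv linear_comp[OF lin(1)] linear_comp[OF lin(2)]
    linear_sym_map F m lin)+

text \<open>Together with \<open>sym_map_coder\<close>, this exhibits both composites as
  coderivations along \<open>sym_map F\<close>, with corestrictions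
  \<open>lam \<circ> sym_map F\<close> and \<open>F \<circ> lam\<close>. The defect of a section is
  thus the coderivation given by the difference of these two, its curvature.\<close>

lemma coder_sym_map:
  assumes "linear lam" and F: "F \<in> Hom 0"
  shows "coder lam (sym_map F x) = conv 0 smul (\<lambda>x. lam (sym_map F x)) (sym_map F) x"
  using conv_sym_map[OF bilinear_smul F assms(1) linear_ident, of 0 x] by (simp add: coder_conv assms)

lemma sym_map_coder:
  assumes lam: "linear lam" and F: "F \<in> Hom 0"
  shows "sym_map F (coder lam x) = conv 0 smul (\<lambda>x. F (lam x)) (sym_map F) x"
  unfolding coder_conv[OF lam]
  by (rule sym[OF conv_cong])
    (simp_all add: bilinear_smul linear_comp[OF Hom_linear[OF F]] linear_sym_map F lam linear_ident sym_map_smul)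

text \<open>Projecting \<open>smul u x\<close> leaves \<open>counit x\<close> times
  \<open>u\<close>, so the projected coderivation is \<open>lam\<close> convolved with the counit,
  which is \<open>lam\<close> again.\<close>

lemma sym_proj_coder:
  assumes lam: "linear lam" shows "sym_proj (coder lam x) = lam x"
proof -
  have b: "bilinear (\<lambda>u (c::real). c *\<^sub>R u)"
    by (intro bilinearI) (auto intro!: linearI simp: scaleR_add_left scaleR_add_right)
  have "lam x = conv 0 (\<lambda>u c. c *\<^sub>R u) lam (\<lambda>x. counit x *\<^sub>R (1::real)) x"
    using conv_counit_right[OF b lam, of "1::real" x] by simp
  also have "\<dots> = sym_proj (conv 0 smul lam (\<lambda>x. x) x)"
    by (rule conv_cong)
      (auto intro!: b bilinear_smul lam linear_counit linear_ident linear_sym_proj simp: sym_proj_smul)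
  finally show ?thesis by (simp add: coder_conv lam)
qed

lemma bilinear_rmul: "bilinear (\<lambda>y u. sym_mult (y \<otimes> sym_incl u))"
  by (intro bilinearI linear_intros)

text \<open>This is the only place where cocommutativity of the coproduct enters.\<close>

lemma conv_smul_flip:
  fixes F :: "'a::graded_vector \<Rightarrow> 'b::graded_vector"
  assumes F: "F \<in> Hom 0" and \<kappa>: "\<kappa> \<in> Hom l"
  shows "conv 0 smul \<kappa> (sym_map F) x = conv l (\<lambda>y u. sym_mult (y \<otimes> sym_incl u)) (sym_map F) \<kappa> x"
proof (rule sym_eqI[where F = "conv 0 smul \<kappa> (sym_map F)"])
  note linF = linear_sym_map[OF F]
  fix ds and vs :: "'a list" assume "homogeneous ds vs"
  then show "conv 0 smul \<kappa> (sym_map F) (sprod vs) = conv l (\<lambda>y u. sym_mult (y \<otimes> sym_incl u)) (sym_map F) \<kappa> (sprod vs)"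
    using \<kappa>
  proof (induction arbitrary: \<kappa> l rule: list_all2_induct)
    case Nil
    have "smul u sym_unit = sym_mult (sym_unit \<otimes> sym_incl u)" for u :: 'b
      by (simp add: sym_mult_unit) (simp add: sym_unit_def smul_sprod sym_incl_def)
    then show ?case
      using Nil by (simp add: conv_unit bilinear_smul bilinear_rmul linF Hom_linear sym_map_unit[OF F] flip: sym_unit_def)
  next
    case (Cons d ds v vs)
    have Fv: "F v \<in> gcomp d" using Hom_gcomp[OF F Cons.hyps(1)] by simp
    note v = Cons.hyps(1) and lin = Hom_linear[OF Cons.prems]
    have out: "conv l (\<lambda>y u. sym_mult (y \<otimes> sym_incl u)) (\<lambda>x. smul (F v) (sym_map F x)) \<kappa> x =
       smul (F v) (conv l (\<lambda>y u. sym_mult (y \<otimes> sym_incl u)) (sym_map F) \<kappa> x)" for x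
      by (rule conv_cong)
        (auto intro!: bilinear_rmul linear_comp[OF linear_smul] linF lin linear_smul simp: sym_mult_smul
          linear_scale[OF linear_smul])
    show ?case
      unfolding smul_sprod[symmetric] conv_smul[OF bilinear_smul lin linF v] conv_smul[OF bilinear_rmul linF lin v]
        sym_map_smul[OF F] out conv_smul_out[OF Cons.prems linF Fv, of 0, simplified]
      by (simp add: Cons.IH[OF Cons.prems] Cons.IH[OF Hom_compose_smul[OF Cons.prems v]]
        conv_smul_out[OF Cons.prems linF Fv, of 0, simplified])
  qed
qed (intro linear_conv bilinear_smul bilinear_rmul linear_sym_map F Hom_linear[OF \<kappa>])+

subsection \<open>Tensor words\<close>

definition tcons :: "'a::graded_vector \<Rightarrow> 'a talg \<Rightarrow> 'a talg" where
  "tcons v t = talg_cons (v \<otimes> t)"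

lemma
  fixes v :: "'a::graded_vector"
  shows bilinear_tcons: "bilinear (tcons :: 'a \<Rightarrow> _)"
    and tcons_word: "tcons v (word vs) = word (v # vs)"
    and talg_cons_eq: "(talg_cons :: 'a \<otimes> 'a talg \<Rightarrow> _) = tensor_lift tcons"
proof -
  note m = multilinear_Cons[OF multilinear_word]
  have l: "linear (\<lambda>v. talg_lift (\<lambda>vs. word (v # vs)) t)" for t :: "'a talg"
  proof (induction t rule: linear_talg_induct)
    case subspace
    show ?case
      by (rule subspaceI)
        (simp_all add: linear_0[OF linear_talg_lift[OF m]] linear_add[OF linear_talg_lift[OF m]]
          linear_scale[OF linear_talg_lift[OF m]] linear_zero linear_compose_add linear_compose_scale_right)
  next
    case (word ds vs)
    show ?case unfolding talg_lift_word[OF m] by (rule multilinear_Nil[OF multilinear_word])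
  qed
  have tcons: "tcons v t = talg_lift (\<lambda>vs. word (v # vs)) t" for v :: 'a and t
    unfolding tcons_def talg_cons_def by (rule tensor_lift_tens[OF l linear_talg_lift[OF m]])
  show "bilinear (tcons :: 'a \<Rightarrow> _)"
    by (intro bilinearI) (simp_all add: tcons[abs_def] l linear_talg_lift[OF m])
  show "tcons v (word vs) = word (v # vs)"
    by (simp add: tcons talg_lift_word[OF m])
  show "(talg_cons :: 'a \<otimes> 'a talg \<Rightarrow> _) = tensor_lift tcons"
    unfolding talg_cons_def tcons[abs_def] ..
qed

lemmas linear_tcons = bilinearD[OF bilinear_tcons]

lemma talg_eqI:
  assumes "linear F" "linear G" and "\<And>ds vs. homogeneous ds vs \<Longrightarrow> F (word vs) = G (word vs)"
  shows "F t = G t"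
  by (rule linear_talg_induct[OF subspace_linear_eq]) (use assms in auto)

lemma Hom_talgI:
  fixes F :: "'a::graded_vector talg \<Rightarrow> 'c::graded_vector"
  assumes F: "linear F"
    and deg: "\<And>ds vs. homogeneous ds vs \<Longrightarrow> F (word vs) \<in> gcomp (sum_list ds + p)"
  shows "F \<in> Hom p"
proof (rule HomI[OF F])
  fix n and x :: "'a talg" assume x: "x \<in> gcomp n"
  have "F (hproj n x) \<in> gcomp (n + p)"
  proof (induction x rule: linear_talg_induct)
    case subspace
    show ?case
      by (rule subspaceI) (simp_all add: linear_0[OF F] linear_add[OF F] linear_scale[OF F] hproj_add hproj_scaleR)
  next
    case (word ds vs)
    then show ?case
      using deg[OF word] by (auto simp: hproj_homogeneous[OF word_gcomp[OF word]] linear_0[OF F])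
  qed
  then show "F x \<in> gcomp (n + p)" using x by (simp add: gcomp_def)
qed

lemma tcons_gcomp:
  fixes v :: "'a::graded_vector"
  assumes v: "v \<in> gcomp d" and t: "t \<in> gcomp e" shows "tcons v t \<in> gcomp (d + e)"
proof -
  have "tcons v \<in> Hom d"
  proof (rule Hom_talgI[OF linear_tcons(1)])
    fix ds and vs :: "'a list" assume "homogeneous ds vs"
    then show "tcons v (word vs) \<in> gcomp (sum_list ds + d)"
      using v word_gcomp[of "d # ds" "v # vs"] by (simp add: tcons_word add.commute)
  qed
  from Hom_gcomp[OF this t] show ?thesis by (simp add: add.commute)
qed

subsection \<open>The induced representation on tensor words\<close>

context
  fixes \<rho> :: "'a::graded_vector sym \<otimes> 'v::graded_vector \<Rightarrow> 'v"
  assumes \<rho>: "\<rho> \<in> Hom 1"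
begin

definition ruth_words :: "int \<Rightarrow> 'a sym \<Rightarrow> int list \<Rightarrow> 'v list \<Rightarrow> 'v talg" where
  "ruth_words e x ds vs =
     (\<Sum>i<length vs. msgn ((e + 1) * sum_list (take i ds)) *\<^sub>R word (vs[i := \<rho> (x \<otimes> vs ! i)]))"

lemma linear_rho_left: "linear (\<lambda>x. \<rho> (x \<otimes> v))" and linear_rho_right: "linear (\<lambda>v. \<rho> (x \<otimes> v))"
  by (rule linear_comp[OF Hom_linear[OF \<rho>] linear_tens_left] linear_comp[OF Hom_linear[OF \<rho>] linear_tens_right])+

lemma multilinear_ruth_words: "multilinear (ruth_words e x ds)"
proof (rule multilinearI)
  fix us ws :: "'v list"
  have "linear (\<lambda>v. word ((us @ v # ws)[i := \<rho> (x \<otimes> (us @ v # ws) ! i)]))" for i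
  proof -
    consider "i < length us" | "i = length us" | j where "i = length us + Suc j"
      by (metis add_Suc_right less_imp_Suc_add linorder_neqE_nat)
    then show ?thesis
    proof cases
      case 1
      then show ?thesis
        using multilinearD[OF multilinear_word, of "us[i := \<rho> (x \<otimes> us ! i)]" ws]
        by (simp add: list_update_append nth_append)
    next
      case 2
      then show ?thesis
        using linear_comp[OF multilinearD[OF multilinear_word, of us ws] linear_rho_right]
        by (simp add: nth_append)
    next
      case 3
      then show ?thesis
        using multilinearD[OF multilinear_word, of us "ws[j := \<rho> (x \<otimes> ws ! j)]"]
        by (simp add: list_update_append nth_append)
    qed
  qed
  then show "linear (\<lambda>v. ruth_words e x ds (us @ v # ws))"
    unfolding ruth_words_def length_append length_Cons
    by (intro linear_compose_sum ballI linear_compose_scale_right)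
qed

lemma linear_ruth_words: "linear (\<lambda>x. ruth_words e x ds vs)"
  unfolding ruth_words_def
  by (intro linear_compose_sum ballI linear_compose_scale_right
      linear_comp[OF multilinear_update[OF multilinear_word] linear_rho_left]) simp

lemma
  shows bilinear_talg_ruth: "bilinear (\<lambda>x t. talg_ruth \<rho> (x \<otimes> t))"
    and talg_ruth_word: "x \<in> gcomp e \<Longrightarrow> homogeneous ds vs \<Longrightarrow> talg_ruth \<rho> (x \<otimes> word vs) = ruth_words e x ds vs"
proof -
  let ?g = "\<lambda>e x. talg_lift (hext (ruth_words e x))"
  note m = multilinear_hext[OF multilinear_ruth_words]
  have word: "?g e x (word vs) = ruth_words e x ds vs" if "homogeneous ds vs" for e x ds vs
    by (simp add: talg_lift_word[OF m] hext_homogeneous[OF that multilinear_ruth_words])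
  have l: "linear (\<lambda>x. ?g e x t)" for e t
  proof (induction t rule: linear_talg_induct)
    case subspace
    show ?case
      by (rule subspaceI)
        (simp_all add: linear_0[OF linear_talg_lift[OF m]] linear_add[OF linear_talg_lift[OF m]]
          linear_scale[OF linear_talg_lift[OF m]] linear_zero linear_compose_add linear_compose_scale_right)
  next
    case (word ds vs)
    then show ?case by (simp add: \<open>\<And>x vs e ds. homogeneous ds vs \<Longrightarrow> _ = ruth_words e x ds vs\<close> linear_ruth_words)
  qed
  have eq: "talg_ruth \<rho> = tensor_lift (\<lambda>x t. \<Sum>e\<in>degs x. ?g e (hproj e x) t)"
    unfolding talg_ruth_def ruth_words_def ..
  have L: "linear (\<lambda>x. \<Sum>e\<in>degs x. ?g e (hproj e x) t)" for t
    by (rule linear_sum_degs[OF l])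
  have R: "linear (\<lambda>t. \<Sum>e\<in>degs x. ?g e (hproj e x) t)" for x
    by (intro linear_compose_sum ballI linear_talg_lift m)
  have tens: "talg_ruth \<rho> (x \<otimes> t) = (\<Sum>e\<in>degs x. ?g e (hproj e x) t)" for x t
    unfolding eq by (rule tensor_lift_tens[OF L R])
  show "bilinear (\<lambda>x t. talg_ruth \<rho> (x \<otimes> t))"
    unfolding tens by (intro bilinearI L R)
  show "talg_ruth \<rho> (x \<otimes> word vs) = ruth_words e x ds vs" if "x \<in> gcomp e" "homogeneous ds vs"
    unfolding tens using that linear_0[OF linear_ruth_words]
    by (auto simp: degs_homogeneous[OF that(1)] hproj_homogeneous[OF that(1)] word)
qed

lemma talg_ruth_Nil:
  assumes "x \<in> gcomp e" shows "talg_ruth \<rho> (x \<otimes> word []) = 0"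
  using talg_ruth_word[OF assms, of "[]" "[]"] by (simp add: ruth_words_def)

text \<open>The position on which \<open>x\<close> acts is either the first or a later one; in the
  second case an operator of degree \<open>e + 1\<close> moves past \<open>u\<close>. Together with
  \<open>talg_ruth_Nil\<close>, this rule replaces the sum over positions in the rest of the
  proof.\<close>

lemma talg_ruth_tcons:
  assumes x: "x \<in> gcomp e" and u: "u \<in> gcomp d"
  shows "talg_ruth \<rho> (x \<otimes> tcons u t) =
    tcons (\<rho> (x \<otimes> u)) t + msgn ((e + 1) * d) *\<^sub>R tcons u (talg_ruth \<rho> (x \<otimes> t))"
proof (rule talg_eqI[where F = "\<lambda>t. talg_ruth \<rho> (x \<otimes> tcons u t)"])
  fix ds and vs :: "'v list" assume h: "homogeneous ds vs"
  have "talg_ruth \<rho> (x \<otimes> word (u # vs)) = ruth_words e x (d # ds) (u # vs)"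
    using h u by (intro talg_ruth_word[OF x]) simp
  also have "\<dots> = word (\<rho> (x \<otimes> u) # vs) + msgn ((e + 1) * d) *\<^sub>R tcons u (ruth_words e x ds vs)"
    unfolding ruth_words_def length_Cons sum.lessThan_Suc_shift
    by (simp add: linear_sum[OF linear_tcons(1)] linear_scale[OF linear_tcons(1)] tcons_word
        scaleR_sum_right distrib_left msgn_add)
  finally show "talg_ruth \<rho> (x \<otimes> tcons u (word vs)) =
    tcons (\<rho> (x \<otimes> u)) (word vs) + msgn ((e + 1) * d) *\<^sub>R tcons u (talg_ruth \<rho> (x \<otimes> word vs))"
    by (simp add: tcons_word talg_ruth_word[OF x h])
qed (intro linear_compose_add linear_compose_scale_right linear_tcons linear_comp[OF linear_tcons(1)]
    linear_comp[OF bilinearD(1)[OF bilinear_talg_ruth]] bilinearD(1)[OF bilinear_talg_ruth])+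

lemma rho_gcomp: "x \<in> gcomp e \<Longrightarrow> v \<in> gcomp d \<Longrightarrow> \<rho> (x \<otimes> v) \<in> gcomp (e + d + 1)"
  using Hom_gcomp[OF \<rho> tens_gcomp] by blast

end

subsection \<open>Exterior powers\<close>

lemma wprod_swap:
  assumes "homogeneous ds us" "v \<in> gcomp d" "w \<in> gcomp e" "homogeneous es ws"
  shows "wprod (us @ v # w # ws) = (- msgn (d * e)) *\<^sub>R wprod (us @ w # v # ws)"
proof -
  let ?\<sigma> = "transpose (length us) (Suc (length us))"
  let ?ds = "ds @ d # e # es"
  have len: "length ds = length us" using assms by (auto dest: list_all2_lengthD)
  have "word (us @ v # w # ws) - (of_int (sign ?\<sigma>) * koszul ?\<sigma> ?ds) *\<^sub>R word (permute_list ?\<sigma> (us @ v # w # ws))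
      \<in> perm_rels (\<lambda>\<sigma> ds. of_int (sign \<sigma>) * koszul \<sigma> ds)"
    unfolding perm_rels_def
  proof (intro CollectI exI conjI)
    show "homogeneous ?ds (us @ v # w # ws)" using assms by (simp add: list_all2_appendI)
    show "?\<sigma> permutes {..<length (us @ v # w # ws)}" by (intro permutes_swap_id) auto
  qed (rule refl)
  moreover have "of_int (sign ?\<sigma>) * koszul ?\<sigma> ?ds = - msgn (d * e)"
    by (subst koszul_adjacent) (auto simp: len nth_append sign_swap_id simp flip: len)
  ultimately have "abs_wedge (word (us @ v # w # ws)) = abs_wedge ((- msgn (d * e)) *\<^sub>R word (us @ w # v # ws))"
    by (simp only: wedge.abs_eq_iff permute_list_adjacent span_base)
  then show ?thesis by (simp add: wprod_def wedge_proj_def scaleR_wedge.abs_eq)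
qed

text \<open>By the reduction to adjacent swaps, the relations of the exterior power lie in the
  kernel of \<open>T\<close>. The conclusion is a congruence rather than a lifted map because
  \<open>wedge_ruth\<close> works with representatives.\<close>

lemma wedge_factor:
  fixes T :: "'a::graded_vector talg \<Rightarrow> 'b::real_vector"
  assumes T: "linear T"
    and swap: "\<And>us v w ws d e ds es. homogeneous ds us \<Longrightarrow> v \<in> gcomp d \<Longrightarrow> w \<in> gcomp e \<Longrightarrow>
      homogeneous es ws \<Longrightarrow> T (word (us @ v # w # ws)) = (- msgn (d * e)) *\<^sub>R T (word (us @ w # v # ws))"
    and eq: "wedge_proj s = wedge_proj t"
  shows "T s = T t"
proof -
  have "T z = 0" if "z \<in> span (perm_rels (\<lambda>\<sigma> ds. of_int (sign \<sigma>) * koszul \<sigma> ds))" for z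
  proof (rule linear_vanish_span[OF T _ that])
    fix z :: "'a talg" assume "z \<in> perm_rels (\<lambda>\<sigma> ds. of_int (sign \<sigma>) * koszul \<sigma> ds)"
    then obtain vs ds \<sigma> where z: "z = word vs - (of_int (sign \<sigma>) * koszul \<sigma> ds) *\<^sub>R word (permute_list \<sigma> vs)"
      and h: "homogeneous ds vs" and p: "\<sigma> permutes {..<length vs}"
      unfolding perm_rels_def by blast
    have "T (word vs) = (of_int (sign \<sigma>) * koszul \<sigma> ds) *\<^sub>R T (word (permute_list \<sigma> vs))"
      by (rule antisymmetry_from_swaps[where \<phi> = "\<lambda>vs. T (word vs)", OF _ h p])
        (rule trans[OF swap], assumption+, simp)
    then show "T z = 0" by (simp add: z linear_diff[OF T] linear_scale[OF T])
  qed
  moreover have "s - t \<in> span (perm_rels (\<lambda>\<sigma> ds. of_int (sign \<sigma>) * koszul \<sigma> ds))"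
    using eq by (simp add: wedge_proj_def wedge.abs_eq_iff)
  ultimately show ?thesis using linear_diff[OF T, of s t] by fastforce
qed

lemma linear_wedge_proj_tcons: "linear (\<lambda>t. wedge_proj (tcons a t))"
  by (rule linear_comp[OF linear_wedge_proj linear_tcons(1)])

lemma wedge_proj_tcons_cong:
  fixes a :: "'a::graded_vector"
  assumes a: "a \<in> gcomp c" and "wedge_proj s = wedge_proj t"
  shows "wedge_proj (tcons a s) = wedge_proj (tcons a t)"
proof (rule wedge_factor[OF linear_wedge_proj_tcons _ assms(2)])
  fix us ws :: "'a list" and v w :: 'a and d e ds es assume "homogeneous ds us" "v \<in> gcomp d" "w \<in> gcomp e" "homogeneous es ws"
  then show "wedge_proj (tcons a (word (us @ v # w # ws))) = (- msgn (d * e)) *\<^sub>R wedge_proj (tcons a (word (us @ w # v # ws)))"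
    using wprod_swap[of "c # ds" "a # us" v d w e es ws] a by (simp add: tcons_word wprod_def)
qed

lemma wedge_proj_tcons_swap:
  fixes v w :: "'a::graded_vector"
  assumes "v \<in> gcomp d" "w \<in> gcomp e"
  shows "wedge_proj (tcons v (tcons w t)) = (- msgn (d * e)) *\<^sub>R wedge_proj (tcons w (tcons v t))"
proof (rule talg_eqI[where F = "\<lambda>t. wedge_proj (tcons v (tcons w t))"])
  fix ds and vs :: "'a list" assume "homogeneous ds vs"
  then show "wedge_proj (tcons v (tcons w (word vs))) = (- msgn (d * e)) *\<^sub>R wedge_proj (tcons w (tcons v (word vs)))"
    using wprod_swap[of "[]" "[]" v d w e ds vs] assms by (simp add: tcons_word wprod_def)
qed (intro linear_compose_scale_right linear_comp[OF linear_wedge_proj_tcons linear_tcons(1)])+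

lemma wedge_proj_hproj: "wedge_proj (hproj n t) = hproj n (wedge_proj t)"
  by (simp add: wedge_proj_def hproj_wedge.abs_eq)

lemma Hom_wedge_proj: "wedge_proj \<in> Hom 0"
  by (rule HomI[OF linear_wedge_proj]) (simp add: gcomp_def flip: wedge_proj_hproj)

text \<open>Once \<open>us\<close> is peeled off, the action hits \<open>v\<close>, \<open>w\<close>
  or the tail. If it hits \<open>v\<close>, the degree becomes \<open>e + dv + 1\<close>, and the
  exchange with \<open>w\<close> contributes an additional sign \<open>msgn ((e + 1) * dw)\<close>;
  this is the sign with which the action passes \<open>w\<close> on the other side. The case of
  \<open>w\<close> is symmetric, and on the tail both orders carry the same sign.\<close>

lemma wedge_proj_talg_ruth_swap:
  assumes \<rho>: "\<rho> \<in> Hom 1" and x: "x \<in> gcomp e" and "homogeneous ds us"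
    and v: "v \<in> gcomp dv" and w: "w \<in> gcomp dw" and ws: "homogeneous es ws"
  shows "wedge_proj (talg_ruth \<rho> (x \<otimes> word (us @ v # w # ws))) =
    (- msgn (dv * dw)) *\<^sub>R wedge_proj (talg_ruth \<rho> (x \<otimes> word (us @ w # v # ws)))"
  using assms(3)
proof (induction rule: list_all2_induct)
  case Nil
  note [simp] = linear_add[OF linear_wedge_proj] linear_scale[OF linear_wedge_proj]
    linear_add[OF linear_tcons(1)] linear_scale[OF linear_tcons(1)]
  have ruth: "talg_ruth \<rho> (x \<otimes> word (a # b # ws)) = tcons (\<rho> (x \<otimes> a)) (tcons b (word ws)) +
      msgn ((e + 1) * da) *\<^sub>R (tcons a (tcons (\<rho> (x \<otimes> b)) (word ws)) +
        msgn ((e + 1) * db) *\<^sub>R tcons a (tcons b (talg_ruth \<rho> (x \<otimes> word ws))))"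
    if "a \<in> gcomp da" "b \<in> gcomp db" for a b da db
    using talg_ruth_tcons[OF \<rho> x that(1), of "word (b # ws)"] talg_ruth_tcons[OF \<rho> x that(2), of "word ws"]
    by (simp add: tcons_word)
  show ?case
    unfolding append_Nil ruth[OF v w] ruth[OF w v]
    using wedge_proj_tcons_swap[OF rho_gcomp[OF \<rho> x v] w, of "word ws"]
      wedge_proj_tcons_swap[OF v rho_gcomp[OF \<rho> x w], of "word ws"]
      wedge_proj_tcons_swap[OF v w, of "talg_ruth \<rho> (x \<otimes> word ws)"]
    by (simp add: algebra_simps msgn_add)
next
  case (Cons d ds u us)
  note a = \<open>u \<in> gcomp d\<close>
  have IH: "wedge_proj (tcons u (talg_ruth \<rho> (x \<otimes> word (us @ v # w # ws)))) =
    (- msgn (dv * dw)) *\<^sub>R wedge_proj (tcons u (talg_ruth \<rho> (x \<otimes> word (us @ w # v # ws))))"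
    using wedge_proj_tcons_cong[OF a, of "talg_ruth \<rho> (x \<otimes> word (us @ v # w # ws))"
        "(- msgn (dv * dw)) *\<^sub>R talg_ruth \<rho> (x \<otimes> word (us @ w # v # ws))"] Cons.IH
    by (simp add: linear_scale[OF linear_wedge_proj] linear_scale[OF linear_wedge_proj_tcons]
      linear_neg[OF linear_wedge_proj] linear_neg[OF linear_wedge_proj_tcons])
  have tc: "wedge_proj (tcons (\<rho> (x \<otimes> u)) (word (us @ v # w # ws))) =
    (- msgn (dv * dw)) *\<^sub>R wedge_proj (tcons (\<rho> (x \<otimes> u)) (word (us @ w # v # ws)))"
    using wprod_swap[of "(e + d + 1) # ds" "\<rho> (x \<otimes> u) # us" v dv w dw es ws] rho_gcomp[OF \<rho> x a] Cons.hyps v w ws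
    by (simp add: tcons_word wprod_def)
  show ?case
    using talg_ruth_tcons[OF \<rho> x a, of "word (us @ v # w # ws)"] talg_ruth_tcons[OF \<rho> x a, of "word (us @ w # v # ws)"]
    by (simp add: tcons_word[symmetric] linear_add[OF linear_wedge_proj] linear_scale[OF linear_wedge_proj] IH tc algebra_simps)
qed

text \<open>Independence of the representative chosen by \<open>rep_wedge\<close>. The swap argument
  needs a homogeneous \<open>x\<close>; linearity in \<open>x\<close> extends it to the whole
  symmetric algebra.\<close>

lemma wedge_ruth_wedge_proj:
  fixes \<rho> :: "'a::graded_vector sym \<otimes> 'v::graded_vector \<Rightarrow> 'v"
  assumes \<rho>: "\<rho> \<in> Hom 1"
  shows "wedge_ruth \<rho> (x \<otimes> wedge_proj t) = wedge_proj (talg_ruth \<rho> (x \<otimes> t))"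
proof -
  note lin = linear_comp[OF linear_wedge_proj bilinearD(1)[OF bilinear_talg_ruth[OF \<rho>]]]
    linear_comp[OF linear_wedge_proj bilinearD(2)[OF bilinear_talg_ruth[OF \<rho>]]]
  have hom: "wedge_proj (talg_ruth \<rho> (x \<otimes> s)) = wedge_proj (talg_ruth \<rho> (x \<otimes> t))"
    if "wedge_proj s = wedge_proj t" "x \<in> gcomp e" for x e and s t :: "'v talg"
    by (rule wedge_factor[OF lin(1) _ that(1)]) (rule wedge_proj_talg_ruth_swap[OF \<rho> that(2)])
  have cong: "wedge_proj (talg_ruth \<rho> (x \<otimes> s)) = wedge_proj (talg_ruth \<rho> (x \<otimes> t))"
    if "wedge_proj s = wedge_proj t" for x and s t :: "'v talg"
    by (rule sym_eqI[OF lin(2) lin(2)]) (rule hom[OF that sprod_gcomp])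
  have rep: "wedge_proj (talg_ruth \<rho> (x \<otimes> rep_wedge (wedge_proj s))) = wedge_proj (talg_ruth \<rho> (x \<otimes> s))"
    for x and s :: "'v talg"
    by (rule cong) (rule wedge_proj_rep)
  have "linear (\<lambda>w. wedge_proj (talg_ruth \<rho> (x \<otimes> rep_wedge w)))" for x
  proof (rule linearI)
    fix w w' :: "'v wedge" and c :: real
    have "w + w' = wedge_proj (rep_wedge w + rep_wedge w')" "c *\<^sub>R w = wedge_proj (c *\<^sub>R rep_wedge w)"
      by (simp_all add: linear_add[OF linear_wedge_proj] linear_scale[OF linear_wedge_proj] wedge_proj_rep)
    then show "wedge_proj (talg_ruth \<rho> (x \<otimes> rep_wedge (w + w'))) =
        wedge_proj (talg_ruth \<rho> (x \<otimes> rep_wedge w)) + wedge_proj (talg_ruth \<rho> (x \<otimes> rep_wedge w'))"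
      "wedge_proj (talg_ruth \<rho> (x \<otimes> rep_wedge (c *\<^sub>R w))) = c *\<^sub>R wedge_proj (talg_ruth \<rho> (x \<otimes> rep_wedge w))"
      by (simp_all add: rep linear_add[OF lin(1)] linear_scale[OF lin(1)])
  qed
  then show ?thesis
    unfolding wedge_ruth_def by (subst tensor_lift_tens) (auto simp: rep lin)
qed

subsection \<open>Powers of a cochain\<close>

text \<open>The parameter \<open>int m\<close> is the degree of the \<open>m\<close> remaining
  factors for \<open>K\<close> of degree 1. The counit provides a zeroth power, which lets
  inductions begin at 0 although the powers of interest have \<open>k \<ge> 1\<close>.\<close>

primrec cochain_power :: "('a::graded_vector sym \<Rightarrow> 'n::graded_vector) \<Rightarrow> nat \<Rightarrow> 'a sym \<Rightarrow> 'n talg" where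
  "cochain_power K 0 = (\<lambda>x. counit x *\<^sub>R word [])"
| "cochain_power K (Suc m) = conv (int m) tcons K (cochain_power K m)"

lemma linear_cochain_power: "linear K \<Longrightarrow> linear (cochain_power K m)"
  by (induction m) (simp_all add: linear_counit_scale linear_conv bilinear_tcons)

section \<open>Comparison of the recursive powers with the iterated coproduct\<close>

abbreviation homogeneous_words :: "nat \<Rightarrow> 'a::graded_vector talg set" where
  "homogeneous_words n \<equiv> {word vs | ds vs. homogeneous ds vs \<and> length vs = n}"

lemma multilinear_tpow:
  assumes "linear K"
  shows "multilinear (\<lambda>vs. msgn (\<Sum>j<length vs. \<Sum>i<j. q * ds ! i) *\<^sub>R word (map K vs))"
proof (rule multilinearI)
  show "linear (\<lambda>v. msgn (\<Sum>j<length (us @ v # ws). \<Sum>i<j. q * ds ! i) *\<^sub>R word (map K (us @ v # ws)))" for us ws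
    using linear_comp[OF multilinearD[OF multilinear_word] assms, of "map K us" "map K ws"]
    by (simp add: linear_compose_scale_right)
qed

lemma linear_tpow_map: "linear K \<Longrightarrow> linear (tpow_map q K)"
  unfolding tpow_map_def by (intro linear_talg_lift multilinear_hext multilinear_tpow)

lemma tpow_map_word:
  assumes "linear K" "homogeneous ds vs"
  shows "tpow_map q K (word vs) = msgn (\<Sum>j<length vs. \<Sum>i<j. q * ds ! i) *\<^sub>R word (map K vs)"
  unfolding tpow_map_def
  by (simp add: talg_lift_word multilinear_hext multilinear_tpow assms hext_homogeneous[OF assms(2)])

text \<open>The sign comes from moving \<open>n\<close> further copies of \<open>K\<close>, each of
  degree 1, past \<open>x\<close>. It depends on the number of factors, whence the restriction to
  the span of words of one length.\<close>

lemma tpow_map_tcons: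
  fixes K :: "'a::graded_vector \<Rightarrow> 'b::graded_vector"
  assumes K: "linear K" and x: "x \<in> gcomp d" and t: "t \<in> span (homogeneous_words n)"
  shows "tpow_map 1 K (tcons x t) = msgn (int n * d) *\<^sub>R tcons (K x) (tpow_map 1 K t)"
proof (rule linear_eq_on[OF _ _ t, where f = "\<lambda>t. tpow_map 1 K (tcons x t)"])
  show "linear (\<lambda>t. tpow_map 1 K (tcons x t))" "linear (\<lambda>t. msgn (int n * d) *\<^sub>R tcons (K x) (tpow_map 1 K t))"
    by (intro linear_compose_scale_right linear_comp[OF linear_tpow_map] linear_comp[OF linear_tcons(1)]
        linear_tpow_map linear_tcons(1) K)+
  fix t :: "'a talg" assume "t \<in> homogeneous_words n"
  then obtain ds vs where t: "t = word vs" and h: "homogeneous ds vs" and n: "length vs = n" by blast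
  have "homogeneous (d # ds) (x # vs)" using x h by simp
  from tpow_map_word[OF K this, of 1]
  show "tpow_map 1 K (tcons x t) = msgn (int n * d) *\<^sub>R tcons (K x) (tpow_map 1 K t)"
    unfolding t tcons_word tpow_map_word[OF K h]
    by (simp add: n linear_scale[OF linear_tcons(1)] tcons_word sum.lessThan_Suc_shift sum.distrib msgn_add
        del: sum.lessThan_Suc)
qed

lemma subspace_preimage: "linear f \<Longrightarrow> subspace S \<Longrightarrow> subspace {x. f x \<in> S}"
  using linear_subspace_vimage[of f S] by (simp add: vimage_def)

lemma linear_talg_cons: "linear (talg_cons :: 'a::graded_vector \<otimes> _ \<Rightarrow> _)"
  by (simp add: talg_cons_eq linear_tensor_lift_bilinear bilinear_tcons)

lemma linear_coprod_iter: "linear (coprod_iter m)"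
proof (induction m)
  case 0
  show ?case using multilinear_Nil[OF multilinear_word, of "[]"] by simp
next
  case (Suc m)
  show ?case
    using linear_comp[OF linear_talg_cons linear_comp[OF linear_tmap[OF linear_id Suc.IH] linear_coprod]] by simp
qed

lemma tcons_homogeneous_words:
  fixes x :: "'a::graded_vector"
  assumes x: "x \<in> gcomp d" and t: "t \<in> span (homogeneous_words n)"
  shows "tcons x t \<in> span (homogeneous_words (Suc n))"
proof (rule span_induct[OF t, where P = "\<lambda>t. tcons x t \<in> span (homogeneous_words (Suc n))"])
  show "subspace {t. tcons x t \<in> span (homogeneous_words (Suc n))}"
    by (rule subspace_preimage[OF linear_tcons(1) subspace_span])
  fix t :: "'a talg" assume "t \<in> homogeneous_words n"
  then obtain ds vs where t: "t = word vs" and h: "homogeneous ds vs" and n: "length vs = n" by blast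
  have "homogeneous (d # ds) (x # vs)" "length (x # vs) = Suc n" using x h n by auto
  then show "tcons x t \<in> span (homogeneous_words (Suc n))"
    unfolding t tcons_word by (intro span_base) blast
qed

lemma Nil_homogeneous_words: "word [] \<in> span (homogeneous_words 0)"
  by (intro span_base) (auto intro!: exI[of _ "[]"])

lemma coprod_iter_span:
  fixes x :: "'a::graded_vector sym"
  shows "coprod_iter m x \<in> span (homogeneous_words (Suc m))"
proof (induction m arbitrary: x)
  case 0
  show ?case
  proof (induction x rule: sym_induct_homogeneous)
    case subspace
    show ?case by (rule subspace_preimage[OF linear_coprod_iter subspace_span])
  next
    case (sprod ds vs)
    show ?case
      using tcons_homogeneous_words[OF sprod_gcomp[OF sprod] Nil_homogeneous_words] by (simp add: tcons_word)
  qed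
next
  case (Suc m)
  have "talg_cons (tmap 0 id (coprod_iter m) t) \<in> span (homogeneous_words (Suc (Suc m)))" for t :: "'a sym \<otimes> 'a sym"
  proof (induction t rule: tensor_induct_homogeneous)
    case subspace
    show ?case
      by (rule subspace_preimage[OF linear_comp[OF linear_talg_cons linear_tmap[OF linear_id linear_coprod_iter]] subspace_span])
  next
    case (tens x y d e)
    show ?case
      unfolding tmap_homogeneous[OF linear_id linear_coprod_iter tens(1)]
      using tcons_homogeneous_words[OF tens(1) Suc.IH[of y]] by (simp add: tcons_def)
  qed
  then show ?case by simp
qed

lemma tpow_map_coprod_iter:
  fixes K :: "'a::graded_vector sym \<Rightarrow> 'b::graded_vector"
  assumes K: "linear K"
  shows "tpow_map 1 K (coprod_iter m x) = cochain_power K (Suc m) x"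
proof (induction m arbitrary: x)
  case 0
  show ?case
  proof (rule sym_eqI[OF linear_comp[OF linear_tpow_map[OF K] linear_coprod_iter] linear_cochain_power[OF K]])
    fix ds vs assume "homogeneous ds (vs :: 'a list)"
    then show "tpow_map 1 K (coprod_iter 0 (sprod vs)) = cochain_power K (Suc 0) (sprod vs)"
      using tpow_map_tcons[OF K sprod_gcomp Nil_homogeneous_words, of ds vs] tpow_map_word[OF K, of "[]" "[]" 1]
      by (simp add: conv_counit_right bilinear_tcons K tcons_word)
  qed
next
  case (Suc m)
  have "tpow_map 1 K (talg_cons (tmap 0 id (coprod_iter m) t)) =
    tensor_lift tcons (tmap (int (Suc m)) K (cochain_power K (Suc m)) t)" for t
  proof (rule tensor_eqI[where F = "\<lambda>t. tpow_map 1 K (talg_cons (tmap 0 id (coprod_iter m) t))"])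
    show "linear (\<lambda>t. tpow_map 1 K (talg_cons (tmap 0 id (coprod_iter m) t)))"
      by (intro linear_comp[OF linear_tpow_map[OF K]] linear_comp[OF linear_talg_cons] linear_tmap linear_id linear_coprod_iter)
    show "linear (\<lambda>t. tensor_lift tcons (tmap (int (Suc m)) K (cochain_power K (Suc m)) t))"
      by (intro linear_comp[OF linear_tensor_lift_bilinear] linear_tmap bilinear_tcons K linear_cochain_power)
    fix x y :: "'a sym" and d e assume x: "x \<in> gcomp d"
    show "tpow_map 1 K (talg_cons (tmap 0 id (coprod_iter m) (x \<otimes> y))) =
      tensor_lift tcons (tmap (int (Suc m)) K (cochain_power K (Suc m)) (x \<otimes> y))"
      unfolding tensor_lift_tmap_homogeneous[OF bilinear_tcons K linear_cochain_power[OF K] x]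
        tmap_homogeneous[OF linear_id linear_coprod_iter x]
      using tpow_map_tcons[OF K x coprod_iter_span, of m y]
      by (simp add: tcons_def Suc.IH del: cochain_power.simps)
  qed
  then show ?case by (simp add: conv_def)
qed

lemma curv_power_eq: "linear K \<Longrightarrow> k \<ge> 1 \<Longrightarrow> curv_power K k x = cochain_power K k x"
  using tpow_map_coprod_iter[of K "k - 1" x] by (simp add: curv_power_def)

lemma Hom_cochain_power:
  fixes K :: "'a::graded_vector sym \<Rightarrow> 'n::graded_vector"
  assumes K: "K \<in> Hom 1" shows "cochain_power K m \<in> Hom (int m)"
proof (induction m)
  case 0
  have "(\<lambda>x :: 'a sym. counit x *\<^sub>R (word [] :: 'n talg)) \<in> Hom 0"
    by (rule Hom_symI[OF linear_counit_scale]) (use word_gcomp[of "[]" "[]"] in \<open>auto simp: counit_sprod\<close>)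
  then show ?case by simp
next
  case (Suc m)
  then show ?case
    using Hom_conv[OF bilinear_tcons _ K Suc.IH, of 0] by (simp add: tcons_gcomp)
qed

subsection \<open>The covariant differential\<close>

text \<open>An operator of degree \<open>s + 1\<close> passes a first factor of degree
  \<open>a\<close>, which explains the sign. On the unit the claim is
  \<open>talg_ruth_tcons\<close>. Contraction with a letter replaces \<open>S\<close>,
  \<open>\<alpha>\<close> or \<open>\<beta>\<close> by its contraction on both sides, and this
  recursion also accounts for the exchange of the arguments of \<open>S\<close> and
  \<open>\<alpha>\<close> in the last term. The degree \<open>s\<close> is general because
  contraction changes it; the rule is applied with \<open>s = 0\<close>.\<close>

lemma conv_talg_ruth_tcons:
  fixes \<rho> :: "'b::graded_vector sym \<otimes> 'n::graded_vector \<Rightarrow> 'n" and S :: "'a::graded_vector sym \<Rightarrow> 'b sym"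
  assumes \<rho>: "\<rho> \<in> Hom 1" and S: "S \<in> Hom s" and \<alpha>: "\<alpha> \<in> Hom a" and \<beta>: "linear \<beta>"
  defines "R \<equiv> \<lambda>x t. talg_ruth \<rho> (x \<otimes> t)" and "A \<equiv> \<lambda>x u. \<rho> (x \<otimes> u)"
  shows "conv (a + b) R S (conv b tcons \<alpha> \<beta>) x =
    conv b tcons (conv a A S \<alpha>) \<beta> x + msgn (a * (s + 1)) *\<^sub>R conv (b + s + 1) tcons \<alpha> (conv b R S \<beta>) x"
proof -
  have R: "bilinear R" unfolding R_def by (rule bilinear_talg_ruth[OF \<rho>])
  have A: "bilinear A" unfolding A_def by (intro bilinearI linear_rho_left[OF \<rho>] linear_rho_right[OF \<rho>])
  note T = bilinear_tcons
  show ?thesis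
  proof (rule sym_eqI[where F = "conv (a + b) R S (conv b tcons \<alpha> \<beta>)"])
    fix ds and vs :: "'a list" assume "homogeneous ds vs"
    then show "conv (a + b) R S (conv b tcons \<alpha> \<beta>) (sprod vs) =
      conv b tcons (conv a A S \<alpha>) \<beta> (sprod vs) + msgn (a * (s + 1)) *\<^sub>R conv (b + s + 1) tcons \<alpha> (conv b R S \<beta>) (sprod vs)"
      using S \<alpha> \<beta>
    proof (induction arbitrary: S s \<alpha> a \<beta> b rule: list_all2_induct)
      case Nil
      have "S sym_unit \<in> gcomp s" "\<alpha> sym_unit \<in> gcomp a"
        using Hom_gcomp[OF Nil(1) sym_unit_gcomp] Hom_gcomp[OF Nil(2) sym_unit_gcomp] by simp_all
      from talg_ruth_tcons[OF \<rho> this, of "\<beta> sym_unit"] show ?case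
        using Nil
        by (simp add: conv_unit R A T Hom_linear linear_conv mult.commute flip: sym_unit_def)
          (simp add: R_def A_def)
    next
      case (Cons d ds v vs)
      note v = Cons.hyps(1)
      have lin: "linear S" "linear \<alpha>" "linear \<beta>" using Cons.prems by (auto intro: Hom_linear)
      note lin' = lin[THEN linear_comp[OF _ linear_smul, of _ v]]
      have IH: "conv (a + (b + d)) R S (conv b tcons (\<lambda>x. \<alpha> (smul v x)) \<beta>) (sprod vs) =
          conv b tcons (conv (a + d) A S (\<lambda>x. \<alpha> (smul v x))) \<beta> (sprod vs) +
          msgn ((a + d) * (s + 1)) *\<^sub>R conv (b + s + 1) tcons (\<lambda>x. \<alpha> (smul v x)) (conv b R S \<beta>) (sprod vs)"
        using Cons.IH[OF Cons.prems(1) Hom_compose_smul[OF Cons.prems(2) v] Cons.prems(3), of b] by (simp add: ac_simps)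
      show ?case
        unfolding smul_sprod[symmetric]
        by (simp add: conv_smul[OF _ _ _ v] conv_add_left conv_add_right conv_scale_left conv_scale_right
          linear_conv linear_compose_add linear_compose_scale_right R A T lin lin'
          Cons.IH[OF Cons.prems] Cons.IH[OF Hom_compose_smul[OF Cons.prems(1) v] Cons.prems(2,3)]
          IH
          Cons.IH[OF Cons.prems(1,2) lin'(3)] algebra_simps msgn_add)
    qed
  qed (intro linear_compose_add linear_compose_scale_right linear_conv R A T Hom_linear[OF S] Hom_linear[OF \<alpha>] \<beta>)+
qed

context
  fixes \<rho> :: "'b::graded_vector sym \<otimes> 'n::graded_vector \<Rightarrow> 'n" and S :: "'a::graded_vector sym \<Rightarrow> 'b sym"
    and lam :: "'a sym \<Rightarrow> 'a"
  assumes \<rho>: "\<rho> \<in> Hom 1" and S: "S \<in> Hom 0" and lam: "lam \<in> Hom 1"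
begin

definition nabla :: "int \<Rightarrow> ('a sym \<Rightarrow> 'n talg) \<Rightarrow> 'a sym \<Rightarrow> 'n talg" where
  "nabla q \<beta> x = conv q (\<lambda>x t. talg_ruth \<rho> (x \<otimes> t)) S \<beta> x - msgn q *\<^sub>R \<beta> (coder lam x)"

definition nabla1 :: "int \<Rightarrow> ('a sym \<Rightarrow> 'n) \<Rightarrow> 'a sym \<Rightarrow> 'n" where
  "nabla1 q \<alpha> x = conv q (\<lambda>x u. \<rho> (x \<otimes> u)) S \<alpha> x - msgn q *\<^sub>R \<alpha> (coder lam x)"

lemma linear_nabla1: "linear \<alpha> \<Longrightarrow> linear (nabla1 q \<alpha>)"
  unfolding nabla1_def[abs_def]
  by (intro linear_compose_sub linear_compose_scale_right linear_conv bilinearI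
      linear_rho_left[OF \<rho>] linear_rho_right[OF \<rho>] Hom_linear[OF S]
      linear_comp[OF _ linear_coder[OF Hom_linear[OF lam]]])

text \<open>Both halves of \<open>nabla\<close> are graded derivations of degree 1: the action by
  \<open>conv_talg_ruth_tcons\<close>, the precomposition with \<open>coder lam\<close> by
  \<open>conv_coder\<close>. Neither relates \<open>S\<close> to \<open>coder lam\<close>, so the
  rule is available for an \<open>S\<close> that is no chain map.\<close>

lemma nabla_tcons:
  assumes \<alpha>: "\<alpha> \<in> Hom a" and \<beta>: "linear \<beta>"
  shows "nabla (a + b) (conv b tcons \<alpha> \<beta>) x =
    conv b tcons (nabla1 a \<alpha>) \<beta> x + msgn a *\<^sub>R conv (b + 1) tcons \<alpha> (nabla b \<beta>) x"
proof -
  note T = bilinear_tcons and R = bilinear_talg_ruth[OF \<rho>]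
  have A: "bilinear (\<lambda>x u. \<rho> (x \<otimes> u))"
    by (intro bilinearI linear_rho_left[OF \<rho>] linear_rho_right[OF \<rho>])
  have cl: "linear (coder lam)" by (rule linear_coder[OF Hom_linear[OF lam]])
  note lin = Hom_linear[OF \<alpha>] \<beta> Hom_linear[OF S]
  note lin' = linear_comp[OF lin(1) cl] linear_comp[OF lin(2) cl]
  \<comment> \<open>Subtraction becomes a sum with a negative multiple, the form to which the
    additivity and scaling rules of \<open>conv\<close> apply.\<close>
  have neg: "f - c *\<^sub>R g = f + (- c) *\<^sub>R g" for f g :: "'c::real_vector" and c
    by simp
  show ?thesis
    unfolding nabla_def nabla1_def conv_talg_ruth_tcons[OF \<rho> S \<alpha> \<beta>] conv_coder[OF T lam lin(1,2)] neg
    by (simp add: conv_add_left conv_add_right conv_scale_left conv_scale_right linear_conv linear_compose_scale_right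
        T R A lin lin' algebra_simps msgn_add del: scaleR_minus_left)
qed

text \<open>The zeroth power is closed because the counit vanishes on the image of
  \<open>coder lam\<close> and the induced ruth kills the empty word; the Leibniz rule adds one
  factor at a time.\<close>

lemma nabla_cochain_power:
  assumes K: "K \<in> Hom 1" and flat: "\<And>x. nabla1 1 K x = 0"
  shows "nabla (int m) (cochain_power K m) x = 0"
proof (induction m arbitrary: x)
  case 0
  have counit: "counit (coder lam x) = 0" for x
  proof -
    have "counit (tensor_lift smul (tmap 0 lam (\<lambda>x. x) t)) = 0" for t
      by (rule tensor_eqI[where F = "\<lambda>t. counit (tensor_lift smul (tmap 0 lam (\<lambda>x. x) t))" and G = "\<lambda>t. 0"])
        (auto intro!: linear_comp[OF linear_counit] linear_comp[OF linear_tensor_lift_bilinear] bilinear_smul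
          linear_tmap linear_ident Hom_linear[OF lam] linear_zero
          simp: tensor_lift_tmap_homogeneous bilinear_smul Hom_linear[OF lam] linear_ident counit_smul
            linear_scale[OF linear_counit])
    then show ?thesis by (simp add: coder_conv[OF Hom_linear[OF lam]] conv_def)
  qed
  have "talg_ruth \<rho> (S x \<otimes> word []) = 0"
    by (rule sym_eqI[where F = "\<lambda>x. talg_ruth \<rho> (S x \<otimes> word [])"])
      (auto intro!: linear_comp[OF bilinearD(2)[OF bilinear_talg_ruth[OF \<rho>]]] Hom_linear[OF S] linear_zero
        talg_ruth_Nil[OF \<rho>] Hom_gcomp[OF S] sprod_gcomp)
  then show ?case
    by (simp add: nabla_def counit conv_counit_right bilinear_talg_ruth[OF \<rho>] Hom_linear[OF S])
next
  case (Suc m)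
  have "nabla (1 + int m) (conv (int m) tcons K (cochain_power K m)) x = 0"
    unfolding nabla_tcons[OF K linear_cochain_power[OF Hom_linear[OF K]]] ext[OF flat] ext[OF Suc.IH]
    by (simp add: conv_zero_left conv_zero_right bilinear_tcons linear_cochain_power Hom_linear[OF K])
  then show ?case by simp
qed

end

section \<open>Variation of the powers and its primitive\<close>

primrec cochain_power_deriv :: "('a::graded_vector sym \<Rightarrow> 'n::graded_vector) \<Rightarrow> ('a sym \<Rightarrow> 'n) \<Rightarrow> nat \<Rightarrow> 'a sym \<Rightarrow> 'n talg" where
  "cochain_power_deriv K K' 0 = (\<lambda>x. 0)"
| "cochain_power_deriv K K' (Suc m) =
    (\<lambda>x. conv (int m) tcons K' (cochain_power K m) x + conv (int m) tcons K (cochain_power_deriv K K' m) x)"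

text \<open>The alternating sum of the products with one factor \<open>b\<close> and all other
  factors \<open>K\<close>, with sign \<open>(-1)^i\<close> if \<open>i\<close> copies of
  \<open>K\<close> precede \<open>b\<close>. A factor \<open>b\<close> of degree 0 in place of
  \<open>K\<close> lowers the degree by one, hence the parameter \<open>int m - 1\<close>.\<close>

primrec cochain_power_primitive :: "('a::graded_vector sym \<Rightarrow> 'n::graded_vector) \<Rightarrow> ('a sym \<Rightarrow> 'n) \<Rightarrow> nat \<Rightarrow> 'a sym \<Rightarrow> 'n talg" where
  "cochain_power_primitive K b 0 = (\<lambda>x. 0)"
| "cochain_power_primitive K b (Suc m) =
    (\<lambda>x. conv (int m) tcons b (cochain_power K m) x - conv (int m - 1) tcons K (cochain_power_primitive K b m) x)"

lemma Hom_diff: "f \<in> Hom p \<Longrightarrow> g \<in> Hom p \<Longrightarrow> (\<lambda>x. f x - g x) \<in> Hom p"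
  by (rule HomI) (auto intro: linear_compose_sub Hom_linear simp: Hom_gcomp)

lemma Hom_cochain_power_primitive:
  assumes K: "K \<in> Hom 1" and b: "b \<in> Hom 0"
  shows "cochain_power_primitive K b m \<in> Hom (int m - 1)"
proof (induction m)
  case 0
  show ?case by (auto intro!: HomI linear_zero)
next
  case (Suc m)
  have "conv (int m) tcons b (cochain_power K m) \<in> Hom (int m)"
    "conv (int m - 1) tcons K (cochain_power_primitive K b m) \<in> Hom (int m)"
    using Hom_conv[OF bilinear_tcons _ b Hom_cochain_power[OF K], of 0]
      Hom_conv[OF bilinear_tcons _ K Suc.IH, of 0] by (simp_all add: tcons_gcomp)
  then show ?case by (simp add: Hom_diff)
qed

text \<open>For flat \<open>K\<close>, the Leibniz rule passes \<open>K\<close> with the sign -1,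
  which the minus sign in \<open>cochain_power_primitive\<close> cancels. What remains is the
  covariant differential of \<open>b\<close> inserted at each position without alternating
  signs.\<close>

lemma nabla_cochain_power_primitive:
  assumes \<rho>: "\<rho> \<in> Hom 1" and S: "S \<in> Hom 0" and lam: "lam \<in> Hom 1"
    and K: "K \<in> Hom 1" and flat: "\<And>x. nabla1 \<rho> S lam 1 K x = 0" and b: "b \<in> Hom 0"
  shows "nabla \<rho> S lam (int m - 1) (cochain_power_primitive K b m) x =
    cochain_power_deriv K (nabla1 \<rho> S lam 0 b) m x"
proof (induction m arbitrary: x)
  case 0
  show ?case
    by (simp add: nabla_def[OF \<rho> S lam] conv_zero_right bilinear_talg_ruth[OF \<rho>] Hom_linear[OF S])
next
  case (Suc m)
  note lK = Hom_linear[OF K] and lP = linear_cochain_power[OF Hom_linear[OF K]]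
    and lH = Hom_linear[OF Hom_cochain_power_primitive[OF K b]]
  have sub: "nabla \<rho> S lam q (\<lambda>x. f x - g x) x = nabla \<rho> S lam q f x - nabla \<rho> S lam q g x"
    if "linear f" "linear g" for q f g x
    using conv_add_right[OF bilinear_talg_ruth[OF \<rho>] Hom_linear[OF S] that(1) linear_compose_scale_right[OF that(2), of "-1"], of q x]
      conv_scale_right[OF bilinear_talg_ruth[OF \<rho>] Hom_linear[OF S] that(2), of q "-1" x]
    by (simp add: nabla_def[OF \<rho> S lam] algebra_simps)
  have "nabla \<rho> S lam (0 + int m) (conv (int m) tcons b (cochain_power K m)) x =
      conv (int m) tcons (nabla1 \<rho> S lam 0 b) (cochain_power K m) x"
    unfolding nabla_tcons[OF \<rho> S lam b lP] ext[OF nabla_cochain_power[OF \<rho> S lam K flat]]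
    by (simp add: conv_zero_right bilinear_tcons Hom_linear[OF b])
  moreover have "nabla \<rho> S lam (1 + (int m - 1)) (conv (int m - 1) tcons K (cochain_power_primitive K b m)) x =
      - conv (int m) tcons K (cochain_power_deriv K (nabla1 \<rho> S lam 0 b) m) x"
    unfolding nabla_tcons[OF \<rho> S lam K lH] ext[OF Suc.IH] ext[OF flat]
    by (simp add: conv_zero_left bilinear_tcons lH)
  ultimately show ?case
    by (simp add: sub linear_conv bilinear_tcons lK lP lH Hom_linear[OF b])
qed

subsection \<open>Polynomial curves in a real vector space\<close>

text \<open>
  Differentiation and integration in the parameter are formal, as the vector spaces carry no topology.
\<close>

inductive has_poly_deriv :: "(real \<Rightarrow> 'b::real_vector) \<Rightarrow> (real \<Rightarrow> 'b) \<Rightarrow> bool" where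
  monom: "has_poly_deriv (\<lambda>t. t ^ n *\<^sub>R v) (\<lambda>t. (real n * t ^ (n - Suc 0)) *\<^sub>R v)"
| add: "has_poly_deriv P P' \<Longrightarrow> has_poly_deriv Q Q' \<Longrightarrow> has_poly_deriv (\<lambda>t. P t + Q t) (\<lambda>t. P' t + Q' t)"

lemma has_poly_deriv_const: "has_poly_deriv (\<lambda>t. v) (\<lambda>t. 0)"
  using has_poly_deriv.monom[of 0 v] by simp

lemma has_poly_deriv_ident: "has_poly_deriv (\<lambda>t. t *\<^sub>R v) (\<lambda>t. v)"
  using has_poly_deriv.monom[of 1 v] by simp

lemma has_poly_deriv_linear:
  assumes "has_poly_deriv P P'" and L: "linear L"
  shows "has_poly_deriv (\<lambda>t. L (P t)) (\<lambda>t. L (P' t))"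
  using assms(1)
  by induction (simp_all add: linear_scale[OF L] linear_add[OF L] has_poly_deriv.intros)

lemma has_poly_deriv_diff:
  assumes "has_poly_deriv P P'" "has_poly_deriv Q Q'"
  shows "has_poly_deriv (\<lambda>t. P t - Q t) (\<lambda>t. P' t - Q' t)"
  using has_poly_deriv.add[OF assms(1) has_poly_deriv_linear[OF assms(2), of uminus]]
  by (simp add: linear_uminus)

lemma has_poly_deriv_bilinear:
  assumes m: "bilinear m" and "has_poly_deriv P P'" "has_poly_deriv Q Q'"
  shows "has_poly_deriv (\<lambda>t. m (P t) (Q t)) (\<lambda>t. m (P' t) (Q t) + m (P t) (Q' t))"
  using assms(2)
proof induction
  note [simp] = linear_add[OF bilinearD(1)[OF m]] linear_add[OF bilinearD(2)[OF m]]
    linear_scale[OF bilinearD(1)[OF m]] linear_scale[OF bilinearD(2)[OF m]]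
  case (monom n v)
  show ?case
    using assms(3)
  proof induction
    case (monom k w)
    \<comment> \<open>The exponent \<open>n - Suc 0\<close> is truncated at \<open>n = 0\<close>,
      where its coefficient vanishes; the exponents add up as expected only for positive
      \<open>n\<close> and \<open>k\<close>, so the zero cases are separated.\<close>
    have "real n * t ^ (n - Suc 0) * t ^ k + real k * (t ^ n * t ^ (k - Suc 0)) = real (n + k) * t ^ (n + k - Suc 0)" for t
    proof (cases "n = 0 \<or> k = 0")
      case False
      then obtain n' k' where "n = Suc n'" "k = Suc k'" by (metis not0_implies_Suc)
      then show ?thesis by (simp add: power_add algebra_simps)
    qed auto
    then have "(\<lambda>t. (real (n + k) * t ^ (n + k - Suc 0)) *\<^sub>R m v w) =
        (\<lambda>t. m ((real n * t ^ (n - Suc 0)) *\<^sub>R v) (t ^ k *\<^sub>R w) + m (t ^ n *\<^sub>R v) ((real k * t ^ (k - Suc 0)) *\<^sub>R w))"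
      by (simp add: mult_ac flip: scaleR_add_left)
    then show ?case
      using has_poly_deriv.monom[of "n + k" "m v w"] by (simp add: power_add mult.commute)
  next
    case (add Q1 Q1' Q2 Q2')
    from has_poly_deriv.add[OF add.IH] show ?case by (simp add: algebra_simps)
  qed
next
  note [simp] = linear_add[OF bilinearD(2)[OF m]]
  case (add P1 P1' P2 P2')
  from has_poly_deriv.add[OF add.IH] show ?case by (simp add: algebra_simps)
qed

lemma has_poly_deriv_real:
  assumes "has_poly_deriv P P'" and L: "linear (L :: _ \<Rightarrow> real)"
  shows "((\<lambda>t. L (P t)) has_real_derivative L (P' t)) (at t)"
  using assms(1)
proof induction
  case (monom n v)
  show ?case by (auto simp: linear_scale[OF L] intro!: derivative_eq_intros)
next
  case (add P P' Q Q')
  then show ?case by (auto simp: linear_add[OF L] intro!: derivative_eq_intros)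
qed

text \<open>A linear functional equal to 1 on a supposed nonzero difference reduces the claim to a
  real function with zero derivative. The functional comes from extending a map on one independent
  vector and needs no topology.\<close>

lemma has_poly_deriv_zero:
  assumes "has_poly_deriv P (\<lambda>t. 0)" shows "P s = P t"
proof (rule ccontr)
  let ?v = "P s - P t"
  assume "P s \<noteq> P t"
  then have "independent {?v}" by simp
  then obtain L :: "'a \<Rightarrow> real" where L: "linear L" "L ?v = 1"
    using linear_independent_extend[of "{?v}" "\<lambda>_. 1 :: real"] by auto
  have "((\<lambda>t. L (P t)) has_real_derivative 0) (at t)" for t
    using has_poly_deriv_real[OF assms L(1), of t] by (simp add: linear_0[OF L(1)])
  then have "L (P s) = L (P t)" using DERIV_isconst_all by blast
  then show False using L by (simp add: linear_diff)
qed

definition polynomial_curve :: "(real \<Rightarrow> 'b::real_vector) \<Rightarrow> bool" where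
  "polynomial_curve P \<longleftrightarrow> (\<exists>P'. has_poly_deriv P P')"

text \<open>The integral over \<open>[0, 1]\<close>, as the difference of the end values of a formal
  antiderivative. Antiderivatives are not unique as curves, but this difference is, by
  \<open>has_poly_deriv_zero\<close>.\<close>

definition poly_integral :: "(real \<Rightarrow> 'b::real_vector) \<Rightarrow> 'b" where
  "poly_integral P = (THE v. \<exists>Q. has_poly_deriv Q P \<and> v = Q 1 - Q 0)"

lemma poly_integral_deriv:
  assumes "has_poly_deriv Q P" shows "poly_integral P = Q 1 - Q 0"
  unfolding poly_integral_def
proof (rule the_equality)
  fix v assume "\<exists>Q. has_poly_deriv Q P \<and> v = Q 1 - Q 0"
  then obtain R where R: "has_poly_deriv R P" "v = R 1 - R 0" by blast
  have "has_poly_deriv (\<lambda>t. R t - Q t) (\<lambda>t. 0)"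
    using has_poly_deriv_diff[OF R(1) assms] by simp
  from has_poly_deriv_zero[OF this, of 1 0] show "v = Q 1 - Q 0" by (simp add: R(2) algebra_simps)
qed (use assms in blast)

lemma polynomial_curve_antiderivative:
  assumes "polynomial_curve P" obtains Q where "has_poly_deriv Q P"
proof -
  obtain P' where "has_poly_deriv P P'" using assms by (auto simp: polynomial_curve_def)
  then have "\<exists>Q. has_poly_deriv Q P"
  proof induction
    case (monom n v)
    show ?case
      using has_poly_deriv.monom[of "Suc n" "(1 / real (Suc n)) *\<^sub>R v"] by auto
  next
    case (add P P' Q Q')
    then show ?case by (blast intro: has_poly_deriv.add)
  qed
  then show ?thesis using that by blast
qed

lemma poly_integral_linear:
  assumes "polynomial_curve P" "linear L"
  shows "poly_integral (\<lambda>t. L (P t)) = L (poly_integral P)"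
proof -
  obtain Q where Q: "has_poly_deriv Q P" using polynomial_curve_antiderivative[OF assms(1)] .
  show ?thesis
    using poly_integral_deriv[OF has_poly_deriv_linear[OF Q assms(2)]] poly_integral_deriv[OF Q]
    by (simp add: linear_diff[OF assms(2)])
qed

lemma poly_integral_add:
  assumes "polynomial_curve P" "polynomial_curve Q"
  shows "poly_integral (\<lambda>t. P t + Q t) = poly_integral P + poly_integral Q"
proof -
  obtain A where A: "has_poly_deriv A P" using polynomial_curve_antiderivative[OF assms(1)] .
  obtain B where B: "has_poly_deriv B Q" using polynomial_curve_antiderivative[OF assms(2)] .
  show ?thesis
    using poly_integral_deriv[OF has_poly_deriv.add[OF A B]] poly_integral_deriv[OF A] poly_integral_deriv[OF B]
    by simp
qed

lemma polynomial_curve_linear: "polynomial_curve P \<Longrightarrow> linear L \<Longrightarrow> polynomial_curve (\<lambda>t. L (P t))"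
  unfolding polynomial_curve_def by (blast intro: has_poly_deriv_linear)

lemma polynomial_curve_add: "polynomial_curve P \<Longrightarrow> polynomial_curve Q \<Longrightarrow> polynomial_curve (\<lambda>t. P t + Q t)"
  unfolding polynomial_curve_def by (blast intro: has_poly_deriv.add)

lemma polynomial_curve_diff: "polynomial_curve P \<Longrightarrow> polynomial_curve Q \<Longrightarrow> polynomial_curve (\<lambda>t. P t - Q t)"
  unfolding polynomial_curve_def by (blast intro: has_poly_deriv_diff)

lemma polynomial_curve_const: "polynomial_curve (\<lambda>t. v)"
  unfolding polynomial_curve_def by (blast intro: has_poly_deriv_const)

lemma polynomial_curve_bilinear:
  "bilinear m \<Longrightarrow> polynomial_curve P \<Longrightarrow> polynomial_curve Q \<Longrightarrow> polynomial_curve (\<lambda>t. m (P t) (Q t))"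
  unfolding polynomial_curve_def by (blast intro: has_poly_deriv_bilinear)

lemma linear_poly_integral:
  assumes "\<And>t. linear (g t)" "\<And>x. polynomial_curve (\<lambda>t. g t x)"
  shows "linear (\<lambda>x. poly_integral (\<lambda>t. g t x))"
proof (rule linearI)
  show "poly_integral (\<lambda>t. g t (x + y)) = poly_integral (\<lambda>t. g t x) + poly_integral (\<lambda>t. g t y)" for x y
    by (simp add: linear_add[OF assms(1)] poly_integral_add assms(2))
  show "poly_integral (\<lambda>t. g t (c *\<^sub>R x)) = c *\<^sub>R poly_integral (\<lambda>t. g t x)" for c x
    using poly_integral_linear[OF assms(2), of "\<lambda>v. c *\<^sub>R v"]
    by (simp add: linear_scale[OF assms(1)] linear_compose_scale_right linear_ident)
qed

text \<open>Being homogeneous means being fixed by the linear map \<open>hproj\<close>, and the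
  integral commutes with linear maps.\<close>

lemma Hom_poly_integral:
  fixes g :: "real \<Rightarrow> 'a::graded_vector \<Rightarrow> 'b::graded_vector"
  assumes g: "\<And>t. g t \<in> Hom p" and P: "\<And>x. polynomial_curve (\<lambda>t. g t x)"
  shows "(\<lambda>x. poly_integral (\<lambda>t. g t x)) \<in> Hom p"
proof (rule HomI)
  show "linear (\<lambda>x. poly_integral (\<lambda>t. g t x))"
    by (rule linear_poly_integral[OF Hom_linear[OF g] P])
  fix n and x :: 'a assume "x \<in> gcomp n"
  then have "g t x \<in> gcomp (n + p)" for t using Hom_gcomp[OF g] by blast
  then show "poly_integral (\<lambda>t. g t x) \<in> gcomp (n + p)"
    using poly_integral_linear[OF P linear_hproj, of "n + p" x] by (simp add: gcomp_def)
qed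

lemma has_poly_deriv_conv:
  fixes \<alpha> :: "real \<Rightarrow> 'a::graded_vector sym \<Rightarrow> 'b::real_vector" and \<beta> :: "real \<Rightarrow> 'a sym \<Rightarrow> 'c::real_vector"
  assumes m: "bilinear m"
    and lin: "\<And>t. linear (\<alpha> t)" "\<And>t. linear (\<alpha>' t)" "\<And>t. linear (\<beta> t)" "\<And>t. linear (\<beta>' t)"
    and d: "\<And>x. has_poly_deriv (\<lambda>t. \<alpha> t x) (\<lambda>t. \<alpha>' t x)" "\<And>x. has_poly_deriv (\<lambda>t. \<beta> t x) (\<lambda>t. \<beta>' t x)"
  shows "has_poly_deriv (\<lambda>t. conv q m (\<alpha> t) (\<beta> t) x)
    (\<lambda>t. conv q m (\<alpha>' t) (\<beta> t) x + conv q m (\<alpha> t) (\<beta>' t) x)"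
proof -
  let ?F = "\<lambda>t z. tensor_lift m (tmap q (\<alpha> t) (\<beta> t) z)"
  let ?G = "\<lambda>t z. tensor_lift m (tmap q (\<alpha>' t) (\<beta> t) z) + tensor_lift m (tmap q (\<alpha> t) (\<beta>' t) z)"
  have linF: "linear (?F t)" "linear (?G t)" for t
    by (intro linear_compose_add linear_comp[OF linear_tensor_lift_bilinear] linear_tmap m lin)+
  \<comment> \<open>On pure tensors this is the product rule for bilinear maps. Both curves are
    linear in \<open>z\<close>, so the relation passes to sums and multiples.\<close>
  have "has_poly_deriv (\<lambda>t. ?F t z) (\<lambda>t. ?G t z)" for z
  proof (induction z rule: tensor_induct_homogeneous)
    case subspace
    show ?case
    proof (rule subspaceI; unfold mem_Collect_eq)
      show "has_poly_deriv (\<lambda>t. ?F t 0) (\<lambda>t. ?G t 0)"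
        unfolding linear_0[OF linF(1)] linear_0[OF linF(2)] by (rule has_poly_deriv_const)
    next
      fix x y assume "has_poly_deriv (\<lambda>t. ?F t x) (\<lambda>t. ?G t x)" "has_poly_deriv (\<lambda>t. ?F t y) (\<lambda>t. ?G t y)"
      from has_poly_deriv.add[OF this]
      show "has_poly_deriv (\<lambda>t. ?F t (x + y)) (\<lambda>t. ?G t (x + y))"
        unfolding linear_add[OF linF(1)] linear_add[OF linF(2)] .
    next
      fix c x assume "has_poly_deriv (\<lambda>t. ?F t x) (\<lambda>t. ?G t x)"
      from has_poly_deriv_linear[OF this linear_compose_scale_right[OF linear_ident, of c]]
      show "has_poly_deriv (\<lambda>t. ?F t (c *\<^sub>R x)) (\<lambda>t. ?G t (c *\<^sub>R x))"
        unfolding linear_scale[OF linF(1)] linear_scale[OF linF(2)] .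
    qed
  next
    case (tens x y d e)
    show ?case
      unfolding tensor_lift_tmap_homogeneous[OF m lin(1,3) tens(1)] tensor_lift_tmap_homogeneous[OF m lin(2,3) tens(1)]
        tensor_lift_tmap_homogeneous[OF m lin(1,4) tens(1)]
      using has_poly_deriv_linear[OF has_poly_deriv_bilinear[OF m d] linear_compose_scale_right[OF linear_ident, of "msgn (q * d)"], of x y]
      by (simp add: scaleR_add_right)
  qed
  then show ?thesis by (simp add: conv_def)
qed

lemma polynomial_curve_conv:
  fixes \<alpha> :: "real \<Rightarrow> 'a::graded_vector sym \<Rightarrow> 'b::real_vector" and \<beta> :: "real \<Rightarrow> 'a sym \<Rightarrow> 'c::real_vector"
  assumes m: "bilinear m" and lin: "\<And>t. linear (\<alpha> t)" "\<And>t. linear (\<beta> t)"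
    and P: "\<And>x. polynomial_curve (\<lambda>t. \<alpha> t x)" "\<And>x. polynomial_curve (\<lambda>t. \<beta> t x)"
  shows "polynomial_curve (\<lambda>t. conv q m (\<alpha> t) (\<beta> t) x)"
proof -
  let ?F = "\<lambda>t z. tensor_lift m (tmap q (\<alpha> t) (\<beta> t) z)"
  have linF: "linear (?F t)" for t
    by (intro linear_comp[OF linear_tensor_lift_bilinear] linear_tmap m lin)
  have "polynomial_curve (\<lambda>t. ?F t z)" for z
  proof (induction z rule: tensor_induct_homogeneous)
    case subspace
    show ?case
      using polynomial_curve_linear[OF _ linear_compose_scale_right[OF linear_ident]]
      by (intro subspaceI; unfold mem_Collect_eq linear_0[OF linF] linear_add[OF linF] linear_scale[OF linF])
        (auto intro: polynomial_curve_const polynomial_curve_add)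
  next
    case (tens x y d e)
    show ?case
      unfolding tensor_lift_tmap_homogeneous[OF m lin tens(1)]
      by (rule polynomial_curve_linear[OF polynomial_curve_bilinear[OF m P] linear_compose_scale_right[OF linear_ident]])
  qed
  then show ?thesis by (simp add: conv_def)
qed

lemma conv_poly_integral:
  fixes \<alpha> :: "'a::graded_vector sym \<Rightarrow> 'b::real_vector" and \<beta> :: "real \<Rightarrow> 'a sym \<Rightarrow> 'c::real_vector"
  assumes m: "bilinear m" and lin: "linear \<alpha>" "\<And>t. linear (\<beta> t)"
    and P: "\<And>x. polynomial_curve (\<lambda>t. \<beta> t x)"
  shows "conv q m \<alpha> (\<lambda>x. poly_integral (\<lambda>t. \<beta> t x)) x = poly_integral (\<lambda>t. conv q m \<alpha> (\<beta> t) x)"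
proof -
  let ?F = "\<lambda>t z. tensor_lift m (tmap q \<alpha> (\<beta> t) z)"
  note linI = linear_poly_integral[OF lin(2) P]
  have linF: "linear (?F t)" for t
    by (intro linear_comp[OF linear_tensor_lift_bilinear] linear_tmap m lin)
  have PF: "polynomial_curve (\<lambda>t. ?F t z)" for z
  proof (induction z rule: tensor_induct_homogeneous)
    case subspace
    show ?case
      using polynomial_curve_linear[OF _ linear_compose_scale_right[OF linear_ident]]
      by (intro subspaceI; unfold mem_Collect_eq linear_0[OF linF] linear_add[OF linF] linear_scale[OF linF])
        (auto intro: polynomial_curve_const polynomial_curve_add)
  next
    case (tens x y d e)
    show ?case
      unfolding tensor_lift_tmap_homogeneous[OF m lin tens(1)]
      by (rule polynomial_curve_linear[OF polynomial_curve_bilinear[OF m polynomial_curve_const P] linear_compose_scale_right[OF linear_ident]])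
  qed
  have "tensor_lift m (tmap q \<alpha> (\<lambda>x. poly_integral (\<lambda>t. \<beta> t x)) z) = poly_integral (\<lambda>t. ?F t z)" for z
  proof (rule tensor_eqI[where F = "\<lambda>z. tensor_lift m (tmap q \<alpha> (\<lambda>x. poly_integral (\<lambda>t. \<beta> t x)) z)"])
    show "linear (\<lambda>z. tensor_lift m (tmap q \<alpha> (\<lambda>x. poly_integral (\<lambda>t. \<beta> t x)) z))"
      by (intro linear_comp[OF linear_tensor_lift_bilinear] linear_tmap m lin linI)
    show "linear (\<lambda>z. poly_integral (\<lambda>t. ?F t z))"
      by (rule linear_poly_integral[OF linF PF])
    fix x y :: "'a sym" and d e assume x: "x \<in> gcomp d"
    show "tensor_lift m (tmap q \<alpha> (\<lambda>x. poly_integral (\<lambda>t. \<beta> t x)) (x \<otimes> y)) = poly_integral (\<lambda>t. ?F t (x \<otimes> y))"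
      unfolding tensor_lift_tmap_homogeneous[OF m lin x] tensor_lift_tmap_homogeneous[OF m lin(1) linI x]
      by (rule sym[OF poly_integral_linear[OF P linear_compose_scale_right[OF bilinearD(1)[OF m]]]])
  qed
  then show ?thesis by (simp add: conv_def)
qed

lemma has_poly_deriv_cochain_power:
  assumes K: "\<And>t. linear (K t)" "\<And>t. linear (K' t)" "\<And>x. has_poly_deriv (\<lambda>t. K t x) (\<lambda>t. K' t x)"
  shows "has_poly_deriv (\<lambda>t. cochain_power (K t) m x) (\<lambda>t. cochain_power_deriv (K t) (K' t) m x)"
proof (induction m arbitrary: x)
  case 0
  show ?case by (simp add: has_poly_deriv_const)
next
  case (Suc m)
  have "linear (cochain_power_deriv (K t) (K' t) m)" for t
    by (induction m) (auto intro!: linear_zero linear_compose_add linear_conv bilinear_tcons K linear_cochain_power)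
  then show ?case
    by (simp add: has_poly_deriv_conv bilinear_tcons K linear_cochain_power Suc.IH)
qed

lemma polynomial_curve_cochain_power_primitive:
  assumes K: "\<And>t. K t \<in> Hom 1" "\<And>x. polynomial_curve (\<lambda>t. K t x)" and b: "b \<in> Hom 0"
  shows "polynomial_curve (\<lambda>t. cochain_power_primitive (K t) b m x)"
proof (induction m arbitrary: x)
  case 0
  show ?case by (simp add: polynomial_curve_const)
next
  case (Suc m)
  have "polynomial_curve (\<lambda>t. cochain_power (K t) m x)" for x
    by (induction m arbitrary: x)
      (simp_all add: polynomial_curve_const polynomial_curve_conv bilinear_tcons K Hom_linear[OF K(1)] linear_cochain_power)
  moreover have "linear (cochain_power_primitive (K t) b m)" for t
    by (rule Hom_linear[OF Hom_cochain_power_primitive[OF K(1) b]])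
  ultimately show ?case
    by (simp add: polynomial_curve_conv polynomial_curve_diff polynomial_curve_const bilinear_tcons K Hom_linear[OF K(1)]
        Hom_linear[OF b] linear_cochain_power Suc.IH)
qed

subsection \<open>The differential on invariant cochains\<close>

lemma bilinear_rho:
  assumes "linear \<rho>" shows "bilinear (\<lambda>x v. \<rho> (x \<otimes> v))"
  by (intro bilinearI linear_comp[OF assms linear_tens_left] linear_comp[OF assms linear_tens_right])

lemma D_conv:
  fixes \<rho> :: "'g::graded_vector shift sym \<otimes> 'v::graded_vector \<Rightarrow> 'v"
  assumes \<rho>: "linear \<rho>" and \<alpha>: "linear \<alpha>"
  shows "D lam \<rho> q \<alpha> x = conv q (\<lambda>x v. \<rho> (x \<otimes> v)) (\<lambda>x. x) \<alpha> x - msgn q *\<^sub>R \<alpha> (coder lam x)"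
proof -
  note A = bilinear_rho[OF \<rho>]
  have "\<rho> (tmap q id \<alpha> t) = tensor_lift (\<lambda>x v. \<rho> (x \<otimes> v)) (tmap q (\<lambda>x. x) \<alpha> t)" for t
  proof (rule tensor_eqI[where F = "\<lambda>t. \<rho> (tmap q id \<alpha> t)"])
    show "linear (\<lambda>t. \<rho> (tmap q id \<alpha> t))" "linear (\<lambda>t. tensor_lift (\<lambda>x v. \<rho> (x \<otimes> v)) (tmap q (\<lambda>x. x) \<alpha> t))"
      by (intro linear_comp[OF \<rho>] linear_comp[OF linear_tensor_lift_bilinear] linear_tmap linear_id linear_ident A \<alpha>)+
    fix x y :: "'g shift sym" and d e assume x: "x \<in> gcomp d"
    show "\<rho> (tmap q id \<alpha> (x \<otimes> y)) = tensor_lift (\<lambda>x v. \<rho> (x \<otimes> v)) (tmap q (\<lambda>x. x) \<alpha> (x \<otimes> y))"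
      unfolding tensor_lift_tmap_homogeneous[OF A linear_ident \<alpha> x] tmap_homogeneous[OF linear_id \<alpha> x]
      by (simp add: linear_scale[OF \<rho>])
  qed
  then show ?thesis by (simp add: D_def conv_def)
qed

lemma D_add:
  assumes \<rho>: "linear \<rho>" and "linear \<alpha>" "linear \<beta>"
  shows "D lam \<rho> q (\<lambda>x. \<alpha> x + \<beta> x) x = D lam \<rho> q \<alpha> x + D lam \<rho> q \<beta> x"
  using assms
  by (simp add: D_conv linear_compose_add conv_add_right bilinear_rho linear_ident scaleR_add_right)

lemma D_scale:
  assumes \<rho>: "linear \<rho>" and "linear \<alpha>"
  shows "D lam \<rho> q (\<lambda>x. c *\<^sub>R \<alpha> x) x = c *\<^sub>R D lam \<rho> q \<alpha> x"
  using assms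
  by (simp add: D_conv linear_compose_scale_right conv_scale_right bilinear_rho linear_ident scaleR_diff_right)

lemma D_poly_integral:
  assumes \<rho>: "linear \<rho>" and g: "\<And>t. linear (g t)" and P: "\<And>x. polynomial_curve (\<lambda>t. g t x)"
  shows "D lam \<rho> q (\<lambda>x. poly_integral (\<lambda>t. g t x)) x = poly_integral (\<lambda>t. D lam \<rho> q (g t) x)"
proof -
  have c: "polynomial_curve (\<lambda>t. conv q (\<lambda>x v. \<rho> (x \<otimes> v)) (\<lambda>x. x) (g t) x)"
    by (intro polynomial_curve_conv bilinear_rho[OF \<rho>] linear_ident g P polynomial_curve_const)
  have s: "linear (\<lambda>v. (- msgn q) *\<^sub>R v)" by (intro linear_compose_scale_right linear_ident)
  have "D lam \<rho> q (g t) x = conv q (\<lambda>x v. \<rho> (x \<otimes> v)) (\<lambda>x. x) (g t) x + (- msgn q) *\<^sub>R g t (coder lam x)" for t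
    by (simp add: D_conv[OF \<rho> g])
  then have "poly_integral (\<lambda>t. D lam \<rho> q (g t) x) =
      poly_integral (\<lambda>t. conv q (\<lambda>x v. \<rho> (x \<otimes> v)) (\<lambda>x. x) (g t) x) + (- msgn q) *\<^sub>R poly_integral (\<lambda>t. g t (coder lam x))"
    using poly_integral_add[OF c polynomial_curve_linear[OF P s]] poly_integral_linear[OF P s] by simp
  then show ?thesis
    by (simp add: D_conv[OF \<rho> linear_poly_integral[OF g P]] conv_poly_integral[OF bilinear_rho[OF \<rho>] linear_ident g P])
qed

text \<open>On \<open>S x\<close> the pulled-back representation is \<open>\<rho>\<close> on
  \<open>x\<close>, because \<open>S\<close> splits \<open>sym_map \<pi>\<close>; invariance of
  \<open>f\<close> then exchanges \<open>\<rho>\<close> with the induced ruth inside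
  \<open>f\<close>. The sign \<open>msgn p\<close> of invariance also occurs in the term with
  \<open>coder lam\<close>, as part of \<open>msgn (p + q)\<close>, so it factors out.\<close>

lemma D_invariant:
  fixes ad :: "'h::graded_vector shift sym \<otimes> 'n::graded_vector \<Rightarrow> 'n"
    and \<rho> :: "'g::graded_vector shift sym \<otimes> 'v::graded_vector \<Rightarrow> 'v"
  assumes ad: "ad \<in> Hom 1" and \<rho>: "\<rho> \<in> Hom 1" and S: "S \<in> Hom 0" and lam: "lam \<in> Hom 1" and \<pi>: "\<pi> \<in> Hom 0"
    and sec: "\<And>x. sym_map \<pi> (S x) = x" and f: "f \<in> Hom p"
    and inv: "\<And>t. f (wedge_ruth ad t) = msgn p *\<^sub>R pullback \<pi> \<rho> (tmap p id f t)"
    and \<beta>: "linear \<beta>"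
  shows "D lam \<rho> (p + q) (\<lambda>x. f (wedge_proj (\<beta> x))) x = msgn p *\<^sub>R f (wedge_proj (nabla ad S lam q \<beta> x))"
proof -
  note lf = Hom_linear[OF f] and lp = linear_wedge_proj and lr = Hom_linear[OF \<rho>]
  note lfp = linear_comp[OF lf lp]
  have ruth: "f (wedge_proj (talg_ruth ad (x \<otimes> t))) = (msgn p * msgn (p * d)) *\<^sub>R \<rho> (sym_map \<pi> x \<otimes> f (wedge_proj t))"
    if x: "x \<in> gcomp d" for x t d
  proof -
    have "sym_map \<pi> x \<in> gcomp d" using Hom_gcomp[OF Hom_sym_map[OF \<pi>] x] by simp
    have "f (wedge_proj (talg_ruth ad (x \<otimes> t))) = msgn p *\<^sub>R \<rho> (tmap 0 (sym_map \<pi>) id (tmap p id f (x \<otimes> wedge_proj t)))"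
      using inv[of "x \<otimes> wedge_proj t"] by (simp add: wedge_ruth_wedge_proj[OF ad] pullback_def)
    also have "\<dots> = (msgn p * msgn (p * d)) *\<^sub>R \<rho> (sym_map \<pi> x \<otimes> f (wedge_proj t))"
      unfolding tmap_homogeneous[OF linear_id lf x] id_apply linear_scale[OF linear_tmap[OF linear_sym_map[OF \<pi>] linear_id]]
        tmap_homogeneous[OF linear_sym_map[OF \<pi>] linear_id x]
      by (simp add: linear_scale[OF lr])
    finally show ?thesis .
  qed
  have "conv (p + q) (\<lambda>x v. \<rho> (x \<otimes> v)) (\<lambda>x. x) (\<lambda>x. f (wedge_proj (\<beta> x))) x =
      msgn p *\<^sub>R f (wedge_proj (conv q (\<lambda>x t. talg_ruth ad (x \<otimes> t)) S \<beta> x))"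
  proof (rule conv_cong[where f = "\<lambda>t. msgn p *\<^sub>R f (wedge_proj t)"])
    fix x y :: "'g shift sym" and d e assume x: "x \<in> gcomp d"
    have "S x \<in> gcomp d" using Hom_gcomp[OF S x] by simp
    from ruth[OF this, of "\<beta> y"]
    show "msgn ((p + q) * d) *\<^sub>R \<rho> (x \<otimes> f (wedge_proj (\<beta> y))) =
      msgn (q * d) *\<^sub>R msgn p *\<^sub>R f (wedge_proj (talg_ruth ad (S x \<otimes> \<beta> y)))"
      by (simp add: sec algebra_simps msgn_add)
  qed (intro bilinear_rho lr linear_ident linear_comp[OF lfp \<beta>] bilinear_talg_ruth[OF ad] Hom_linear[OF S] \<beta>
      linear_compose_scale_right lfp)+
  then show ?thesis
    using linear_comp[OF lfp \<beta>]
    by (simp add: D_conv[OF lr] nabla_def[OF ad S lam] linear_diff[OF lfp] linear_scale[OF lfp] scaleR_diff_right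
        msgn_add)
qed

subsection \<open>Extensions\<close>

lemma sym_map_mult:
  assumes F: "F \<in> Hom 0"
  shows "sym_map F (sym_mult (x \<otimes> y)) = sym_mult (sym_map F x \<otimes> sym_map F y)"
proof (rule sym_eqI[where F = "\<lambda>x. sym_map F (sym_mult (x \<otimes> y))"])
  note lin = linear_comp[OF linear_sym_map[OF F]] linear_comp[OF linear_sym_mult]
    linear_comp[OF linear_tens_left] linear_comp[OF linear_tens_right] linear_tens_left linear_tens_right linear_sym_map[OF F]
  show "linear (\<lambda>x. sym_map F (sym_mult (x \<otimes> y)))" "linear (\<lambda>x. sym_mult (sym_map F x \<otimes> sym_map F y))"
    by (intro lin)+
  show "sym_map F (sym_mult (sprod us \<otimes> y)) = sym_mult (sym_map F (sprod us) \<otimes> sym_map F y)" for us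
  proof (rule sym_eqI[where F = "\<lambda>y. sym_map F (sym_mult (sprod us \<otimes> y))"])
    show "linear (\<lambda>y. sym_map F (sym_mult (sprod us \<otimes> y)))" "linear (\<lambda>y. sym_mult (sym_map F (sprod us) \<otimes> sym_map F y))"
      by (intro lin)+
  qed (simp add: sym_mult_sprod sym_map_sprod[OF F])
qed

lemma sym_map_incl: "F \<in> Hom 0 \<Longrightarrow> sym_map F (sym_incl v) = sym_incl (F v)"
  by (simp add: sym_incl_def sym_map_sprod)

lemma Hom_sym_mult: "sym_mult \<in> Hom 0"
proof (rule Hom_tensorI[OF linear_sym_mult])
  fix x y :: "'a sym" and d e assume x: "x \<in> gcomp d" and y: "y \<in> gcomp e"
  have "sym_mult (hproj d x \<otimes> hproj e y) \<in> gcomp (d + e)"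
  proof (induction x rule: sym_induct_homogeneous)
    case subspace
    show ?case
      using subspace_preimage[OF linear_comp[OF linear_sym_mult linear_comp[OF linear_tens_left linear_hproj]] subspace_gcomp] .
  next
    case (sprod ds us)
    show ?case
    proof (induction y rule: sym_induct_homogeneous)
      case subspace
      show ?case
        using subspace_preimage[OF linear_comp[OF linear_sym_mult linear_comp[OF linear_tens_right linear_hproj]] subspace_gcomp] .
    next
      case (sprod es vs)
      have "sprod (us @ vs) \<in> gcomp (sum_list ds + sum_list es)"
        using sprod_gcomp[of "ds @ es" "us @ vs"] sprod \<open>homogeneous ds us\<close> by (simp add: list_all2_appendI)
      then show ?case
        using hproj_homogeneous[OF sprod_gcomp[OF sprod]] hproj_homogeneous[OF sprod_gcomp[OF \<open>homogeneous ds us\<close>]]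
        by (auto simp: sym_mult_sprod linear_0[OF linear_tens_left] linear_0[OF linear_tens_right] linear_0[OF linear_sym_mult])
    qed
  qed
  then show "sym_mult (x \<otimes> y) \<in> gcomp (d + e + 0)" using x y by (simp add: gcomp_def)
qed

lemma Hom_sym_incl: "sym_incl \<in> Hom 0"
  by (rule HomI[OF linear_sym_incl]) (use sprod_gcomp[of "[_]" "[_]"] in \<open>simp add: sym_incl_def\<close>)

locale extension_context =
  fixes lam_n :: "'n::graded_vector shift sym \<Rightarrow> 'n shift"
    and lam_h :: "'h::graded_vector shift sym \<Rightarrow> 'h shift"
    and lam_g :: "'g::graded_vector shift sym \<Rightarrow> 'g shift"
    and \<iota> :: "'n shift \<Rightarrow> 'h shift" and \<pi> :: "'h shift \<Rightarrow> 'g shift"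
  assumes ext: "linf_extension lam_n lam_h lam_g \<iota> \<pi>"
begin

lemma Hom_iota: "\<iota> \<in> Hom 0" and Hom_pi: "\<pi> \<in> Hom 0"
  and Hom_lam_h: "lam_h \<in> Hom 1" and Hom_lam_g: "lam_g \<in> Hom 1"
  and inj_iota: "inj \<iota>" and range_iota: "range \<iota> = {x. \<pi> x = 0}"
  and coder_coder_h: "coder lam_h (coder lam_h x) = 0"
  and pi_morphism: "sym_map \<pi> (coder lam_h x) = coder lam_g (sym_map \<pi> x)"
  using ext unfolding linf_extension_def linf_algebra_def strict_linf_morphism_def linf_morphism_def
  by (auto dest: fun_cong[of _ _ x])

lemmas linear_iota = Hom_linear[OF Hom_iota] and linear_pi = Hom_linear[OF Hom_pi]
  and linear_lam_h = Hom_linear[OF Hom_lam_h] and linear_lam_g = Hom_linear[OF Hom_lam_g]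

lemma pi_iota: "\<pi> (\<iota> u) = 0"
  using range_iota by blast

lemma iota_inv: "\<pi> y = 0 \<Longrightarrow> \<iota> (inv \<iota> y) = y"
  using range_iota by (intro f_inv_into_f) blast

lemma lam_h_coder: "lam_h (coder lam_h x) = 0"
  using sym_proj_coder[OF linear_lam_h, of "coder lam_h x"] by (simp add: coder_coder_h linear_0[OF linear_sym_proj])

lemma pi_lam_h: "\<pi> (lam_h x) = lam_g (sym_map \<pi> x)"
proof -
  have "sym_proj (sym_map \<pi> (coder lam_h x)) = sym_proj (coder lam_g (sym_map \<pi> x))"
    by (simp only: pi_morphism)
  then show ?thesis
    by (simp add: sym_proj_sym_map[OF Hom_pi] sym_proj_coder linear_lam_h linear_lam_g)
qed

text \<open>Maps into n[1] are defined through \<open>inv \<iota>\<close>, which is controlled on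
  the range of \<open>\<iota>\<close> only. Their linearity and degree are read off after
  composition with \<open>\<iota>\<close>, which is injective and commutes with the projections
  \<open>hproj\<close>.\<close>

lemma Hom_iota_cancel:
  fixes F :: "'a::graded_vector \<Rightarrow> 'n shift"
  assumes "(\<lambda>x. \<iota> (F x)) \<in> Hom p" shows "F \<in> Hom p"
proof (rule HomI)
  note lin = Hom_linear[OF assms]
  show "linear F"
  proof (rule linearI)
    show "F (x + y) = F x + F y" for x y
      using linear_add[OF lin, of x y] injD[OF inj_iota] by (simp flip: linear_add[OF linear_iota])
    show "F (c *\<^sub>R x) = c *\<^sub>R F x" for c x
      using linear_scale[OF lin, of c x] injD[OF inj_iota] by (simp flip: linear_scale[OF linear_iota])
  qed
  fix n and x :: 'a assume "x \<in> gcomp n"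
  then have "\<iota> (F x) \<in> gcomp (n + p)" by (rule Hom_gcomp[OF assms])
  then have "\<iota> (hproj (n + p) (F x)) = \<iota> (F x)"
    using Hom_hproj[OF Hom_iota, of "n + p" "F x"] by (simp add: gcomp_def)
  then show "F x \<in> gcomp (n + p)" using injD[OF inj_iota] by (simp add: gcomp_def)
qed

abbreviation "ad \<equiv> ad_restr lam_h \<iota>"

lemma Hom_sym_incl_iota: "sym_incl \<circ> \<iota> \<in> Hom 0"
  using Hom_compose[OF Hom_sym_incl Hom_iota] by (simp add: o_def)

lemma Hom_id: "id \<in> Hom 0"
  using Hom_ident by (simp add: id_def)

lemma iota_ad: "\<iota> (ad t) = lam_h (sym_mult (tmap 0 id (sym_incl \<circ> \<iota>) t))"
proof -
  note li = Hom_linear[OF Hom_sym_incl_iota]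
  have "sym_map \<pi> (sym_mult (tmap 0 id (sym_incl \<circ> \<iota>) t)) = 0"
  proof (rule tensor_eqI[where F = "\<lambda>t. sym_map \<pi> (sym_mult (tmap 0 id (sym_incl \<circ> \<iota>) t))" and G = "\<lambda>t. 0"])
    show "linear (\<lambda>t. sym_map \<pi> (sym_mult (tmap 0 id (sym_incl \<circ> \<iota>) t)))"
      by (intro linear_comp[OF linear_sym_map[OF Hom_pi]] linear_comp[OF linear_sym_mult] linear_tmap linear_id li)
    fix x :: "'h shift sym" and u :: "'n shift" and d assume "x \<in> gcomp d"
    then show "sym_map \<pi> (sym_mult (tmap 0 id (sym_incl \<circ> \<iota>) (x \<otimes> u))) = 0"
      by (simp only: tmap_homogeneous[OF linear_id li])
        (simp add: sym_map_mult[OF Hom_pi] sym_map_incl[OF Hom_pi] pi_iota linear_0[OF linear_sym_incl]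
          linear_0[OF linear_tens_right] linear_0[OF linear_sym_mult])
  qed (rule linear_zero)
  then show ?thesis
    by (simp add: ad_restr_def iota_inv pi_lam_h linear_0[OF linear_lam_g])
qed

lemma Hom_ad: "ad \<in> Hom 1"
  by (rule Hom_iota_cancel, unfold iota_ad)
    (use Hom_compose[OF Hom_lam_h Hom_compose[OF Hom_sym_mult Hom_tmap[OF Hom_id Hom_sym_incl_iota]]] in simp)

lemma iota_ad_tens: "\<iota> (ad (x \<otimes> u)) = lam_h (sym_mult (x \<otimes> sym_incl (\<iota> u)))"
proof (rule sym_eqI[where F = "\<lambda>x. \<iota> (ad (x \<otimes> u))"])
  show "linear (\<lambda>x. \<iota> (ad (x \<otimes> u)))"
    by (rule linear_comp[OF linear_iota linear_rho_left[OF Hom_ad]])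
  show "linear (\<lambda>x. lam_h (sym_mult (x \<otimes> sym_incl (\<iota> u))))"
    by (intro linear_comp[OF linear_lam_h] linear_comp[OF linear_sym_mult] linear_tens_left)
  fix ds and vs :: "'h shift list" assume "homogeneous ds vs"
  then show "\<iota> (ad (sprod vs \<otimes> u)) = lam_h (sym_mult (sprod vs \<otimes> sym_incl (\<iota> u)))"
    by (simp only: iota_ad tmap_homogeneous[OF linear_id Hom_linear[OF Hom_sym_incl_iota] sprod_gcomp]) simp
qed

lemma Hom_section: "is_section \<pi> h \<Longrightarrow> h \<in> Hom 0"
  by (simp add: is_section_def)

lemma pi_section: "is_section \<pi> h \<Longrightarrow> \<pi> (h x) = x"
  by (simp add: is_section_def fun_eq_iff)

lemma sym_map_section:
  assumes h: "is_section \<pi> h" shows "sym_map \<pi> (sym_map h x) = x"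
  by (rule sym_eqI[OF linear_comp[OF linear_sym_map[OF Hom_pi] linear_sym_map[OF Hom_section[OF h]]] linear_ident])
    (simp add: sym_map_sprod[OF Hom_pi] sym_map_sprod[OF Hom_section[OF h]] pi_section[OF h] o_def)

abbreviation "curv \<equiv> curvature lam_h lam_g \<iota>"

lemma iota_curv:
  assumes h: "is_section \<pi> h" shows "\<iota> (curv h x) = lam_h (sym_map h x) - h (lam_g x)"
  by (simp add: curvature_def iota_inv linear_diff[OF linear_pi] pi_lam_h sym_map_section[OF h] pi_section[OF h])

lemma Hom_curv:
  assumes h: "is_section \<pi> h" shows "curv h \<in> Hom 1"
  by (rule Hom_iota_cancel, unfold iota_curv[OF h])
    (use Hom_compose[OF Hom_lam_h Hom_sym_map[OF Hom_section[OF h]]] Hom_compose[OF Hom_section[OF h] Hom_lam_g]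
      in \<open>simp add: Hom_diff\<close>)

abbreviation nab :: "('g shift \<Rightarrow> 'h shift) \<Rightarrow> int \<Rightarrow> ('g shift sym \<Rightarrow> 'n shift) \<Rightarrow> 'g shift sym \<Rightarrow> 'n shift" where
  "nab h \<equiv> nabla1 ad (sym_map h) lam_g"

text \<open>\<open>conv_smul_flip\<close> moves the argument of \<open>ad\<close> from the right to
  the left of the symmetric product. The result has the shape in which the curvature comes out of
  \<open>coder_sym_map\<close> and the difference of sections out of the derivative of
  \<open>sym_map\<close>.\<close>

lemma iota_nab:
  assumes h: "is_section \<pi> h" and \<alpha>: "\<alpha> \<in> Hom a"
  shows "\<iota> (nab h a \<alpha> x) = lam_h (conv 0 smul (\<lambda>x. \<iota> (\<alpha> x)) (sym_map h) x) - msgn a *\<^sub>R \<iota> (\<alpha> (coder lam_g x))"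
proof -
  note F = Hom_section[OF h]
  have \<iota>\<alpha>: "(\<lambda>x. \<iota> (\<alpha> x)) \<in> Hom a" using Hom_compose[OF Hom_iota \<alpha>] by simp
  note A = bilinear_rho[OF Hom_linear[OF Hom_ad]] and S = linear_sym_map[OF F] and l\<alpha> = Hom_linear[OF \<alpha>]
  have B: "bilinear (\<lambda>x u. \<iota> (ad (x \<otimes> u)))"
    by (intro bilinearI linear_comp[OF linear_iota bilinearD(1)[OF A]] linear_comp[OF linear_iota bilinearD(2)[OF A]])
  have "conv a (\<lambda>x u. \<iota> (ad (x \<otimes> u))) (sym_map h) \<alpha> x = \<iota> (conv a (\<lambda>x u. ad (x \<otimes> u)) (sym_map h) \<alpha> x)"
    by (rule conv_cong) (auto intro: A B S l\<alpha> linear_iota simp: linear_scale[OF linear_iota])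
  moreover have "conv a (\<lambda>x u. \<iota> (ad (x \<otimes> u))) (sym_map h) \<alpha> x =
      lam_h (conv a (\<lambda>y u. sym_mult (y \<otimes> sym_incl u)) (sym_map h) (\<lambda>x. \<iota> (\<alpha> x)) x)"
    by (rule conv_cong[OF B S l\<alpha> bilinear_rmul S Hom_linear[OF \<iota>\<alpha>] linear_lam_h]) (simp add: iota_ad_tens)
  ultimately show ?thesis
    unfolding nabla1_def[OF Hom_ad Hom_sym_map[OF F] Hom_lam_g] conv_smul_flip[OF F \<iota>\<alpha>]
    by (simp add: linear_diff[OF linear_iota] linear_scale[OF linear_iota])
qed

lemma bianchi:
  assumes h: "is_section \<pi> h" shows "nab h 1 (curv h) x = 0"
proof -
  note F = Hom_section[OF h] and K = Hom_curv[OF h]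
  note S = linear_sym_map[OF F]
  have l: "linear (\<lambda>x. \<iota> (curv h x))" "linear (\<lambda>x. h (lam_g x))"
    by (rule linear_comp[OF linear_iota Hom_linear[OF K]] linear_comp[OF Hom_linear[OF F] linear_lam_g])+
  have "coder lam_h (sym_map h x) = conv 0 smul (\<lambda>x. \<iota> (curv h x) + h (lam_g x)) (sym_map h) x"
    by (simp add: coder_sym_map[OF linear_lam_h F] iota_curv[OF h])
  also have "\<dots> = conv 0 smul (\<lambda>x. \<iota> (curv h x)) (sym_map h) x + sym_map h (coder lam_g x)"
    by (simp add: conv_add_left bilinear_smul l S sym_map_coder[OF linear_lam_g F])
  finally have "lam_h (conv 0 smul (\<lambda>x. \<iota> (curv h x)) (sym_map h) x) + lam_h (sym_map h (coder lam_g x)) = 0"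
    using lam_h_coder[of "sym_map h x"] by (simp add: linear_add[OF linear_lam_h])
  \<comment> \<open>The curvature at \<open>coder lam_g x\<close> also contains
    \<open>h (lam_g (coder lam_g x))\<close>. This vanishes, as the projection by
    \<open>\<pi>\<close> of the corresponding identity for \<open>lam_h\<close>.\<close>
  moreover have "lam_g (coder lam_g x) = 0"
  proof -
    have "\<pi> (lam_h (coder lam_h (sym_map h x))) = lam_g (coder lam_g x)"
      by (simp only: pi_lam_h pi_morphism sym_map_section[OF h])
    then show ?thesis by (simp add: lam_h_coder linear_0[OF linear_pi])
  qed
  ultimately have "\<iota> (nab h 1 (curv h) x) = \<iota> 0"
    unfolding iota_nab[OF h K] iota_curv[OF h]
    by (simp add: linear_0[OF linear_iota] linear_0[OF Hom_linear[OF F]] iota_curv[OF h] flip: iota_curv[OF h])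
  then show ?thesis by (rule injD[OF inj_iota])
qed

subsection \<open>Changing the section\<close>

definition path :: "('g shift \<Rightarrow> 'h shift) \<Rightarrow> ('g shift \<Rightarrow> 'h shift) \<Rightarrow> real \<Rightarrow> 'g shift \<Rightarrow> 'h shift" where
  "path h h' t v = h v + t *\<^sub>R (h' v - h v)"

definition section_diff :: "('g shift \<Rightarrow> 'h shift) \<Rightarrow> ('g shift \<Rightarrow> 'h shift) \<Rightarrow> 'g shift sym \<Rightarrow> 'n shift" where
  "section_diff h h' x = inv \<iota> (h' (sym_proj x) - h (sym_proj x))"

lemma Hom_sym_proj: "sym_proj \<in> Hom 0"
proof (rule Hom_symI[OF linear_sym_proj])
  fix ds and vs :: "'a list" assume "homogeneous ds vs"
  then show "sym_proj (sprod vs) \<in> gcomp (sum_list ds + 0)"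
    by (auto simp: sym_proj_sprod list_all2_Cons2 split: list.splits)
qed

context
  fixes h h' :: "'g shift \<Rightarrow> 'h shift"
  assumes h: "is_section \<pi> h" and h': "is_section \<pi> h'"
begin

lemma is_section_path: "is_section \<pi> (path h h' t)"
  unfolding is_section_def
proof
  show "path h h' t \<in> Hom 0"
  proof (rule HomI)
    show "linear (path h h' t)"
      unfolding path_def[abs_def]
      by (intro linear_compose_add linear_compose_scale_right linear_compose_sub Hom_linear[OF Hom_section] h h')
    show "path h h' t x \<in> gcomp (n + 0)" if "x \<in> gcomp n" for n x
      using Hom_gcomp[OF Hom_section[OF h] that] Hom_gcomp[OF Hom_section[OF h'] that] by (simp add: path_def)
  qed
  show "\<pi> \<circ> path h h' t = id"
    by (simp add: fun_eq_iff path_def linear_add[OF linear_pi] linear_scale[OF linear_pi] linear_diff[OF linear_pi]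
        pi_section[OF h] pi_section[OF h'])
qed

lemma iota_section_diff: "\<iota> (section_diff h h' x) = h' (sym_proj x) - h (sym_proj x)"
  by (simp add: section_diff_def iota_inv linear_diff[OF linear_pi] pi_section[OF h] pi_section[OF h'])

lemma Hom_section_diff: "section_diff h h' \<in> Hom 0"
  by (rule Hom_iota_cancel, unfold iota_section_diff)
    (use Hom_compose[OF Hom_section[OF h] Hom_sym_proj] Hom_compose[OF Hom_section[OF h'] Hom_sym_proj]
      in \<open>simp add: Hom_diff\<close>)

lemma has_poly_deriv_path: "has_poly_deriv (\<lambda>t. path h h' t v) (\<lambda>t. h' v - h v)"
  unfolding path_def using has_poly_deriv.add[OF has_poly_deriv_const has_poly_deriv_ident] by simp

text \<open>Differentiating a word replaces one letter at a time by \<open>h' v - h v\<close>. The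
  sum over all letters is the coderivation along the moving map whose corestriction is the
  difference of the sections.\<close>

lemma has_poly_deriv_sym_map:
  "has_poly_deriv (\<lambda>t. sym_map (path h h' t) x)
    (\<lambda>t. conv 0 smul (\<lambda>x. \<iota> (section_diff h h' x)) (sym_map (path h h' t)) x)"
proof -
  note H = Hom_section[OF is_section_path]
  note linS = linear_sym_map[OF H]
  let ?b = "\<lambda>x. \<iota> (section_diff h h' x)"
  have b: "?b \<in> Hom 0" using Hom_compose[OF Hom_iota Hom_section_diff] by simp
  note linE = linear_conv[OF bilinear_smul Hom_linear[OF b] linS]
  show ?thesis
  proof (induction x rule: sym_induct_homogeneous)
    case subspace
    show ?case
      by (rule subspaceI; unfold mem_Collect_eq linear_0[OF linS] linear_add[OF linS] linear_scale[OF linS]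
          linear_0[OF linE] linear_add[OF linE] linear_scale[OF linE])
        (rule has_poly_deriv_const has_poly_deriv.add has_poly_deriv_linear[OF _ linear_compose_scale_right[OF linear_ident]];
          assumption)+
  next
    case (sprod ds vs)
    then show ?case
    proof (induction rule: list_all2_induct)
      case Nil
      have "conv 0 smul ?b (sym_map (path h h' t)) sym_unit = 0" for t
        unfolding conv_unit[OF bilinear_smul Hom_linear[OF b] linS]
        by (simp add: iota_section_diff sym_proj_unit linear_0[OF Hom_linear[OF Hom_section]] h h' linear_0[OF linear_smul_left])
      then show ?case
        by (simp add: sym_map_unit[OF H] has_poly_deriv_const flip: sym_unit_def)
    next
      case (Cons d ds v vs)
      have v: "path h h' t v \<in> gcomp d" for t using Hom_gcomp[OF H Cons.hyps(1)] by simp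
      \<comment> \<open>The contraction of the difference with \<open>v\<close> is a multiple of the
        counit, so its convolution is plain multiplication by \<open>h' v - h v\<close>.\<close>
      have "?b (smul v x) = counit x *\<^sub>R (h' v - h v)" for x
        by (simp add: iota_section_diff sym_proj_smul linear_scale[OF Hom_linear[OF Hom_section]] h h' scaleR_diff_right)
      then have "conv 0 smul ?b (sym_map (path h h' t)) (sprod (v # vs)) =
          smul (h' v - h v) (sym_map (path h h' t) (sprod vs)) +
          smul (path h h' t v) (conv 0 smul ?b (sym_map (path h h' t)) (sprod vs))" for t
        using conv_smul_out[OF b linS v[of t], of 0 t "sprod vs"]
        by (simp add: conv_smul[OF bilinear_smul Hom_linear[OF b] linS Cons.hyps(1)] sym_map_smul[OF H]
            conv_counit_left[OF bilinear_smul linS] flip: smul_sprod)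
      then show ?case
        using has_poly_deriv_bilinear[OF bilinear_smul has_poly_deriv_path Cons.IH, of v]
        by (simp add: sym_map_smul[OF H] flip: smul_sprod)
    qed
  qed
qed

text \<open>The first term of the curvature is differentiated by
  \<open>has_poly_deriv_sym_map\<close>. The second, \<open>path h h' t (lam_g x)\<close>, has
  derivative \<open>h' (lam_g x) - h (lam_g x)\<close>; by \<open>sym_proj_coder\<close> this is the
  difference of the sections evaluated at \<open>coder lam_g x\<close>, the other half of the
  covariant differential.\<close>

lemma has_poly_deriv_curv:
  "has_poly_deriv (\<lambda>t. curv (path h h' t) x) (\<lambda>t. nab (path h h' t) 0 (section_diff h h') x)"
proof -
  \<comment> \<open>Carrying the derivative back along \<open>\<iota>\<close> needs a linear left
    inverse; \<open>inv \<iota>\<close> need not be linear outside the range of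
    \<open>\<iota>\<close>.\<close>
  obtain r where r: "linear r" "r \<circ> \<iota> = id"
    using linear_injective_left_inverse[OF linear_iota inj_iota] by blast
  then have r\<iota>: "r (\<iota> u) = u" for u by (simp add: fun_eq_iff)
  have "has_poly_deriv (\<lambda>t. \<iota> (curv (path h h' t) x)) (\<lambda>t. \<iota> (nab (path h h' t) 0 (section_diff h h') x))"
    unfolding iota_curv[OF is_section_path] iota_nab[OF is_section_path Hom_section_diff]
    using has_poly_deriv_diff[OF has_poly_deriv_linear[OF has_poly_deriv_sym_map linear_lam_h] has_poly_deriv_path]
    by (simp add: iota_section_diff sym_proj_coder[OF linear_lam_g])
  from has_poly_deriv_linear[OF this r(1)] show ?thesis by (simp add: r\<iota>)
qed

end

end

section \<open>The cocycle and the independence of its class\<close>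

lemma char_cochain_eq:
  "linear K \<Longrightarrow> k \<ge> 1 \<Longrightarrow> char_cochain f K k = (\<lambda>x. f (wedge_proj (cochain_power K k x)))"
  by (simp add: char_cochain_def fun_eq_iff curv_power_eq)

lemma coboundaries_add:
  assumes \<rho>: "linear \<rho>" and "\<alpha> \<in> coboundaries lam \<rho> q" "\<beta> \<in> coboundaries lam \<rho> q"
  shows "(\<lambda>x. \<alpha> x + \<beta> x) \<in> coboundaries lam \<rho> q"
proof -
  obtain a b where a: "a \<in> Hom (q - 1)" "\<alpha> = D lam \<rho> (q - 1) a" and b: "b \<in> Hom (q - 1)" "\<beta> = D lam \<rho> (q - 1) b"
    using assms(2,3) by (auto simp: coboundaries_def)
  have "(\<lambda>x. \<alpha> x + \<beta> x) = D lam \<rho> (q - 1) (\<lambda>x. a x + b x)"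
    using a b by (simp add: fun_eq_iff D_add[OF \<rho>] Hom_linear)
  moreover have "(\<lambda>x. a x + b x) \<in> Hom (q - 1)"
    using a b by (intro HomI) (auto intro: linear_compose_add Hom_linear simp: Hom_gcomp)
  ultimately show ?thesis by (simp add: coboundaries_def)
qed

context extension_context
begin

context
  fixes \<rho> :: "'g shift sym \<otimes> 'v::graded_vector \<Rightarrow> 'v" and f :: "'n shift wedge \<Rightarrow> 'v" and k :: nat and p :: int
  assumes \<rho>: "\<rho> \<in> Hom 1" and k: "k \<ge> 1" and f: "f \<in> invariant_maps lam_h \<iota> \<pi> \<rho> k p"
begin

lemma Hom_f: "f \<in> Hom p"
  using f by (simp add: invariant_maps_def)

lemmas linear_f = linear_comp[OF Hom_linear[OF Hom_f] linear_wedge_proj]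

lemma D_f:
  assumes h: "is_section \<pi> h" and \<beta>: "linear \<beta>"
  shows "D lam_g \<rho> (p + q) (\<lambda>x. f (wedge_proj (\<beta> x))) x = msgn p *\<^sub>R f (wedge_proj (nabla ad (sym_map h) lam_g q \<beta> x))"
  by (rule D_invariant[OF Hom_ad \<rho> Hom_sym_map[OF Hom_section[OF h]] Hom_lam_g Hom_pi sym_map_section[OF h] Hom_f _ \<beta>])
    (use f in \<open>simp add: invariant_maps_def\<close>)

lemma Hom_f_compose: "\<beta> \<in> Hom q \<Longrightarrow> (\<lambda>x. f (wedge_proj (\<beta> x))) \<in> Hom (p + q)"
  using Hom_compose[OF Hom_f Hom_compose[OF Hom_wedge_proj]] by simp

lemma char_cochain_cocycle:
  assumes h: "is_section \<pi> h"
  shows "char_cochain f (curv h) k \<in> cocycles lam_g \<rho> (p + int k)"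
proof -
  note K = Hom_curv[OF h]
  note S = Hom_sym_map[OF Hom_section[OF h]]
  have "D lam_g \<rho> (p + int k) (\<lambda>x. f (wedge_proj (cochain_power (curv h) k x))) x = 0" for x
    unfolding D_f[OF h linear_cochain_power[OF Hom_linear[OF K]]]
      nabla_cochain_power[OF Hom_ad S Hom_lam_g K bianchi[OF h]]
    by (simp add: linear_0[OF linear_f])
  then show ?thesis
    unfolding char_cochain_eq[OF Hom_linear[OF K] k] cocycles_def
    by (simp add: Hom_f_compose[OF Hom_cochain_power[OF K]])
qed

lemma char_cochain_diff:
  assumes h: "is_section \<pi> h" and h': "is_section \<pi> h'"
  shows "(\<lambda>x. char_cochain f (curv h') k x - char_cochain f (curv h) k x) \<in> coboundaries lam_g \<rho> (p + int k)"
proof -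
  define H where "H t = path h h' t" for t
  define K where "K t = curv (H t)" for t
  define b where "b = section_diff h h'"
  define Q where "Q t x = f (wedge_proj (cochain_power_primitive (K t) b k x))" for t x
  note lr = Hom_linear[OF \<rho>]
  have sec: "is_section \<pi> (H t)" for t unfolding H_def by (rule is_section_path[OF h h'])
  note S = Hom_sym_map[OF Hom_section[OF sec]]
  have K: "K t \<in> Hom 1" for t unfolding K_def by (rule Hom_curv[OF sec])
  have b: "b \<in> Hom 0" unfolding b_def by (rule Hom_section_diff[OF h h'])
  have dK: "has_poly_deriv (\<lambda>t. K t x) (\<lambda>t. nab (H t) 0 b x)" for x
    unfolding K_def H_def b_def by (rule has_poly_deriv_curv[OF h h'])
  have H01: "H 0 = h" "H 1 = h'" by (auto simp: H_def path_def fun_eq_iff)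
  have PK: "polynomial_curve (\<lambda>t. cochain_power_primitive (K t) b k x)" for x
    by (rule polynomial_curve_cochain_power_primitive[OF K _ b]) (use dK in \<open>auto simp: polynomial_curve_def\<close>)
  have Q: "Q t \<in> Hom (p + int k - 1)" "linear (Q t)" for t
    using Hom_f_compose[OF Hom_cochain_power_primitive[OF K b], of t k] Hom_linear
    unfolding Q_def[abs_def] by (auto simp: add_diff_eq)
  have PQ: "polynomial_curve (\<lambda>t. Q t x)" for x
    unfolding Q_def by (rule polynomial_curve_linear[OF PK linear_f])
  have DQ: "D lam_g \<rho> (p + int k - 1) (Q t) x =
      msgn p *\<^sub>R f (wedge_proj (cochain_power_deriv (K t) (nab (H t) 0 b) k x))" for t x
    using D_f[OF sec[of t] Hom_linear[OF Hom_cochain_power_primitive[OF K[of t] b, of k]], of "int k - 1" x]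
      nabla_cochain_power_primitive[OF Hom_ad S[of t] Hom_lam_g K[of t] bianchi[OF sec[of t], folded K_def] b, of k x]
    by (simp add: Q_def[abs_def] add_diff_eq)
  \<comment> \<open>The factor \<open>msgn p\<close> of the primitive compensates the sign in
    \<open>D_f\<close>, its square being 1.\<close>
  have "char_cochain f (curv h') k x - char_cochain f (curv h) k x =
      D lam_g \<rho> (p + int k - 1) (\<lambda>x. msgn p *\<^sub>R poly_integral (\<lambda>t. Q t x)) x" for x
  proof -
    have dF: "has_poly_deriv (\<lambda>t. f (wedge_proj (cochain_power (K t) k x)))
        (\<lambda>t. f (wedge_proj (cochain_power_deriv (K t) (nab (H t) 0 b) k x)))"
      by (intro has_poly_deriv_linear[OF _ linear_f] has_poly_deriv_cochain_power Hom_linear[OF K] dK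
          linear_nabla1[OF Hom_ad S Hom_lam_g Hom_linear[OF b]])
    have "D lam_g \<rho> (p + int k - 1) (\<lambda>x. msgn p *\<^sub>R poly_integral (\<lambda>t. Q t x)) x =
        msgn p *\<^sub>R poly_integral (\<lambda>t. D lam_g \<rho> (p + int k - 1) (Q t) x)"
      by (simp add: D_scale[OF lr linear_poly_integral[OF Q(2) PQ]] D_poly_integral[OF lr Q(2) PQ])
    also have "\<dots> = f (wedge_proj (cochain_power (K 1) k x)) - f (wedge_proj (cochain_power (K 0) k x))"
      unfolding DQ
      using poly_integral_deriv[OF has_poly_deriv_linear[OF dF linear_compose_scale_right[OF linear_ident, of "msgn p"]]]
      by (simp add: scaleR_diff_right)
    finally show ?thesis
      by (simp add: char_cochain_eq[OF Hom_linear[OF Hom_curv] k] h h' K_def H01)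
  qed
  moreover have "(\<lambda>x. msgn p *\<^sub>R poly_integral (\<lambda>t. Q t x)) \<in> Hom (p + int k - 1)"
  proof (rule HomI)
    note G = Hom_poly_integral[OF Q(1) PQ]
    show "linear (\<lambda>x. msgn p *\<^sub>R poly_integral (\<lambda>t. Q t x))"
      by (rule linear_compose_scale_right[OF Hom_linear[OF G]])
    show "msgn p *\<^sub>R poly_integral (\<lambda>t. Q t x) \<in> gcomp (n + (p + int k - 1))" if "x \<in> gcomp n" for n x
      using Hom_gcomp[OF G that] by simp
  qed
  ultimately show ?thesis
    unfolding coboundaries_def image_def by (auto simp: fun_eq_iff)
qed

lemma coh_class_section:
  assumes h: "is_section \<pi> h" and h': "is_section \<pi> h'"
  shows "coh_class lam_g \<rho> (p + int k) (char_cochain f (curv h) k) =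
    coh_class lam_g \<rho> (p + int k) (char_cochain f (curv h') k)"
proof -
  \<comment> \<open>The claim is made for arbitrary sections, so that exchanging them yields both
    inclusions of the cosets.\<close>
  have "(\<lambda>x. \<beta> x - char_cochain f (curv h') k x) \<in> coboundaries lam_g \<rho> (p + int k)"
    if "(\<lambda>x. \<beta> x - char_cochain f (curv h) k x) \<in> coboundaries lam_g \<rho> (p + int k)"
      "is_section \<pi> h" "is_section \<pi> h'" for \<beta> h h'
    using coboundaries_add[OF Hom_linear[OF \<rho>] that(1) char_cochain_diff[OF that(3,2)]] by simp
  then show ?thesis using h h' unfolding coh_class_def by blast
qed

end

end

theorem theorem4p8:
  fixes lam_n :: "'n::graded_vector shift sym \<Rightarrow> 'n shift"
    and lam_h :: "'h::graded_vector shift sym \<Rightarrow> 'h shift"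
    and lam_g :: "'g::graded_vector shift sym \<Rightarrow> 'g shift"
    and \<iota> :: "'n shift \<Rightarrow> 'h shift" and \<pi> :: "'h shift \<Rightarrow> 'g shift"
    and h :: "'g shift \<Rightarrow> 'h shift"
    and \<rho> :: "'g shift sym \<otimes> 'v::graded_vector \<Rightarrow> 'v"
    and f :: "'n shift wedge \<Rightarrow> 'v"
    and k :: nat and p :: int
  assumes "linf_extension lam_n lam_h lam_g \<iota> \<pi>"
    and "is_section \<pi> h"
    and "ruth lam_g \<rho>"
    and "k \<ge> 1"
    and "f \<in> invariant_maps lam_h \<iota> \<pi> \<rho> k p"
  shows "char_cochain f (curvature lam_h lam_g \<iota> h) k \<in> cocycles lam_g \<rho> (p + int k) \<and>
    (\<forall>h'. is_section \<pi> h' \<longrightarrow>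
       coh_class lam_g \<rho> (p + int k) (char_cochain f (curvature lam_h lam_g \<iota> h) k) =
       coh_class lam_g \<rho> (p + int k) (char_cochain f (curvature lam_h lam_g \<iota> h') k))"
proof -
  interpret extension_context lam_n lam_h lam_g \<iota> \<pi> by unfold_locales (rule assms(1))
  have \<rho>: "\<rho> \<in> Hom 1" using assms(3) by (simp add: ruth_def)
  show ?thesis
    using char_cochain_cocycle[OF \<rho> assms(4,5,2)] coh_class_section[OF \<rho> assms(4,5,2)] by blast
qed

end
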